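(* Let $(\mathcal{C},\mathcal{W})$ be a relative category that has finite limits and colimits and proper factorizations. Then $(\mathcal{C},\mathcal{W})$ is admissible. In particular, if $\mathcal{C}$ is a proper model category (with $\mathcal{W}$ its class of weak equivalences), then $(\mathcal{C},\mathcal{W})$ is admissible.
   Context: A relative category is a pair $(\mathcal{C},\mathcal{W})$ of a category $\mathcal{C}$ and a subcategory $\mathcal{W}\subseteq\mathcal{C}$ (the weak equivalences) containing all isomorphisms and satisfying the two out of three property. A map $f:A\to B$ in $\mathcal{C}$ is left proper if for every pushout square in $\mathcal{C}$ with $i:A\to C$ a weak equivalence and $j:B\to D$ its cobase change along $f$, the map $j$ is a weak equivalence; it is right proper if for every pullback square with $i:D\to B$ a weak equivalence and $j:C\to A$ its base change along $f$, the map $j$ is a weak equivalence. $LP$ and $RP$ denote the classes of left proper and right proper maps. For classes $M,N$ of morphisms, $\mathrm{Mor}(\mathcal{C})=M\circ N$ means every morphism factors as a map in $N$ followed by a map in $M$. $(\mathcal{C},\mathcal{W})$ has proper factorizations if $\mathrm{Mor}(\mathcal{C})=RP\circ LP$, $\mathrm{Mor}(\mathcal{C})=RP\circ\mathcal{W}$ and $\mathrm{Mor}(\mathcal{C})=\mathcal{W}\circ LP$. $\mathrm{Pro}(\mathcal{C})$ has as objects diagrams $I\to\mathcal{C}$ with $I$ small cofiltered, and $\mathrm{Hom}(X,Y)=\lim_s\mathrm{colim}_t\mathrm{Hom}_{\mathcal{C}}(X_t,Y_s)$. $\mathrm{Ind}(\mathcal{C})$ has as objects diagrams $I\to\mathcal{C}$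 with $I$ small filtered, and $\mathrm{Hom}(X,Y)=\lim_s\mathrm{colim}_t\mathrm{Hom}_{\mathcal{C}}(X_s,Y_t)$. A natural transformation between diagrams with the same index category induces a morphism. $Lw^{\cong}(\mathcal{W})$ is the class of morphisms of $\mathrm{Pro}(\mathcal{C})$ (resp. $\mathrm{Ind}(\mathcal{C})$) that are isomorphic, in the category of morphisms, to one induced by a natural transformation all of whose components are in $\mathcal{W}$. $(\mathcal{C},\mathcal{W})$ is pro-admissible (resp. ind-admissible) if $Lw^{\cong}(\mathcal{W})$ satisfies the two out of three property in $\mathrm{Pro}(\mathcal{C})$ (resp. $\mathrm{Ind}(\mathcal{C})$), and admissible if it is both. *)

theory Defs
  imports Main "HOL-Library.FuncSet"
begin

section \<open>Categories\<close>

record ('o, 'a) cat =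
  obj :: "'o set"
  arr :: "'a set"
  src :: "'a \<Rightarrow> 'o"
  tgt :: "'a \<Rightarrow> 'o"
  ident :: "'o \<Rightarrow> 'a"
  cmp :: "'a \<Rightarrow> 'a \<Rightarrow> 'a"  (infixl "\<cdot>\<index>" 70)

definition hom :: "('o, 'a) cat \<Rightarrow> 'o \<Rightarrow> 'o \<Rightarrow> 'a set" where
  "hom C A B = {f \<in> arr C. src C f = A \<and> tgt C f = B}"

text \<open>Composition is written in the usual order: \<open>g \<cdot> f\<close> is \<open>f\<close> followed by \<open>g\<close>.\<close>

locale category =
  fixes C :: "('o, 'a) cat" (structure)
  assumes src_obj: "f \<in> arr C \<Longrightarrow> src C f \<in> obj C"
    and tgt_obj: "f \<in> arr C \<Longrightarrow> tgt C f \<in> obj C"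
    and ident_hom: "A \<in> obj C \<Longrightarrow> ident C A \<in> hom C A A"
    and cmp_hom: "f \<in> hom C A B \<Longrightarrow> g \<in> hom C B D \<Longrightarrow> g \<cdot> f \<in> hom C A D"
    and cmp_ident_right: "f \<in> hom C A B \<Longrightarrow> f \<cdot> ident C A = f"
    and cmp_ident_left: "f \<in> hom C A B \<Longrightarrow> ident C B \<cdot> f = f"
    and cmp_assoc: "f \<in> hom C A B \<Longrightarrow> g \<in> hom C B D \<Longrightarrow> h \<in> hom C D E \<Longrightarrow>
                      h \<cdot> (g \<cdot> f) = (h \<cdot> g) \<cdot> f"

definition isos :: "('o, 'a) cat \<Rightarrow> 'a set" where
  "isos C = {f \<in> arr C. \<exists>g \<in> hom C (tgt C f) (src C f).
     g \<cdot>\<^bsub>C\<^esub> f = ident C (src C f) \<and> f \<cdot>\<^bsub>C\<^esub> g = ident C (tgt C f)}"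

definition isomorphic :: "('o, 'a) cat \<Rightarrow> 'o \<Rightarrow> 'o \<Rightarrow> bool" where
  "isomorphic C A B \<longleftrightarrow> (\<exists>f \<in> isos C. f \<in> hom C A B)"

definition is_retract :: "('o, 'a) cat \<Rightarrow> 'o \<Rightarrow> 'o \<Rightarrow> bool" where
  "is_retract C A B \<longleftrightarrow> (\<exists>s \<in> hom C A B. \<exists>r \<in> hom C B A. r \<cdot>\<^bsub>C\<^esub> s = ident C A)"

text \<open>The category of morphisms: an arrow \<open>(f, (a, b), g)\<close> from \<open>f\<close> to \<open>g\<close> is a commutative
  square with \<open>a\<close> between the sources and \<open>b\<close> between the targets.\<close>

definition arrow_cat :: "('o, 'a) cat \<Rightarrow> ('a, 'a \<times> ('a \<times> 'a) \<times> 'a) cat" where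
  "arrow_cat C = \<lparr>
     obj = arr C,
     arr = {(f, (a, b), g). f \<in> arr C \<and> g \<in> arr C \<and>
              a \<in> hom C (src C f) (src C g) \<and> b \<in> hom C (tgt C f) (tgt C g) \<and>
              b \<cdot>\<^bsub>C\<^esub> f = g \<cdot>\<^bsub>C\<^esub> a},
     src = (\<lambda>(f, ab, g). f),
     tgt = (\<lambda>(f, ab, g). g),
     ident = (\<lambda>f. (f, (ident C (src C f), ident C (tgt C f)), f)),
     cmp = (\<lambda>(g', (a', b'), h) (f, (a, b), g). (f, (a' \<cdot>\<^bsub>C\<^esub> a, b' \<cdot>\<^bsub>C\<^esub> b), h)) \<rparr>"

definition two_out_of_three :: "('o, 'a) cat \<Rightarrow> 'a set \<Rightarrow> bool" where
  "two_out_of_three C W \<longleftrightarrow>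
     (\<forall>f \<in> arr C. \<forall>g \<in> arr C. tgt C f = src C g \<longrightarrow>
        (f \<in> W \<and> g \<in> W \<longrightarrow> g \<cdot>\<^bsub>C\<^esub> f \<in> W) \<and>
        (f \<in> W \<and> g \<cdot>\<^bsub>C\<^esub> f \<in> W \<longrightarrow> g \<in> W) \<and>
        (g \<in> W \<and> g \<cdot>\<^bsub>C\<^esub> f \<in> W \<longrightarrow> f \<in> W))"

section \<open>Diagrams and finite (co)limits\<close>

record ('i, 'j, 'o, 'a) diag =
  shape :: "('i, 'j) cat"
  ob :: "'i \<Rightarrow> 'o"
  ar :: "'j \<Rightarrow> 'a"

definition is_diagram :: "('o, 'a) cat \<Rightarrow> ('i, 'j, 'o, 'a) diag \<Rightarrow> bool" where
  "is_diagram C X \<longleftrightarrow>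
     category (shape X) \<and>
     (\<forall>s \<in> obj (shape X). ob X s \<in> obj C \<and> ar X (ident (shape X) s) = ident C (ob X s)) \<and>
     (\<forall>s t. \<forall>u \<in> hom (shape X) s t. ar X u \<in> hom C (ob X s) (ob X t)) \<and>
     (\<forall>r s t. \<forall>u \<in> hom (shape X) r s. \<forall>v \<in> hom (shape X) s t.
        ar X (v \<cdot>\<^bsub>shape X\<^esub> u) = ar X v \<cdot>\<^bsub>C\<^esub> ar X u)"

definition is_cone :: "('o, 'a) cat \<Rightarrow> ('i, 'j, 'o, 'a) diag \<Rightarrow> 'o \<Rightarrow> ('i \<Rightarrow> 'a) \<Rightarrow> bool" where
  "is_cone C X L p \<longleftrightarrow> L \<in> obj C \<and>
     (\<forall>s \<in> obj (shape X). p s \<in> hom C L (ob X s)) \<and>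
     (\<forall>s t. \<forall>u \<in> hom (shape X) s t. ar X u \<cdot>\<^bsub>C\<^esub> p s = p t)"

definition is_limit :: "('o, 'a) cat \<Rightarrow> ('i, 'j, 'o, 'a) diag \<Rightarrow> 'o \<Rightarrow> ('i \<Rightarrow> 'a) \<Rightarrow> bool" where
  "is_limit C X L p \<longleftrightarrow> is_cone C X L p \<and>
     (\<forall>M q. is_cone C X M q \<longrightarrow>
        (\<exists>!h. h \<in> hom C M L \<and> (\<forall>s \<in> obj (shape X). p s \<cdot>\<^bsub>C\<^esub> h = q s)))"

definition is_cocone :: "('o, 'a) cat \<Rightarrow> ('i, 'j, 'o, 'a) diag \<Rightarrow> 'o \<Rightarrow> ('i \<Rightarrow> 'a) \<Rightarrow> bool" where
  "is_cocone C X L p \<longleftrightarrow> L \<in> obj C \<and>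
     (\<forall>s \<in> obj (shape X). p s \<in> hom C (ob X s) L) \<and>
     (\<forall>s t. \<forall>u \<in> hom (shape X) s t. p t \<cdot>\<^bsub>C\<^esub> ar X u = p s)"

definition is_colimit :: "('o, 'a) cat \<Rightarrow> ('i, 'j, 'o, 'a) diag \<Rightarrow> 'o \<Rightarrow> ('i \<Rightarrow> 'a) \<Rightarrow> bool" where
  "is_colimit C X L p \<longleftrightarrow> is_cocone C X L p \<and>
     (\<forall>M q. is_cocone C X M q \<longrightarrow>
        (\<exists>!h. h \<in> hom C L M \<and> (\<forall>s \<in> obj (shape X). h \<cdot>\<^bsub>C\<^esub> p s = q s)))"

text \<open>Every finite category is isomorphic to one whose objects and arrows are natural numbers.\<close>

definition is_finite_diagram :: "('o, 'a) cat \<Rightarrow> (nat, nat, 'o, 'a) diag \<Rightarrow> bool" where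
  "is_finite_diagram C X \<longleftrightarrow>
     is_diagram C X \<and> finite (obj (shape X)) \<and> finite (arr (shape X))"

definition has_finite_limits :: "('o, 'a) cat \<Rightarrow> bool" where
  "has_finite_limits C \<longleftrightarrow> (\<forall>X. is_finite_diagram C X \<longrightarrow> (\<exists>L p. is_limit C X L p))"

definition has_finite_colimits :: "('o, 'a) cat \<Rightarrow> bool" where
  "has_finite_colimits C \<longleftrightarrow> (\<forall>X. is_finite_diagram C X \<longrightarrow> (\<exists>L p. is_colimit C X L p))"

text \<open>\<open>is_pushout C f i j k\<close> and \<open>is_pullback C f i j k\<close> refer, respectively, to the squares
  \begin{verbatim}
    A --f--> B          C --k--> D
    |        |          |        |
    i        j          j        i
    v        v          v        v
    C --k--> D          A --f--> B
  \end{verbatim}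
  so that \<open>j\<close> is the (co)base change of \<open>i\<close> along \<open>f\<close>.\<close>

definition is_pushout :: "('o, 'a) cat \<Rightarrow> 'a \<Rightarrow> 'a \<Rightarrow> 'a \<Rightarrow> 'a \<Rightarrow> bool" where
  "is_pushout C f i j k \<longleftrightarrow>
     f \<in> arr C \<and> i \<in> arr C \<and> j \<in> arr C \<and> k \<in> arr C \<and>
     src C f = src C i \<and> src C j = tgt C f \<and> src C k = tgt C i \<and> tgt C j = tgt C k \<and>
     j \<cdot>\<^bsub>C\<^esub> f = k \<cdot>\<^bsub>C\<^esub> i \<and>
     (\<forall>T. \<forall>u \<in> hom C (tgt C f) T. \<forall>v \<in> hom C (tgt C i) T. u \<cdot>\<^bsub>C\<^esub> f = v \<cdot>\<^bsub>C\<^esub> i \<longrightarrow>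
        (\<exists>!h. h \<in> hom C (tgt C j) T \<and> h \<cdot>\<^bsub>C\<^esub> j = u \<and> h \<cdot>\<^bsub>C\<^esub> k = v))"

definition is_pullback :: "('o, 'a) cat \<Rightarrow> 'a \<Rightarrow> 'a \<Rightarrow> 'a \<Rightarrow> 'a \<Rightarrow> bool" where
  "is_pullback C f i j k \<longleftrightarrow>
     f \<in> arr C \<and> i \<in> arr C \<and> j \<in> arr C \<and> k \<in> arr C \<and>
     tgt C f = tgt C i \<and> tgt C j = src C f \<and> tgt C k = src C i \<and> src C j = src C k \<and>
     f \<cdot>\<^bsub>C\<^esub> j = i \<cdot>\<^bsub>C\<^esub> k \<and>
     (\<forall>T. \<forall>u \<in> hom C T (src C f). \<forall>v \<in> hom C T (src C i). f \<cdot>\<^bsub>C\<^esub> u = i \<cdot>\<^bsub>C\<^esub> v \<longrightarrow>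
        (\<exists>!h. h \<in> hom C T (src C j) \<and> j \<cdot>\<^bsub>C\<^esub> h = u \<and> k \<cdot>\<^bsub>C\<^esub> h = v))"

section \<open>Relative categories and proper factorizations\<close>

definition relative_category :: "('o, 'a) cat \<Rightarrow> 'a set \<Rightarrow> bool" where
  "relative_category C W \<longleftrightarrow>
     category C \<and> W \<subseteq> arr C \<and>
     (\<forall>f \<in> W. \<forall>g \<in> W. tgt C f = src C g \<longrightarrow> g \<cdot>\<^bsub>C\<^esub> f \<in> W) \<and>
     isos C \<subseteq> W \<and> two_out_of_three C W"

definition left_proper_maps :: "('o, 'a) cat \<Rightarrow> 'a set \<Rightarrow> 'a set" where
  "left_proper_maps C W =
     {f \<in> arr C. \<forall>i j k. is_pushout C f i j k \<and> i \<in> W \<longrightarrow> j \<in> W}"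

definition right_proper_maps :: "('o, 'a) cat \<Rightarrow> 'a set \<Rightarrow> 'a set" where
  "right_proper_maps C W =
     {f \<in> arr C. \<forall>i j k. is_pullback C f i j k \<and> i \<in> W \<longrightarrow> j \<in> W}"

definition class_comp :: "('o, 'a) cat \<Rightarrow> 'a set \<Rightarrow> 'a set \<Rightarrow> 'a set" where
  "class_comp C M N = {m \<cdot>\<^bsub>C\<^esub> n | m n. m \<in> M \<and> n \<in> N \<and> tgt C n = src C m}"

definition has_proper_factorizations :: "('o, 'a) cat \<Rightarrow> 'a set \<Rightarrow> bool" where
  "has_proper_factorizations C W \<longleftrightarrow>
     arr C = class_comp C (right_proper_maps C W) (left_proper_maps C W) \<and>
     arr C = class_comp C (right_proper_maps C W) W \<and>
     arr C = class_comp C W (left_proper_maps C W)"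

section \<open>Proper model categories\<close>

definition retract_closed :: "('o, 'a) cat \<Rightarrow> 'a set \<Rightarrow> bool" where
  "retract_closed C M \<longleftrightarrow>
     (\<forall>f g. is_retract (arrow_cat C) f g \<and> f \<in> arr C \<and> g \<in> M \<longrightarrow> f \<in> M)"

definition has_llp :: "('o, 'a) cat \<Rightarrow> 'a \<Rightarrow> 'a \<Rightarrow> bool" where
  "has_llp C i p \<longleftrightarrow>
     (\<forall>u \<in> hom C (src C i) (src C p). \<forall>v \<in> hom C (tgt C i) (tgt C p).
        p \<cdot>\<^bsub>C\<^esub> u = v \<cdot>\<^bsub>C\<^esub> i \<longrightarrow>
        (\<exists>h \<in> hom C (tgt C i) (src C p). h \<cdot>\<^bsub>C\<^esub> i = u \<and> p \<cdot>\<^bsub>C\<^esub> h = v))"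

text \<open>Quillen's axioms for a closed model category.  Only finite limits and colimits are
  required and the factorizations need not be functorial, so this covers the variants of the
  notion that ask for all small (co)limits or for functorial factorizations.\<close>

definition model_category :: "('o, 'a) cat \<Rightarrow> 'a set \<Rightarrow> 'a set \<Rightarrow> 'a set \<Rightarrow> bool" where
  "model_category C W Cof Fib \<longleftrightarrow>
     category C \<and> W \<subseteq> arr C \<and> Cof \<subseteq> arr C \<and> Fib \<subseteq> arr C \<and>
     has_finite_limits C \<and> has_finite_colimits C \<and>
     two_out_of_three C W \<and>
     retract_closed C W \<and> retract_closed C Cof \<and> retract_closed C Fib \<and>
     (\<forall>i \<in> Cof \<inter> W. \<forall>p \<in> Fib. has_llp C i p) \<and>
     (\<forall>i \<in> Cof. \<forall>p \<in> Fib \<inter> W. has_llp C i p) \<and>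
     arr C = class_comp C Fib (Cof \<inter> W) \<and>
     arr C = class_comp C (Fib \<inter> W) Cof"

definition proper_model_category :: "('o, 'a) cat \<Rightarrow> 'a set \<Rightarrow> 'a set \<Rightarrow> 'a set \<Rightarrow> bool" where
  "proper_model_category C W Cof Fib \<longleftrightarrow>
     model_category C W Cof Fib \<and>
     (\<forall>f i j k. is_pushout C f i j k \<and> f \<in> Cof \<and> i \<in> W \<longrightarrow> j \<in> W) \<and>
     (\<forall>f i j k. is_pullback C f i j k \<and> f \<in> Fib \<and> i \<in> W \<longrightarrow> j \<in> W)"

section \<open>Pro- and ind-categories\<close>

definition filtered :: "('o, 'a) cat \<Rightarrow> bool" where
  "filtered I \<longleftrightarrow> category I \<and> obj I \<noteq> {} \<and>
     (\<forall>s \<in> obj I. \<forall>t \<in> obj I. \<exists>r \<in> obj I. hom I s r \<noteq> {} \<and> hom I t r \<noteq> {}) \<and>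
     (\<forall>s t. \<forall>u \<in> hom I s t. \<forall>v \<in> hom I s t. \<exists>r. \<exists>w \<in> hom I t r. w \<cdot>\<^bsub>I\<^esub> u = w \<cdot>\<^bsub>I\<^esub> v)"

definition cofiltered :: "('o, 'a) cat \<Rightarrow> bool" where
  "cofiltered I \<longleftrightarrow> category I \<and> obj I \<noteq> {} \<and>
     (\<forall>s \<in> obj I. \<forall>t \<in> obj I. \<exists>r \<in> obj I. hom I r s \<noteq> {} \<and> hom I r t \<noteq> {}) \<and>
     (\<forall>s t. \<forall>u \<in> hom I s t. \<forall>v \<in> hom I s t. \<exists>r. \<exists>w \<in> hom I r s. u \<cdot>\<^bsub>I\<^esub> w = v \<cdot>\<^bsub>I\<^esub> w)"

text \<open>Smallness is rendered by a type \<open>'u\<close>: an index category is small if its objects and its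
  arrows are elements of \<open>'u\<close>.  No size restriction is imposed on the category \<open>C\<close>.
  The type \<open>'u\<close> is meant to be infinite but otherwise arbitrary: finitely many index
  categories that are small with respect to some universe are, up to isomorphism, all small in
  this sense for a suitable infinite \<open>'u\<close>.\<close>

type_synonym ('u, 'o, 'a) sdiag = "('u, 'u, 'o, 'a) diag"

text \<open>The equivalence relation on \<open>P\<close> generated by \<open>r\<close>.\<close>

definition gen_equiv :: "'p set \<Rightarrow> ('p \<times> 'p) set \<Rightarrow> ('p \<times> 'p) set" where
  "gen_equiv P r = (r \<union> r\<inverse>)\<^sup>* \<inter> P \<times> P"

text \<open>The set \<open>colim\<^sub>t Hom(X\<^sub>t, B)\<close> is the quotient of the pairs \<open>(t, f)\<close> with \<open>f : X\<^sub>t \<rightarrow> B\<close> by the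
  equivalence relation generated by the transition maps.\<close>

definition pro_rep :: "('o, 'a) cat \<Rightarrow> ('u, 'o, 'a) sdiag \<Rightarrow> 'o \<Rightarrow> ('u \<times> 'a) set" where
  "pro_rep C X B = {(t, f). t \<in> obj (shape X) \<and> f \<in> hom C (ob X t) B}"

definition pro_rel ::
  "('o, 'a) cat \<Rightarrow> ('u, 'o, 'a) sdiag \<Rightarrow> 'o \<Rightarrow> (('u \<times> 'a) \<times> ('u \<times> 'a)) set" where
  "pro_rel C X B = gen_equiv (pro_rep C X B)
     {((t, f), (t', f \<cdot>\<^bsub>C\<^esub> ar X a)) | t f t' a. (t, f) \<in> pro_rep C X B \<and> a \<in> hom (shape X) t' t}"

text \<open>An element of \<open>lim\<^sub>s colim\<^sub>t Hom(X\<^sub>t, Y\<^sub>s)\<close> is a family of classes compatible with the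
  transition maps of \<open>Y\<close>.\<close>

definition pro_hom ::
  "('o, 'a) cat \<Rightarrow> ('u, 'o, 'a) sdiag \<Rightarrow> ('u, 'o, 'a) sdiag \<Rightarrow> ('u \<Rightarrow> ('u \<times> 'a) set) set" where
  "pro_hom C X Y =
     {\<phi> \<in> (\<Pi>\<^sub>E s \<in> obj (shape Y). pro_rep C X (ob Y s) // pro_rel C X (ob Y s)).
        \<forall>s s'. \<forall>b \<in> hom (shape Y) s s'. \<forall>(t, f) \<in> \<phi> s. (t, ar Y b \<cdot>\<^bsub>C\<^esub> f) \<in> \<phi> s'}"

definition pro_cat ::
  "('o, 'a) cat \<Rightarrow>
   (('u, 'o, 'a) sdiag, ('u, 'o, 'a) sdiag \<times> ('u \<Rightarrow> ('u \<times> 'a) set) \<times> ('u, 'o, 'a) sdiag) cat" where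
  "pro_cat C = \<lparr>
     obj = {X. is_diagram C X \<and> cofiltered (shape X)},
     arr = {(X, \<phi>, Y). is_diagram C X \<and> cofiltered (shape X) \<and>
              is_diagram C Y \<and> cofiltered (shape Y) \<and> \<phi> \<in> pro_hom C X Y},
     src = (\<lambda>(X, \<phi>, Y). X),
     tgt = (\<lambda>(X, \<phi>, Y). Y),
     ident = (\<lambda>X. (X, (\<lambda>s \<in> obj (shape X). pro_rel C X (ob X s) `` {(s, ident C (ob X s))}), X)),
     cmp = (\<lambda>(Y', \<psi>, Z) (X, \<phi>, Y).
       (X, (\<lambda>r \<in> obj (shape Z). pro_rel C X (ob Z r) ``
              {(t, g \<cdot>\<^bsub>C\<^esub> f) | s t f g. (s, g) \<in> \<psi> r \<and> (t, f) \<in> \<phi> s}), Z)) \<rparr>"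

definition ind_rep :: "('o, 'a) cat \<Rightarrow> 'o \<Rightarrow> ('u, 'o, 'a) sdiag \<Rightarrow> ('u \<times> 'a) set" where
  "ind_rep C A Y = {(t, f). t \<in> obj (shape Y) \<and> f \<in> hom C A (ob Y t)}"

definition ind_rel ::
  "('o, 'a) cat \<Rightarrow> 'o \<Rightarrow> ('u, 'o, 'a) sdiag \<Rightarrow> (('u \<times> 'a) \<times> ('u \<times> 'a)) set" where
  "ind_rel C A Y = gen_equiv (ind_rep C A Y)
     {((t, f), (t', ar Y a \<cdot>\<^bsub>C\<^esub> f)) | t f t' a. (t, f) \<in> ind_rep C A Y \<and> a \<in> hom (shape Y) t t'}"

definition ind_hom ::
  "('o, 'a) cat \<Rightarrow> ('u, 'o, 'a) sdiag \<Rightarrow> ('u, 'o, 'a) sdiag \<Rightarrow> ('u \<Rightarrow> ('u \<times> 'a) set) set" where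
  "ind_hom C X Y =
     {\<phi> \<in> (\<Pi>\<^sub>E s \<in> obj (shape X). ind_rep C (ob X s) Y // ind_rel C (ob X s) Y).
        \<forall>s s'. \<forall>b \<in> hom (shape X) s s'. \<forall>(t, f) \<in> \<phi> s'. (t, f \<cdot>\<^bsub>C\<^esub> ar X b) \<in> \<phi> s}"

definition ind_cat ::
  "('o, 'a) cat \<Rightarrow>
   (('u, 'o, 'a) sdiag, ('u, 'o, 'a) sdiag \<times> ('u \<Rightarrow> ('u \<times> 'a) set) \<times> ('u, 'o, 'a) sdiag) cat" where
  "ind_cat C = \<lparr>
     obj = {X. is_diagram C X \<and> filtered (shape X)},
     arr = {(X, \<phi>, Y). is_diagram C X \<and> filtered (shape X) \<and>
              is_diagram C Y \<and> filtered (shape Y) \<and> \<phi> \<in> ind_hom C X Y},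
     src = (\<lambda>(X, \<phi>, Y). X),
     tgt = (\<lambda>(X, \<phi>, Y). Y),
     ident = (\<lambda>X. (X, (\<lambda>s \<in> obj (shape X). ind_rel C (ob X s) X `` {(s, ident C (ob X s))}), X)),
     cmp = (\<lambda>(Y', \<psi>, Z) (X, \<phi>, Y).
       (X, (\<lambda>s \<in> obj (shape X). ind_rel C (ob X s) Z ``
              {(r, g \<cdot>\<^bsub>C\<^esub> f) | t r f g. (t, f) \<in> \<phi> s \<and> (r, g) \<in> \<psi> t}), Z)) \<rparr>"

section \<open>Admissibility\<close>

definition nat_trans ::
  "('o, 'a) cat \<Rightarrow> ('i, 'j, 'o, 'a) diag \<Rightarrow> ('i, 'j, 'o, 'a) diag \<Rightarrow> ('i \<Rightarrow> 'a) \<Rightarrow> bool" where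
  "nat_trans C X Y \<eta> \<longleftrightarrow>
     is_diagram C X \<and> is_diagram C Y \<and> shape X = shape Y \<and>
     (\<forall>s \<in> obj (shape X). \<eta> s \<in> hom C (ob X s) (ob Y s)) \<and>
     (\<forall>s t. \<forall>u \<in> hom (shape X) s t. \<eta> t \<cdot>\<^bsub>C\<^esub> ar X u = ar Y u \<cdot>\<^bsub>C\<^esub> \<eta> s)"

definition pro_induced where
  "pro_induced C X Y \<eta> =
     (X, (\<lambda>s \<in> obj (shape Y). pro_rel C X (ob Y s) `` {(s, \<eta> s)}), Y)"

definition ind_induced where
  "ind_induced C X Y \<eta> =
     (X, (\<lambda>s \<in> obj (shape X). ind_rel C (ob X s) Y `` {(s, \<eta> s)}), Y)"

definition pro_Lw ::
  "('o, 'a) cat \<Rightarrow> 'a set \<Rightarrow>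
   (('u, 'o, 'a) sdiag \<times> ('u \<Rightarrow> ('u \<times> 'a) set) \<times> ('u, 'o, 'a) sdiag) set" where
  "pro_Lw C W = {f \<in> arr (pro_cat C). \<exists>X Y \<eta>.
     nat_trans C X Y \<eta> \<and> cofiltered (shape X) \<and> (\<forall>s \<in> obj (shape X). \<eta> s \<in> W) \<and>
     isomorphic (arrow_cat (pro_cat C)) f (pro_induced C X Y \<eta>)}"

definition ind_Lw ::
  "('o, 'a) cat \<Rightarrow> 'a set \<Rightarrow>
   (('u, 'o, 'a) sdiag \<times> ('u \<Rightarrow> ('u \<times> 'a) set) \<times> ('u, 'o, 'a) sdiag) set" where
  "ind_Lw C W = {f \<in> arr (ind_cat C). \<exists>X Y \<eta>.
     nat_trans C X Y \<eta> \<and> filtered (shape X) \<and> (\<forall>s \<in> obj (shape X). \<eta> s \<in> W) \<and>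
     isomorphic (arrow_cat (ind_cat C)) f (ind_induced C X Y \<eta>)}"

text \<open>The type argument of the next three definitions is the type \<open>'u\<close> of indices.\<close>

definition pro_admissible :: "'u itself \<Rightarrow> ('o, 'a) cat \<Rightarrow> 'a set \<Rightarrow> bool" where
  "pro_admissible _ C W \<longleftrightarrow>
     two_out_of_three (pro_cat C) (pro_Lw C W
       :: (('u, 'o, 'a) sdiag \<times> ('u \<Rightarrow> ('u \<times> 'a) set) \<times> ('u, 'o, 'a) sdiag) set)"

definition ind_admissible :: "'u itself \<Rightarrow> ('o, 'a) cat \<Rightarrow> 'a set \<Rightarrow> bool" where
  "ind_admissible _ C W \<longleftrightarrow>
     two_out_of_three (ind_cat C) (ind_Lw C W
       :: (('u, 'o, 'a) sdiag \<times> ('u \<Rightarrow> ('u \<times> 'a) set) \<times> ('u, 'o, 'a) sdiag) set)"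

definition admissible :: "'u itself \<Rightarrow> ('o, 'a) cat \<Rightarrow> 'a set \<Rightarrow> bool" where
  "admissible U C W \<longleftrightarrow> pro_admissible U C W \<and> ind_admissible U C W"

end

theory Submission
  imports Defs
begin

text \<open>
  Call an element of \<open>colim\<^sub>t Hom(X\<^sub>t, A)\<close> a germ from the pro-object \<open>X\<close> to the object \<open>A\<close> of \<open>C\<close>.
  Germs out of \<open>X\<close> form a functor from \<open>C\<close> to sets, a morphism \<open>\<phi> : X \<rightarrow> Y\<close> of pro-objects is the same
  thing as a natural transformation from the germs on \<open>Y\<close> to those on \<open>X\<close>, and composition of
  pro-morphisms becomes composition of functions.  The functor of germs is flat: its category of
  elements is cofiltered.  Hence it preserves pullbacks.

  The class \<open>Lw\<^sup>\<cong>(W)\<close> is awkward because two of its members come with unrelated index categories, and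
  factorizations in \<open>C\<close> are not functorial, so that maps cannot be factored levelwise.  The proof
  avoids both problems by a criterion that mentions no index category.  Call \<open>\<phi>\<close> approximable if every
  commutative square from \<open>\<phi>\<close> to a map \<open>f\<close> of \<open>C\<close> factors through a member of \<open>W\<close>, regarded as an
  object of the category of morphisms.  Then \<open>\<phi>\<close> lies in \<open>Lw\<^sup>\<cong>(W)\<close> if and only if it is approximable,
  for any class \<open>W\<close> of maps (\<open>pro_Lw_approximable\<close> and \<open>approximable_pro_Lw\<close>).  A level map in \<open>W\<close> is
  approximable because a square to \<open>f\<close> already starts at some level.  Conversely, choose a small family
  of maps \<open>f\<^sub>c : X\<^sub>t \<rightarrow> Y\<^sub>s\<close> that represent \<open>\<phi>\<close> and are arbitrarily deep, factor each
  \<open>\<phi> \<rightarrow> f\<^sub>c\<close> through some \<open>w\<^sub>c \<in> W\<close>, and note that \<open>\<phi> \<rightarrow> w\<^sub>c\<close> starts at some deeper map.  The maps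
  from \<open>w\<^sub>d\<close> to \<open>w\<^sub>c\<close> that run through \<open>f\<^sub>d\<close> and transition maps of \<open>X\<close> and \<open>Y\<close> then make the \<open>w\<^sub>c\<close>
  a level map interleaved with \<open>\<phi>\<close>, hence isomorphic to it.

  Two out of three for approximable maps is an argument about finitely many maps of \<open>C\<close>.  Each case
  uses one of the three factorizations (\<open>RP \<circ> LP\<close> for composites, \<open>W \<circ> LP\<close> and \<open>RP \<circ> W\<close> for the two
  cancellations) and pushes out or pulls back a member of \<open>W\<close> along a proper map
  (\<open>approximable_cmp\<close>, \<open>approximable_left\<close>, \<open>approximable_right\<close>).  So \<open>C\<close> is pro-admissible.

  The hypotheses are self-dual, and the opposite of the ind-category of \<open>C\<close> is the pro-category of the
  opposite of \<open>C\<close>, so \<open>C\<close> is ind-admissible as well.  In a proper model category the cofibrations are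
  left proper and the fibrations are right proper, so the factorizations of the model structure are
  proper factorizations.
\<close>

section \<open>Arrows, pullbacks and pushouts\<close>

context category
begin

lemma homI: "f \<in> arr C \<Longrightarrow> src C f = A \<Longrightarrow> tgt C f = B \<Longrightarrow> f \<in> hom C A B"
  by (simp add: hom_def)

lemma homD: "f \<in> hom C A B \<Longrightarrow> f \<in> arr C \<and> src C f = A \<and> tgt C f = B"
  by (simp add: hom_def)

lemma hom_obj: "f \<in> hom C A B \<Longrightarrow> A \<in> obj C \<and> B \<in> obj C"
  using src_obj tgt_obj by (auto simp: hom_def)

lemma arr_cmp [simp]:
  assumes "f \<in> arr C" "g \<in> arr C" "tgt C f = src C g"
  shows "g \<cdot> f \<in> arr C" "src C (g \<cdot> f) = src C f" "tgt C (g \<cdot> f) = tgt C g"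
  using cmp_hom[of f "src C f" "tgt C f" g "tgt C g"] assms by (auto simp: hom_def)

lemma arr_ident [simp]:
  assumes "A \<in> obj C"
  shows "ident C A \<in> arr C" "src C (ident C A) = A" "tgt C (ident C A) = A"
  using ident_hom[OF assms] by (auto simp: hom_def)

lemma ident_cmp [simp]:
  "f \<in> arr C \<Longrightarrow> A = src C f \<Longrightarrow> f \<cdot> ident C A = f"
  "f \<in> arr C \<Longrightarrow> B = tgt C f \<Longrightarrow> ident C B \<cdot> f = f"
  using cmp_ident_right[of f "src C f" "tgt C f"] cmp_ident_left[of f "src C f" "tgt C f"]
  by (auto simp: hom_def)

end

lemma pullbackD:
  fixes C :: "('o, 'a) cat" (structure)
  assumes "is_pullback C f i j k" "f \<in> hom C A B" "i \<in> hom C D B"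
  obtains P where "j \<in> hom C P A" "k \<in> hom C P D" "f \<cdot> j = i \<cdot> k"
    "\<And>T u v. u \<in> hom C T A \<Longrightarrow> v \<in> hom C T D \<Longrightarrow> f \<cdot> u = i \<cdot> v \<Longrightarrow>
       \<exists>h \<in> hom C T P. j \<cdot> h = u \<and> k \<cdot> h = v"
    "\<And>T u v h h'. u \<in> hom C T A \<Longrightarrow> v \<in> hom C T D \<Longrightarrow> f \<cdot> u = i \<cdot> v \<Longrightarrow>
       h \<in> hom C T P \<Longrightarrow> j \<cdot> h = u \<Longrightarrow> k \<cdot> h = v \<Longrightarrow>
       h' \<in> hom C T P \<Longrightarrow> j \<cdot> h' = u \<Longrightarrow> k \<cdot> h' = v \<Longrightarrow> h = h'"
proof (rule that[of "src C j"])
  show "j \<in> hom C (src C j) A" "k \<in> hom C (src C j) D" "f \<cdot> j = i \<cdot> k"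
    using assms by (auto simp: is_pullback_def hom_def)
  have A: "A = src C f" and D: "D = src C i" using assms(2,3) by (auto simp: hom_def)
  have un: "\<exists>!h. h \<in> hom C T (src C j) \<and> j \<cdot> h = u \<and> k \<cdot> h = v"
    if "u \<in> hom C T A" "v \<in> hom C T D" "f \<cdot> u = i \<cdot> v" for T u v
    using assms(1) that unfolding is_pullback_def A D by blast
  show "\<exists>h \<in> hom C T (src C j). j \<cdot> h = u \<and> k \<cdot> h = v"
    if "u \<in> hom C T A" "v \<in> hom C T D" "f \<cdot> u = i \<cdot> v" for T u v
    using un[OF that] by blast
  show "h = h'" if "u \<in> hom C T A" "v \<in> hom C T D" "f \<cdot> u = i \<cdot> v"
    "h \<in> hom C T (src C j)" "j \<cdot> h = u" "k \<cdot> h = v"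
    "h' \<in> hom C T (src C j)" "j \<cdot> h' = u" "k \<cdot> h' = v" for T u v h h'
    using un[OF that(1-3)] that(4-) by blast
qed

lemma pushoutD:
  fixes C :: "('o, 'a) cat" (structure)
  assumes "is_pushout C f i j k" "f \<in> hom C A B" "i \<in> hom C A D"
  obtains P where "j \<in> hom C B P" "k \<in> hom C D P" "j \<cdot> f = k \<cdot> i"
    "\<And>T u v. u \<in> hom C B T \<Longrightarrow> v \<in> hom C D T \<Longrightarrow> u \<cdot> f = v \<cdot> i \<Longrightarrow>
       \<exists>h \<in> hom C P T. h \<cdot> j = u \<and> h \<cdot> k = v"
proof (rule that[of "tgt C j"])
  show "j \<in> hom C B (tgt C j)" "k \<in> hom C D (tgt C j)" "j \<cdot> f = k \<cdot> i"
    using assms by (auto simp: is_pushout_def hom_def)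
  have B: "B = tgt C f" and D: "D = tgt C i" using assms(2,3) by (auto simp: hom_def)
  have un: "\<exists>!h. h \<in> hom C (tgt C j) T \<and> h \<cdot> j = u \<and> h \<cdot> k = v"
    if "u \<in> hom C B T" "v \<in> hom C D T" "u \<cdot> f = v \<cdot> i" for T u v
    using assms(1) that unfolding is_pushout_def B D by blast
  show "\<exists>h \<in> hom C (tgt C j) T. h \<cdot> j = u \<and> h \<cdot> k = v"
    if "u \<in> hom C B T" "v \<in> hom C D T" "u \<cdot> f = v \<cdot> i" for T u v
    using un[OF that] by blast
qed

section \<open>Flat set-valued functors\<close>

record ('o, 'a, 'x) set_functor =
  el :: "'o \<Rightarrow> 'x set"
  act :: "'a \<Rightarrow> 'x \<Rightarrow> 'x"

text \<open>A functor to sets is flat if its category of elements is cofiltered.  For germs on a pro-object,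
  this is the form in which the cofilteredness of the index category is used.\<close>

locale flat_functor = category C for C :: "('o, 'a) cat" (structure) +
  fixes F :: "('o, 'a, 'x) set_functor"
  assumes act_el: "g \<in> hom C A B \<Longrightarrow> x \<in> el F A \<Longrightarrow> act F g x \<in> el F B"
    and act_cmp: "f \<in> hom C A B \<Longrightarrow> g \<in> hom C B D \<Longrightarrow> x \<in> el F A \<Longrightarrow>
          act F (g \<cdot> f) x = act F g (act F f x)"
    and inhabited: "\<exists>A \<in> obj C. el F A \<noteq> {}"
    and span: "x \<in> el F A \<Longrightarrow> y \<in> el F B \<Longrightarrow>
          \<exists>D. \<exists>z \<in> el F D. \<exists>p \<in> hom C D A. \<exists>q \<in> hom C D B. act F p z = x \<and> act F q z = y"
    and equalize: "p \<in> hom C A B \<Longrightarrow> q \<in> hom C A B \<Longrightarrow> x \<in> el F A \<Longrightarrow> act F p x = act F q x \<Longrightarrow>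
          \<exists>D. \<exists>z \<in> el F D. \<exists>e \<in> hom C D A. act F e z = x \<and> p \<cdot> e = q \<cdot> e"
begin

text \<open>Flat functors preserve finite limits; only pullbacks occur below.  Two compatible elements are images
  of one element, and after equalizing they are images under maps that themselves form a cone.\<close>

lemma pullback_element:
  assumes f: "f \<in> hom C A B" and i: "i \<in> hom C D B"
    and j: "j \<in> hom C P A" and k: "k \<in> hom C P D"
    and ex: "\<And>T u v. u \<in> hom C T A \<Longrightarrow> v \<in> hom C T D \<Longrightarrow> f \<cdot> u = i \<cdot> v \<Longrightarrow>
       \<exists>h \<in> hom C T P. j \<cdot> h = u \<and> k \<cdot> h = v"
    and x: "x \<in> el F A" and y: "y \<in> el F D" and eq: "act F f x = act F i y"
  shows "\<exists>z \<in> el F P. act F j z = x \<and> act F k z = y"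
proof -
  obtain E z p q where z: "z \<in> el F E" and p: "p \<in> hom C E A" and q: "q \<in> hom C E D"
    and zx: "act F p z = x" and zy: "act F q z = y"
    using span[OF x y] by blast
  have "act F (f \<cdot> p) z = act F (i \<cdot> q) z"
    using eq zx zy act_cmp[OF p f z] act_cmp[OF q i z] by simp
  then obtain E' z' e where z': "z' \<in> el F E'" and e: "e \<in> hom C E' E" and ez: "act F e z' = z"
    and eq': "(f \<cdot> p) \<cdot> e = (i \<cdot> q) \<cdot> e"
    using equalize[OF cmp_hom[OF p f] cmp_hom[OF q i] z] by blast
  have "f \<cdot> (p \<cdot> e) = i \<cdot> (q \<cdot> e)"
    using eq' cmp_assoc[OF e p f] cmp_assoc[OF e q i] by simp
  then obtain h where h: "h \<in> hom C E' P" "j \<cdot> h = p \<cdot> e" "k \<cdot> h = q \<cdot> e"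
    using ex[OF cmp_hom[OF e p] cmp_hom[OF e q]] by blast
  have "act F j (act F h z') = x"
    using act_cmp[OF h(1) j z'] act_cmp[OF e p z'] h(2) ez zx by simp
  moreover have "act F k (act F h z') = y"
    using act_cmp[OF h(1) k z'] act_cmp[OF e q z'] h(3) ez zy by simp
  ultimately show ?thesis using act_el[OF h(1) z'] by blast
qed

lemma pullback_element_unique:
  assumes f: "f \<in> hom C A B" and i: "i \<in> hom C D B"
    and j: "j \<in> hom C P A" and k: "k \<in> hom C P D" and comm: "f \<cdot> j = i \<cdot> k"
    and un: "\<And>T u v h h'. u \<in> hom C T A \<Longrightarrow> v \<in> hom C T D \<Longrightarrow> f \<cdot> u = i \<cdot> v \<Longrightarrow>
       h \<in> hom C T P \<Longrightarrow> j \<cdot> h = u \<Longrightarrow> k \<cdot> h = v \<Longrightarrow>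
       h' \<in> hom C T P \<Longrightarrow> j \<cdot> h' = u \<Longrightarrow> k \<cdot> h' = v \<Longrightarrow> h = h'"
    and z: "z \<in> el F P" and z': "z' \<in> el F P"
    and zj: "act F j z = act F j z'" and zk: "act F k z = act F k z'"
  shows "z = z'"
proof -
  obtain E d p q where d: "d \<in> el F E" and p: "p \<in> hom C E P" and q: "q \<in> hom C E P"
    and dz: "act F p d = z" and dz': "act F q d = z'"
    using span[OF z z'] by blast
  have "act F (j \<cdot> p) d = act F (j \<cdot> q) d"
    using zj dz dz' act_cmp[OF p j d] act_cmp[OF q j d] by simp
  then obtain E1 d1 e where d1: "d1 \<in> el F E1" and e: "e \<in> hom C E1 E" and ed: "act F e d1 = d"
    and eq1: "(j \<cdot> p) \<cdot> e = (j \<cdot> q) \<cdot> e"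
    using equalize[OF cmp_hom[OF p j] cmp_hom[OF q j] d] by blast
  have pe: "p \<cdot> e \<in> hom C E1 P" and qe: "q \<cdot> e \<in> hom C E1 P"
    using cmp_hom[OF e p] cmp_hom[OF e q] .
  have "act F (k \<cdot> (p \<cdot> e)) d1 = act F (k \<cdot> (q \<cdot> e)) d1"
    using zk dz dz' ed act_cmp[OF pe k d1] act_cmp[OF qe k d1] act_cmp[OF e p d1] act_cmp[OF e q d1]
    by simp
  then obtain E2 d2 e' where d2: "d2 \<in> el F E2" and e': "e' \<in> hom C E2 E1"
    and ed': "act F e' d2 = d1" and eq2: "(k \<cdot> (p \<cdot> e)) \<cdot> e' = (k \<cdot> (q \<cdot> e)) \<cdot> e'"
    using equalize[OF cmp_hom[OF pe k] cmp_hom[OF qe k] d1] by blast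
  have pee: "p \<cdot> e \<cdot> e' \<in> hom C E2 P" and qee: "q \<cdot> e \<cdot> e' \<in> hom C E2 P"
    using cmp_hom[OF e' pe] cmp_hom[OF e' qe] .
  have "p \<cdot> e \<cdot> e' = q \<cdot> e \<cdot> e'"
  proof (rule un[OF cmp_hom[OF pee j] cmp_hom[OF pee k] _ pee refl refl qee])
    show "f \<cdot> (j \<cdot> (p \<cdot> e \<cdot> e')) = i \<cdot> (k \<cdot> (p \<cdot> e \<cdot> e'))"
      using cmp_assoc[OF pee j f] cmp_assoc[OF pee k i] comm by simp
    show "j \<cdot> (q \<cdot> e \<cdot> e') = j \<cdot> (p \<cdot> e \<cdot> e')"
      using eq1 cmp_assoc[OF e' pe j] cmp_assoc[OF e' qe j] cmp_assoc[OF e p j] cmp_assoc[OF e q j]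
      by simp
    show "k \<cdot> (q \<cdot> e \<cdot> e') = k \<cdot> (p \<cdot> e \<cdot> e')"
      using eq2 cmp_assoc[OF e' pe k] cmp_assoc[OF e' qe k] by simp
  qed
  then show ?thesis
    using dz dz' ed ed' act_cmp[OF e' pe d2] act_cmp[OF e' qe d2] act_cmp[OF e p d1] act_cmp[OF e q d1]
    by simp
qed

end

section \<open>Approximable transformations and two out of three\<close>

definition natural ::
  "('o, 'a) cat \<Rightarrow> ('o, 'a, 'y) set_functor \<Rightarrow> ('o, 'a, 'x) set_functor \<Rightarrow> ('o \<Rightarrow> 'y \<Rightarrow> 'x) \<Rightarrow> bool" where
  "natural C G F \<phi> \<longleftrightarrow>
     (\<forall>A. \<forall>y \<in> el G A. \<phi> A y \<in> el F A) \<and>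
     (\<forall>A B. \<forall>g \<in> hom C A B. \<forall>y \<in> el G A. \<phi> B (act G g y) = act F g (\<phi> A y))"

lemma natural_el: "natural C G F \<phi> \<Longrightarrow> y \<in> el G A \<Longrightarrow> \<phi> A y \<in> el F A"
  by (simp add: natural_def)

lemma natural_act:
  "natural C G F \<phi> \<Longrightarrow> g \<in> hom C A B \<Longrightarrow> y \<in> el G A \<Longrightarrow> \<phi> B (act G g y) = act F g (\<phi> A y)"
  by (simp add: natural_def)

text \<open>With \<open>F\<close> and \<open>G\<close> the germs on \<open>X\<close> and \<open>Y\<close>, the elements \<open>x\<close> and \<open>y\<close> form a commutative square from
  a map \<open>X \<rightarrow> Y\<close> of pro-objects to the map \<open>f\<close> of \<open>C\<close>, and the condition is that this square factors
  through a member of \<open>W\<close> in the category of morphisms.\<close>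

definition approximable ::
  "('o, 'a) cat \<Rightarrow> 'a set \<Rightarrow> ('o, 'a, 'y) set_functor \<Rightarrow> ('o, 'a, 'x) set_functor \<Rightarrow>
    ('o \<Rightarrow> 'y \<Rightarrow> 'x) \<Rightarrow> bool" where
  "approximable C W G F \<phi> \<longleftrightarrow>
     (\<forall>P R. \<forall>f \<in> hom C P R. \<forall>x \<in> el F P. \<forall>y \<in> el G R. act F f x = \<phi> R y \<longrightarrow>
       (\<exists>A B w a b x' y'. w \<in> W \<and> w \<in> hom C A B \<and> a \<in> hom C A P \<and> b \<in> hom C B R \<and>
          b \<cdot>\<^bsub>C\<^esub> w = f \<cdot>\<^bsub>C\<^esub> a \<and> x' \<in> el F A \<and> y' \<in> el G B \<and> act F w x' = \<phi> B y' \<and>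
          act F a x' = x \<and> act G b y' = y))"

lemma approximableE:
  assumes "approximable C W G F \<phi>" "f \<in> hom C P R" "x \<in> el F P" "y \<in> el G R" "act F f x = \<phi> R y"
  obtains A B w a b x' y' where "w \<in> W" "w \<in> hom C A B" "a \<in> hom C A P" "b \<in> hom C B R"
    "b \<cdot>\<^bsub>C\<^esub> w = f \<cdot>\<^bsub>C\<^esub> a" "x' \<in> el F A" "y' \<in> el G B" "act F w x' = \<phi> B y'"
    "act F a x' = x" "act G b y' = y"
  using assms unfolding approximable_def by blast

text \<open>What the argument needs of a relative category with proper factorizations.  The conditions are closed
  under passage to the opposite category, which exchanges left and right proper maps.\<close>

locale proper_relative = category C for C :: "('o, 'a) cat" (structure) +
  fixes W :: "'a set"
  assumes W_cmp: "f \<in> W \<Longrightarrow> g \<in> W \<Longrightarrow> f \<in> hom C A B \<Longrightarrow> g \<in> hom C B D \<Longrightarrow> g \<cdot> f \<in> W"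
    and W_left: "f \<in> W \<Longrightarrow> g \<cdot> f \<in> W \<Longrightarrow> f \<in> hom C A B \<Longrightarrow> g \<in> hom C B D \<Longrightarrow> g \<in> W"
    and W_right: "g \<in> W \<Longrightarrow> g \<cdot> f \<in> W \<Longrightarrow> f \<in> hom C A B \<Longrightarrow> g \<in> hom C B D \<Longrightarrow> f \<in> W"
    and pullbacks: "f \<in> hom C A B \<Longrightarrow> i \<in> hom C D B \<Longrightarrow> \<exists>j k. is_pullback C f i j k"
    and pushouts: "f \<in> hom C A B \<Longrightarrow> i \<in> hom C A D \<Longrightarrow> \<exists>j k. is_pushout C f i j k"
    and RP_LP: "m \<in> hom C A B \<Longrightarrow> \<exists>Q. \<exists>l \<in> left_proper_maps C W \<inter> hom C A Q.
          \<exists>r \<in> right_proper_maps C W \<inter> hom C Q B. m = r \<cdot> l"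
    and RP_W: "m \<in> hom C A B \<Longrightarrow> \<exists>Q. \<exists>l \<in> W \<inter> hom C A Q.
          \<exists>r \<in> right_proper_maps C W \<inter> hom C Q B. m = r \<cdot> l"
    and W_LP: "m \<in> hom C A B \<Longrightarrow> \<exists>Q. \<exists>l \<in> left_proper_maps C W \<inter> hom C A Q.
          \<exists>r \<in> W \<inter> hom C Q B. m = r \<cdot> l"
begin

text \<open>Let the square from \<open>\<psi>\<phi>\<close> to \<open>f : P \<rightarrow> R\<close> be given.  It restricts to a square from \<open>\<phi>\<close> to \<open>f\<close>, which
  factors through some \<open>w1 : A \<rightarrow> B'\<close> in \<open>W\<close>; the square from \<open>\<psi>\<close> to \<open>B' \<rightarrow> R\<close> factors through some
  \<open>w2 : B \<rightarrow> D\<close> in \<open>W\<close>.  The map \<open>m : B \<rightarrow> B'\<close> points the wrong way for composing \<open>w1\<close> with \<open>w2\<close>.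
  Factoring it through an object \<open>Q\<close> as a left proper map followed by a right proper map moves both to \<open>Q\<close>:
  the base change of \<open>w1\<close> ends at \<open>Q\<close>, and the cobase change of \<open>w2\<close> starts there.\<close>

lemma approximable_cmp:
  assumes "flat_functor C F" "flat_functor C G" "flat_functor C H"
    and nat\<phi>: "natural C G F \<phi>" and nat\<psi>: "natural C H G \<psi>"
    and ap\<phi>: "approximable C W G F \<phi>" and ap\<psi>: "approximable C W H G \<psi>"
  shows "approximable C W H F (\<lambda>A z. \<phi> A (\<psi> A z))"
  unfolding approximable_def
proof (intro allI ballI impI)
  interpret F: flat_functor C F by fact
  interpret G: flat_functor C G by fact
  interpret H: flat_functor C H by fact
  fix P R f x0 z0
  assume f: "f \<in> hom C P R" and x0: "x0 \<in> el F P" and z0: "z0 \<in> el H R"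
    and eq0: "act F f x0 = \<phi> R (\<psi> R z0)"
  have "\<psi> R z0 \<in> el G R" using natural_el[OF nat\<psi> z0] .
  from approximableE[OF ap\<phi> f x0 this eq0]
  obtain A B' w1 a b x y' where w1: "w1 \<in> W" "w1 \<in> hom C A B'" and a: "a \<in> hom C A P"
    and b: "b \<in> hom C B' R" and bw: "b \<cdot> w1 = f \<cdot> a" and x: "x \<in> el F A" and y': "y' \<in> el G B'"
    and w1x: "act F w1 x = \<phi> B' y'" and ax: "act F a x = x0" and byy: "act G b y' = \<psi> R z0"
    by metis
  from approximableE[OF ap\<psi> b y' z0 byy]
  obtain B D w2 m d y z where w2: "w2 \<in> W" "w2 \<in> hom C B D" and m: "m \<in> hom C B B'"
    and d: "d \<in> hom C D R" and dw: "d \<cdot> w2 = b \<cdot> m" and y: "y \<in> el G B" and z: "z \<in> el H D"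
    and w2y: "act G w2 y = \<psi> D z" and my: "act G m y = y'" and dz: "act H d z = z0"
    by metis
  obtain Q l r where l: "l \<in> left_proper_maps C W" "l \<in> hom C B Q"
    and r: "r \<in> right_proper_maps C W" "r \<in> hom C Q B'" and mrl: "m = r \<cdot> l"
    using RP_LP[OF m] by blast
  \<comment> \<open>The base change of \<open>w1\<close> along the right proper map \<open>r : Q \<rightarrow> B'\<close>.\<close>
  obtain j k where pb: "is_pullback C r w1 j k" using pullbacks[OF r(2) w1(2)] by blast
  obtain P' where j: "j \<in> hom C P' Q" and k: "k \<in> hom C P' A" and rj: "r \<cdot> j = w1 \<cdot> k"
    and pbex: "\<And>T u v. u \<in> hom C T Q \<Longrightarrow> v \<in> hom C T A \<Longrightarrow> r \<cdot> u = w1 \<cdot> v \<Longrightarrow>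
       \<exists>h \<in> hom C T P'. j \<cdot> h = u \<and> k \<cdot> h = v"
    using pullbackD[OF pb r(2) w1(2)] by metis
  have jW: "j \<in> W" using pb r(1) w1(1) by (auto simp: right_proper_maps_def)
  \<comment> \<open>The cobase change of \<open>w2\<close> along the left proper map \<open>l : B \<rightarrow> Q\<close>.\<close>
  obtain j' k' where po: "is_pushout C l w2 j' k'" using pushouts[OF l(2) w2(2)] by blast
  obtain R' where j': "j' \<in> hom C Q R'" and k': "k' \<in> hom C D R'" and jl: "j' \<cdot> l = k' \<cdot> w2"
    and poex: "\<And>T u v. u \<in> hom C Q T \<Longrightarrow> v \<in> hom C D T \<Longrightarrow> u \<cdot> l = v \<cdot> w2 \<Longrightarrow>
       \<exists>h \<in> hom C R' T. h \<cdot> j' = u \<and> h \<cdot> k' = v"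
    using pushoutD[OF po l(2) w2(2)] by metis
  have jW': "j' \<in> W" using po l(1) w2(1) by (auto simp: left_proper_maps_def)
  let ?y = "\<phi> B y"
  have yF: "?y \<in> el F B" using natural_el[OF nat\<phi> y] .
  have "act F r (act F l ?y) = act F w1 x"
    using F.act_cmp[OF l(2) r(2) yF] mrl w1x my natural_act[OF nat\<phi> m y] by simp
  then obtain x' where x': "x' \<in> el F P'" and jx: "act F j x' = act F l ?y" and kx: "act F k x' = x"
    using F.pullback_element[OF r(2) w1(2) j k pbex F.act_el[OF l(2) yF] x] by blast
  have "(b \<cdot> r) \<cdot> l = d \<cdot> w2"
    using dw mrl cmp_assoc[OF l(2) r(2) b] by simp
  then obtain h where h: "h \<in> hom C R' R" "h \<cdot> j' = b \<cdot> r" "h \<cdot> k' = d"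
    using poex[OF cmp_hom[OF r(2) b] d] by blast
  have "h \<cdot> (j' \<cdot> j) = f \<cdot> (a \<cdot> k)"
    using cmp_assoc[OF j j' h(1)] h(2) cmp_assoc[OF j r(2) b] rj cmp_assoc[OF k w1(2) b] bw
      cmp_assoc[OF k a f] by simp
  moreover have "act F (j' \<cdot> j) x' = \<phi> R' (\<psi> R' (act H k' z))"
  proof -
    have "act F (j' \<cdot> j) x' = act F j' (act F l ?y)"
      using F.act_cmp[OF j j' x'] jx by simp
    also have "\<dots> = act F k' (act F w2 ?y)"
      using F.act_cmp[OF l(2) j' yF] F.act_cmp[OF w2(2) k' yF] jl by simp
    also have "\<dots> = act F k' (\<phi> D (\<psi> D z))"
      using natural_act[OF nat\<phi> w2(2) y] w2y by simp
    also have "\<dots> = \<phi> R' (\<psi> R' (act H k' z))"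
      using natural_act[OF nat\<phi> k' natural_el[OF nat\<psi> z]] natural_act[OF nat\<psi> k' z] by simp
    finally show ?thesis .
  qed
  moreover have "act F (a \<cdot> k) x' = x0" using F.act_cmp[OF k a x'] kx ax by simp
  moreover have "act H h (act H k' z) = z0" using H.act_cmp[OF k' h(1) z] h(3) dz by simp
  ultimately show "\<exists>A B w a b x' y'. w \<in> W \<and> w \<in> hom C A B \<and> a \<in> hom C A P \<and> b \<in> hom C B R \<and>
          b \<cdot> w = f \<cdot> a \<and> x' \<in> el F A \<and> y' \<in> el H B \<and> act F w x' = \<phi> B (\<psi> B y') \<and>
          act F a x' = x0 \<and> act H b y' = z0"
    using W_cmp[OF jW jW' j j'] cmp_hom[OF j j'] cmp_hom[OF k a] h(1) x' H.act_el[OF k' z] by blast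
qed

text \<open>Here \<open>\<phi>\<close> and \<open>\<psi>\<phi>\<close> are approximable.  The square from \<open>\<psi>\<phi>\<close> to \<open>h : P \<rightarrow> R\<close> factors through some
  \<open>k : A \<rightarrow> D\<close> in \<open>W\<close>.  Its source only receives a germ from \<open>X\<close>, so \<open>A\<close> has to be enlarged to an object
  that receives one from \<open>Y\<close>.  Applying the hypothesis on \<open>\<phi>\<close> to \<open>A \<rightarrow> D \<times>\<^sub>R P\<close> gives \<open>w : A1 \<rightarrow> B1\<close> in
  \<open>W\<close> over it.  Factor \<open>A1 \<rightarrow> A\<close> through \<open>Q\<close> as a left proper map followed by a member of \<open>W\<close>.  Then \<open>Q\<close>
  maps by members of \<open>W\<close> both to the pushout of \<open>Q\<close> and \<open>B1\<close> under \<open>A1\<close> and, via \<open>k\<close>, to \<open>D\<close>; so the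
  map from that pushout to \<open>D\<close> is in \<open>W\<close>.\<close>

lemma approximable_left:
  assumes "flat_functor C F" "flat_functor C G" "flat_functor C H"
    and nat\<phi>: "natural C G F \<phi>" and nat\<psi>: "natural C H G \<psi>"
    and ap\<phi>: "approximable C W G F \<phi>" and ap: "approximable C W H F (\<lambda>A z. \<phi> A (\<psi> A z))"
  shows "approximable C W H G \<psi>"
  unfolding approximable_def
proof (intro allI ballI impI)
  interpret F: flat_functor C F by fact
  interpret G: flat_functor C G by fact
  interpret H: flat_functor C H by fact
  fix P R h y0 z0
  assume h: "h \<in> hom C P R" and y0: "y0 \<in> el G P" and z0: "z0 \<in> el H R"
    and eq0: "act G h y0 = \<psi> R z0"
  have y0F: "\<phi> P y0 \<in> el F P" using natural_el[OF nat\<phi> y0] .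
  have "act F h (\<phi> P y0) = \<phi> R (\<psi> R z0)" using natural_act[OF nat\<phi> h y0] eq0 by simp
  from approximableE[OF ap h y0F z0 this]
  obtain A D k a d x z where k: "k \<in> W" "k \<in> hom C A D" and a: "a \<in> hom C A P"
    and d: "d \<in> hom C D R" and dk: "d \<cdot> k = h \<cdot> a" and x: "x \<in> el F A" and z: "z \<in> el H D"
    and kx: "act F k x = \<phi> D (\<psi> D z)" and ax: "act F a x = \<phi> P y0" and dz: "act H d z = z0"
    by metis
  have z': "\<psi> D z \<in> el G D" using natural_el[OF nat\<psi> z] .
  \<comment> \<open>The target \<open>T = D \<times>\<^sub>R P\<close> keeps track of the maps to \<open>D\<close> and to \<open>P\<close> at once.\<close>
  obtain p q where pb: "is_pullback C d h p q" using pullbacks[OF d h] by blast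
  obtain T where p: "p \<in> hom C T D" and q: "q \<in> hom C T P" and dp: "d \<cdot> p = h \<cdot> q"
    and pbex: "\<And>T' u v. u \<in> hom C T' D \<Longrightarrow> v \<in> hom C T' P \<Longrightarrow> d \<cdot> u = h \<cdot> v \<Longrightarrow>
       \<exists>i \<in> hom C T' T. p \<cdot> i = u \<and> q \<cdot> i = v"
    and pbun: "\<And>T' u v i i'. u \<in> hom C T' D \<Longrightarrow> v \<in> hom C T' P \<Longrightarrow> d \<cdot> u = h \<cdot> v \<Longrightarrow>
       i \<in> hom C T' T \<Longrightarrow> p \<cdot> i = u \<Longrightarrow> q \<cdot> i = v \<Longrightarrow>
       i' \<in> hom C T' T \<Longrightarrow> p \<cdot> i' = u \<Longrightarrow> q \<cdot> i' = v \<Longrightarrow> i = i'"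
    using pullbackD[OF pb d h] by metis
  obtain c where c: "c \<in> hom C A T" "p \<cdot> c = k" "q \<cdot> c = a" using pbex[OF k(2) a dk] by blast
  have "act G d (\<psi> D z) = act G h y0"
    using natural_act[OF nat\<psi> d z] dz eq0 by simp
  then obtain y1 where y1: "y1 \<in> el G T" and py: "act G p y1 = \<psi> D z" and qy: "act G q y1 = y0"
    using G.pullback_element[OF d h p q pbex z' y0] by blast
  have y1F: "\<phi> T y1 \<in> el F T" using natural_el[OF nat\<phi> y1] .
  have "act F c x = \<phi> T y1"
  proof (rule F.pullback_element_unique[OF d h p q dp pbun F.act_el[OF c(1) x] y1F])
    show "act F p (act F c x) = act F p (\<phi> T y1)"
      using F.act_cmp[OF c(1) p x] c(2) kx py natural_act[OF nat\<phi> p y1] by simp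
    show "act F q (act F c x) = act F q (\<phi> T y1)"
      using F.act_cmp[OF c(1) q x] c(3) ax qy natural_act[OF nat\<phi> q y1] by simp
  qed
  from approximableE[OF ap\<phi> c(1) x y1 this]
  obtain A1 B1 w m b x1 y' where w: "w \<in> W" "w \<in> hom C A1 B1" and m: "m \<in> hom C A1 A"
    and b: "b \<in> hom C B1 T" and bw: "b \<cdot> w = c \<cdot> m" and x1: "x1 \<in> el F A1" and y': "y' \<in> el G B1"
    and wx: "act F w x1 = \<phi> B1 y'" and mx: "act F m x1 = x" and byy: "act G b y' = y1"
    by metis
  obtain Q l r where l: "l \<in> left_proper_maps C W" "l \<in> hom C A1 Q"
    and r: "r \<in> W" "r \<in> hom C Q A" and mrl: "m = r \<cdot> l"
    using W_LP[OF m] by blast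
  \<comment> \<open>The pushout \<open>F'\<close> will be the source of the required member of \<open>W\<close>.\<close>
  obtain j i where po: "is_pushout C l w j i" using pushouts[OF l(2) w(2)] by blast
  obtain F' where j: "j \<in> hom C Q F'" and i: "i \<in> hom C B1 F'" and jl: "j \<cdot> l = i \<cdot> w"
    and poex: "\<And>T u v. u \<in> hom C Q T \<Longrightarrow> v \<in> hom C B1 T \<Longrightarrow> u \<cdot> l = v \<cdot> w \<Longrightarrow>
       \<exists>h \<in> hom C F' T. h \<cdot> j = u \<and> h \<cdot> i = v"
    using pushoutD[OF po l(2) w(2)] by metis
  have jW: "j \<in> W" using po l(1) w(1) by (auto simp: left_proper_maps_def)
  have "(c \<cdot> r) \<cdot> l = b \<cdot> w"
    using bw mrl cmp_assoc[OF l(2) r(2) c(1)] by simp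
  then obtain t where t: "t \<in> hom C F' T" "t \<cdot> j = c \<cdot> r" "t \<cdot> i = b"
    using poex[OF cmp_hom[OF r(2) c(1)] b] by blast
  have "(p \<cdot> t) \<cdot> j = k \<cdot> r"
    using cmp_assoc[OF j t(1) p] t(2) cmp_assoc[OF r(2) c(1) p] c(2) by simp
  then have ptW: "p \<cdot> t \<in> W"
    using W_left[OF jW _ j cmp_hom[OF t(1) p]] W_cmp[OF r(1) k(1) r(2) k(2)] by simp
  have y'': "act G i y' \<in> el G F'" using G.act_el[OF i y'] .
  have ty: "act G t (act G i y') = y1" using G.act_cmp[OF i t(1) y'] t(3) byy by simp
  have "d \<cdot> (p \<cdot> t) = h \<cdot> (q \<cdot> t)"
    using cmp_assoc[OF t(1) p d] cmp_assoc[OF t(1) q h] dp by simp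
  moreover have "act G (p \<cdot> t) (act G i y') = \<psi> D z"
    using G.act_cmp[OF t(1) p y''] ty py by simp
  moreover have "act G (q \<cdot> t) (act G i y') = y0"
    using G.act_cmp[OF t(1) q y''] ty qy by simp
  ultimately show "\<exists>A B w a b x' y'. w \<in> W \<and> w \<in> hom C A B \<and> a \<in> hom C A P \<and> b \<in> hom C B R \<and>
          b \<cdot> w = h \<cdot> a \<and> x' \<in> el G A \<and> y' \<in> el H B \<and> act G w x' = \<psi> B y' \<and>
          act G a x' = y0 \<and> act H b y' = z0"
    using ptW cmp_hom[OF t(1) p] cmp_hom[OF t(1) q] d y'' z dz by blast
qed

text \<open>Here \<open>\<psi>\<close> and \<open>\<psi>\<phi>\<close> are approximable, and \<open>g : P \<rightarrow> R\<close> is the target of the square from \<open>\<phi>\<close>.  Some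
  \<open>w : B \<rightarrow> D\<close> in \<open>W\<close> approximates \<open>\<psi>\<close> with \<open>B\<close> over \<open>R\<close>, and some \<open>k : A \<rightarrow> E\<close> in \<open>W\<close>
  approximates \<open>\<psi>\<phi>\<close> over \<open>P \<times>\<^sub>R B \<rightarrow> D\<close>.  Factor \<open>E \<rightarrow> D\<close> through \<open>Q\<close> as a member of \<open>W\<close> followed by a
  right proper map.  The base change \<open>B \<times>\<^sub>D Q \<rightarrow> Q\<close> of \<open>w\<close> and the composite \<open>A \<rightarrow> E \<rightarrow> Q\<close> are in
  \<open>W\<close>, hence so is \<open>A \<rightarrow> B \<times>\<^sub>D Q\<close>.\<close>

lemma approximable_right:
  assumes "flat_functor C F" "flat_functor C G" "flat_functor C H"
    and nat\<phi>: "natural C G F \<phi>" and nat\<psi>: "natural C H G \<psi>"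
    and ap\<psi>: "approximable C W H G \<psi>" and ap: "approximable C W H F (\<lambda>A z. \<phi> A (\<psi> A z))"
  shows "approximable C W G F \<phi>"
  unfolding approximable_def
proof (intro allI ballI impI)
  interpret F: flat_functor C F by fact
  interpret G: flat_functor C G by fact
  interpret H: flat_functor C H by fact
  fix P R g x0 y0
  assume g: "g \<in> hom C P R" and x0: "x0 \<in> el F P" and y0: "y0 \<in> el G R"
    and eq0: "act F g x0 = \<phi> R y0"
  \<comment> \<open>Nothing in the square concerns \<open>\<psi>\<close>, so any germ on \<open>Z\<close> may serve to start the approximation of \<open>\<psi>\<close>.\<close>
  obtain R0 z0 where z0: "z0 \<in> el H R0" using H.inhabited by blast
  have "\<psi> R0 z0 \<in> el G R0" using natural_el[OF nat\<psi> z0] .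
  then obtain T t e e' where t: "t \<in> el G T" and e: "e \<in> hom C T R" and e': "e' \<in> hom C T R0"
    and et: "act G e t = y0" and et': "act G e' t = \<psi> R0 z0"
    using G.span[OF y0] by metis
  from approximableE[OF ap\<psi> e' t z0 et']
  obtain B D w b0 d y z where w: "w \<in> W" "w \<in> hom C B D" and b0: "b0 \<in> hom C B T"
    and y: "y \<in> el G B" and z: "z \<in> el H D" and wy: "act G w y = \<psi> D z" and b0y: "act G b0 y = t"
    by metis
  define b where "b = e \<cdot> b0"
  have b: "b \<in> hom C B R" using cmp_hom[OF b0 e] b_def by simp
  have byy: "act G b y = y0" using G.act_cmp[OF b0 e y] b_def b0y et by simp
  have yF: "\<phi> B y \<in> el F B" using natural_el[OF nat\<phi> y] .
  obtain p q where pb: "is_pullback C g b p q" using pullbacks[OF g b] by blast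
  obtain S where p: "p \<in> hom C S P" and q: "q \<in> hom C S B" and gp: "g \<cdot> p = b \<cdot> q"
    and pbex: "\<And>T' u v. u \<in> hom C T' P \<Longrightarrow> v \<in> hom C T' B \<Longrightarrow> g \<cdot> u = b \<cdot> v \<Longrightarrow>
       \<exists>i \<in> hom C T' S. p \<cdot> i = u \<and> q \<cdot> i = v"
    using pullbackD[OF pb g b] by metis
  have "act F g x0 = act F b (\<phi> B y)"
    using eq0 byy natural_act[OF nat\<phi> b y] by simp
  then obtain x1 where x1: "x1 \<in> el F S" and px: "act F p x1 = x0" and qx: "act F q x1 = \<phi> B y"
    using F.pullback_element[OF g b p q pbex x0 yF] by blast
  have "act F (w \<cdot> q) x1 = \<phi> D (\<psi> D z)"
    using F.act_cmp[OF q w(2) x1] qx wy natural_act[OF nat\<phi> w(2) y] by simp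
  from approximableE[OF ap cmp_hom[OF q w(2)] x1 z this]
  obtain A E k a m x z' where k: "k \<in> W" "k \<in> hom C A E" and a: "a \<in> hom C A S"
    and m: "m \<in> hom C E D" and mk: "m \<cdot> k = (w \<cdot> q) \<cdot> a" and x: "x \<in> el F A" and z': "z' \<in> el H E"
    and kx: "act F k x = \<phi> E (\<psi> E z')" and ax: "act F a x = x1" and mz: "act H m z' = z"
    by metis
  obtain Q l r where l: "l \<in> W" "l \<in> hom C E Q"
    and r: "r \<in> right_proper_maps C W" "r \<in> hom C Q D" and mrl: "m = r \<cdot> l"
    using RP_W[OF m] by blast
  \<comment> \<open>The base change of \<open>w\<close> along the right proper map \<open>r : Q \<rightarrow> D\<close>.\<close>
  obtain j i where pb': "is_pullback C r w j i" using pullbacks[OF r(2) w(2)] by blast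
  obtain P' where j: "j \<in> hom C P' Q" and i: "i \<in> hom C P' B" and rj: "r \<cdot> j = w \<cdot> i"
    and pbex': "\<And>T u v. u \<in> hom C T Q \<Longrightarrow> v \<in> hom C T B \<Longrightarrow> r \<cdot> u = w \<cdot> v \<Longrightarrow>
       \<exists>h \<in> hom C T P'. j \<cdot> h = u \<and> i \<cdot> h = v"
    and pbun': "\<And>T u v h h'. u \<in> hom C T Q \<Longrightarrow> v \<in> hom C T B \<Longrightarrow> r \<cdot> u = w \<cdot> v \<Longrightarrow>
       h \<in> hom C T P' \<Longrightarrow> j \<cdot> h = u \<Longrightarrow> i \<cdot> h = v \<Longrightarrow>
       h' \<in> hom C T P' \<Longrightarrow> j \<cdot> h' = u \<Longrightarrow> i \<cdot> h' = v \<Longrightarrow> h = h'"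
    using pullbackD[OF pb' r(2) w(2)] by metis
  have jW: "j \<in> W" using pb' r(1) w(1) by (auto simp: right_proper_maps_def)
  have lk: "l \<cdot> k \<in> hom C A Q" and qa: "q \<cdot> a \<in> hom C A B"
    using cmp_hom[OF k(2) l(2)] cmp_hom[OF a q] .
  have "r \<cdot> (l \<cdot> k) = w \<cdot> (q \<cdot> a)"
    using cmp_assoc[OF k(2) l(2) r(2)] mrl mk cmp_assoc[OF a q w(2)] by simp
  then obtain v where v: "v \<in> hom C A P'" "j \<cdot> v = l \<cdot> k" "i \<cdot> v = q \<cdot> a"
    using pbex'[OF lk qa] by blast
  have vW: "v \<in> W"
    using W_right[OF jW _ v(1) j] W_cmp[OF k(1) l(1) k(2) l(2)] v(2) by simp
  have z'G: "\<psi> E z' \<in> el G E" using natural_el[OF nat\<psi> z'] .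
  have "act G r (act G l (\<psi> E z')) = act G w y"
    using G.act_cmp[OF l(2) r(2) z'G] mrl wy natural_act[OF nat\<psi> m z'] mz by simp
  then obtain y' where y': "y' \<in> el G P'" and jy: "act G j y' = act G l (\<psi> E z')"
    and iy: "act G i y' = y"
    using G.pullback_element[OF r(2) w(2) j i pbex' G.act_el[OF l(2) z'G] y] by blast
  have y'F: "\<phi> P' y' \<in> el F P'" using natural_el[OF nat\<phi> y'] .
  have "act F v x = \<phi> P' y'"
  proof (rule F.pullback_element_unique[OF r(2) w(2) j i rj pbun' F.act_el[OF v(1) x] y'F])
    have "act F j (act F v x) = act F l (act F k x)"
      using F.act_cmp[OF v(1) j x] F.act_cmp[OF k(2) l(2) x] v(2) by simp
    also have "\<dots> = \<phi> Q (act G l (\<psi> E z'))"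
      using kx natural_act[OF nat\<phi> l(2) z'G] by simp
    also have "\<dots> = act F j (\<phi> P' y')"
      using jy natural_act[OF nat\<phi> j y'] by simp
    finally show "act F j (act F v x) = act F j (\<phi> P' y')" .
    have "act F i (act F v x) = \<phi> B y"
      using F.act_cmp[OF v(1) i x] F.act_cmp[OF a q x] v(3) ax qx by simp
    also have "\<dots> = act F i (\<phi> P' y')"
      using iy natural_act[OF nat\<phi> i y'] by simp
    finally show "act F i (act F v x) = act F i (\<phi> P' y')" .
  qed
  moreover have "(b \<cdot> i) \<cdot> v = g \<cdot> (p \<cdot> a)"
    using cmp_assoc[OF v(1) i b] v(3) cmp_assoc[OF a q b] gp cmp_assoc[OF a p g] by simp
  moreover have "act F (p \<cdot> a) x = x0" using F.act_cmp[OF a p x] ax px by simp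
  moreover have "act G (b \<cdot> i) y' = y0" using G.act_cmp[OF i b y'] iy byy by simp
  ultimately show "\<exists>A B w a b x' y'. w \<in> W \<and> w \<in> hom C A B \<and> a \<in> hom C A P \<and> b \<in> hom C B R \<and>
          b \<cdot> w = g \<cdot> a \<and> x' \<in> el F A \<and> y' \<in> el G B \<and> act F w x' = \<phi> B y' \<and>
          act F a x' = x0 \<and> act G b y' = y0"
    using vW v(1) cmp_hom[OF a p] cmp_hom[OF i b] x y' by blast
qed

end

section \<open>Germs on a pro-object\<close>

definition germ :: "('o, 'a) cat \<Rightarrow> ('u, 'o, 'a) sdiag \<Rightarrow> 'u \<Rightarrow> 'a \<Rightarrow> ('u \<times> 'a) set" where
  "germ C X t f = pro_rel C X (tgt C f) `` {(t, f)}"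

text \<open>The functor \<open>A \<mapsto> colim\<^sub>t Hom(X\<^sub>t, A)\<close>; its elements are represented as equivalence classes of pairs, as
  in the definition of morphisms of pro-objects.\<close>

definition germs :: "('o, 'a) cat \<Rightarrow> ('u, 'o, 'a) sdiag \<Rightarrow> ('o, 'a, ('u \<times> 'a) set) set_functor" where
  "germs C X =
     \<lparr> el = (\<lambda>B. pro_rep C X B // pro_rel C X B),
       act = (\<lambda>g x. pro_rel C X (tgt C g) `` {(t, g \<cdot>\<^bsub>C\<^esub> f) | t f. (t, f) \<in> x}) \<rparr>"

lemma Image_constant:
  assumes "z \<in> S" "\<And>z. z \<in> S \<Longrightarrow> R `` {z} = E"
  shows "R `` S = E"
proof -
  have "R `` S = (\<Union>z \<in> S. R `` {z})" by blast
  also have "\<dots> = (\<Union>z \<in> S. E)" by (rule SUP_cong[OF refl assms(2)])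
  finally show ?thesis using assms(1) by blast
qed

locale pro_object = category C for C :: "('o, 'a) cat" (structure) +
  fixes X :: "('u, 'o, 'a) sdiag"
  assumes diag: "is_diagram C X" and cofil: "cofiltered (shape X)"
begin

sublocale I: category "shape X" using cofil by (simp add: cofiltered_def)

lemma ob_obj: "t \<in> obj (shape X) \<Longrightarrow> ob X t \<in> obj C"
  and ar_ident: "t \<in> obj (shape X) \<Longrightarrow> ar X (ident (shape X) t) = ident C (ob X t)"
  and ar_hom: "u \<in> hom (shape X) s t \<Longrightarrow> ar X u \<in> hom C (ob X s) (ob X t)"
  and ar_cmp: "u \<in> hom (shape X) r s \<Longrightarrow> v \<in> hom (shape X) s t \<Longrightarrow>
         ar X (v \<cdot>\<^bsub>shape X\<^esub> u) = ar X v \<cdot> ar X u"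
  using diag unfolding is_diagram_def by blast+

lemma restrict_restrict:
  assumes "f \<in> hom C (ob X t) B" "v \<in> hom (shape X) s t" "u \<in> hom (shape X) r s"
  shows "(f \<cdot> ar X v) \<cdot> ar X u = f \<cdot> ar X (v \<cdot>\<^bsub>shape X\<^esub> u)"
  using cmp_assoc[OF ar_hom[OF assms(3)] ar_hom[OF assms(2)] assms(1)] ar_cmp[OF assms(3,2)] by simp

lemma restrict_hom:
  assumes "f \<in> hom C (ob X t) B" "v \<in> hom (shape X) s t"
  shows "f \<cdot> ar X v \<in> hom C (ob X s) B"
  using cmp_hom[OF ar_hom[OF assms(2)] assms(1)] .

lemma common_refinement:
  assumes "s \<in> obj (shape X)" "t \<in> obj (shape X)"
  obtains r u v where "u \<in> hom (shape X) r s" "v \<in> hom (shape X) r t"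
  using cofil assms unfolding cofiltered_def by blast

lemma equalize_index:
  assumes "u \<in> hom (shape X) s t" "v \<in> hom (shape X) s t"
  obtains r w where "w \<in> hom (shape X) r s" "u \<cdot>\<^bsub>shape X\<^esub> w = v \<cdot>\<^bsub>shape X\<^esub> w"
  using cofil assms unfolding cofiltered_def by metis

lemma complete_cospan:
  assumes u: "u \<in> hom (shape X) s t" and v: "v \<in> hom (shape X) s' t"
  obtains r a b where "a \<in> hom (shape X) r s" "b \<in> hom (shape X) r s'"
    "u \<cdot>\<^bsub>shape X\<^esub> a = v \<cdot>\<^bsub>shape X\<^esub> b"
proof -
  obtain q a b where a: "a \<in> hom (shape X) q s" and b: "b \<in> hom (shape X) q s'"
    using common_refinement I.hom_obj u v by metis
  obtain r w where w: "w \<in> hom (shape X) r q"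
    and eq: "(u \<cdot>\<^bsub>shape X\<^esub> a) \<cdot>\<^bsub>shape X\<^esub> w = (v \<cdot>\<^bsub>shape X\<^esub> b) \<cdot>\<^bsub>shape X\<^esub> w"
    using equalize_index[OF I.cmp_hom[OF a u] I.cmp_hom[OF b v]] by metis
  show ?thesis
    using that[OF I.cmp_hom[OF w a] I.cmp_hom[OF w b]] eq I.cmp_assoc[OF w a u] I.cmp_assoc[OF w b v]
    by simp
qed

text \<open>Over a cofiltered index category the generated equivalence relation has a direct description: two
  representatives are identified exactly when they agree after restriction to a common index.\<close>

definition eventually_equal :: "'o \<Rightarrow> (('u \<times> 'a) \<times> ('u \<times> 'a)) set" where
  "eventually_equal B = {((t, f), (t', f')) | t f t' f'.
     (t, f) \<in> pro_rep C X B \<and> (t', f') \<in> pro_rep C X B \<and>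
     (\<exists>r. \<exists>a \<in> hom (shape X) r t. \<exists>a' \<in> hom (shape X) r t'. f \<cdot> ar X a = f' \<cdot> ar X a')}"

lemma eventually_equal_trans:
  assumes "(x, y) \<in> eventually_equal B" "(y, z) \<in> eventually_equal B"
  shows "(x, z) \<in> eventually_equal B"
proof -
  obtain t f t' f' t'' f'' r a a' s b b' where
    x: "x = (t, f)" "(t, f) \<in> pro_rep C X B" and y: "y = (t', f')" "(t', f') \<in> pro_rep C X B"
    and z: "z = (t'', f'')" "(t'', f'') \<in> pro_rep C X B"
    and a: "a \<in> hom (shape X) r t" "a' \<in> hom (shape X) r t'" "f \<cdot> ar X a = f' \<cdot> ar X a'"
    and b: "b \<in> hom (shape X) s t'" "b' \<in> hom (shape X) s t''" "f' \<cdot> ar X b = f'' \<cdot> ar X b'"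
    using assms unfolding eventually_equal_def by blast
  have f: "f \<in> hom C (ob X t) B" "f' \<in> hom C (ob X t') B" "f'' \<in> hom C (ob X t'') B"
    using x y z by (auto simp: pro_rep_def)
  obtain q c d where c: "c \<in> hom (shape X) q r" and d: "d \<in> hom (shape X) q s"
    and cd: "a' \<cdot>\<^bsub>shape X\<^esub> c = b \<cdot>\<^bsub>shape X\<^esub> d"
    using complete_cospan[OF a(2) b(1)] by metis
  have "f \<cdot> ar X (a \<cdot>\<^bsub>shape X\<^esub> c) = f'' \<cdot> ar X (b' \<cdot>\<^bsub>shape X\<^esub> d)"
    using restrict_restrict[OF f(1) a(1) c] restrict_restrict[OF f(2) a(2) c]
      restrict_restrict[OF f(2) b(1) d] restrict_restrict[OF f(3) b(2) d] a(3) b(3) cd by simp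
  then show ?thesis
    using x z I.cmp_hom[OF c a(1)] I.cmp_hom[OF d b(2)] unfolding eventually_equal_def by blast
qed

lemma eventually_equal_refl: "x \<in> pro_rep C X B \<Longrightarrow> (x, x) \<in> eventually_equal B"
  unfolding eventually_equal_def using I.ident_hom by (cases x) (auto simp: pro_rep_def)

lemma eventually_equal_sym: "(x, y) \<in> eventually_equal B \<Longrightarrow> (y, x) \<in> eventually_equal B"
  unfolding eventually_equal_def by auto metis

lemma pro_rel_eq: "pro_rel C X B = eventually_equal B"
proof -
  let ?P = "pro_rep C X B"
  let ?r = "{((t, f), (t', f \<cdot> ar X a)) | t f t' a. (t, f) \<in> ?P \<and> a \<in> hom (shape X) t' t}"
  have step: "(x, y) \<in> ?r \<Longrightarrow> (x, y) \<in> eventually_equal B" for x y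
  proof -
    assume "(x, y) \<in> ?r"
    then obtain t f t' a where xy: "x = (t, f)" "y = (t', f \<cdot> ar X a)" "(t, f) \<in> ?P"
      "a \<in> hom (shape X) t' t" by blast
    then have f: "f \<in> hom C (ob X t) B" by (simp add: pro_rep_def)
    have t': "t' \<in> obj (shape X)" using I.hom_obj xy(4) by blast
    have "(t', f \<cdot> ar X a) \<in> ?P" using restrict_hom[OF f xy(4)] t' by (simp add: pro_rep_def)
    moreover have "f \<cdot> ar X a = (f \<cdot> ar X a) \<cdot> ar X (ident (shape X) t')"
      using restrict_hom[OF f xy(4)] ar_ident[OF t'] by (simp add: hom_def)
    ultimately show ?thesis
      using xy I.ident_hom[OF t'] unfolding eventually_equal_def by blast
  qed
  have "(x, y) \<in> (?r \<union> ?r\<inverse>)\<^sup>* \<Longrightarrow> x \<in> ?P \<Longrightarrow> (x, y) \<in> eventually_equal B" for x y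
  proof (induction rule: rtrancl_induct)
    case base
    then show ?case by (rule eventually_equal_refl)
  next
    case (step y z)
    have "(y, z) \<in> eventually_equal B"
      using step.hyps(2) \<open>\<And>x y. (x, y) \<in> ?r \<Longrightarrow> (x, y) \<in> eventually_equal B\<close> eventually_equal_sym
      by blast
    then show ?case using step.IH[OF step.prems] eventually_equal_trans by blast
  qed
  moreover have "(x, y) \<in> (?r \<union> ?r\<inverse>)\<^sup>* \<inter> ?P \<times> ?P" if ee: "(x, y) \<in> eventually_equal B" for x y
  proof -
    obtain t f t' f' r a a' where *: "x = (t, f)" "y = (t', f')" "(t, f) \<in> ?P" "(t', f') \<in> ?P"
      "a \<in> hom (shape X) r t" "a' \<in> hom (shape X) r t'" "f \<cdot> ar X a = f' \<cdot> ar X a'"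
      using ee unfolding eventually_equal_def by blast
    have "(x, (r, f \<cdot> ar X a)) \<in> ?r" "(y, (r, f' \<cdot> ar X a')) \<in> ?r" using * by blast+
    then have "(x, (r, f \<cdot> ar X a)) \<in> ?r \<union> ?r\<inverse>" "((r, f \<cdot> ar X a), y) \<in> ?r \<union> ?r\<inverse>"
      using *(7) by auto
    then have "(x, y) \<in> (?r \<union> ?r\<inverse>)\<^sup>*" by (meson converse_rtrancl_into_rtrancl r_into_rtrancl)
    then show ?thesis using * by blast
  qed
  ultimately have "(?r \<union> ?r\<inverse>)\<^sup>* \<inter> ?P \<times> ?P = eventually_equal B"
    by (intro equalityI subrelI) blast+
  then show ?thesis unfolding pro_rel_def gen_equiv_def .
qed

lemma equiv_pro_rel: "equiv (pro_rep C X B) (pro_rel C X B)"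
  unfolding pro_rel_eq
proof (rule equivI)
  show "refl_on (pro_rep C X B) (eventually_equal B)"
    using eventually_equal_refl by (auto simp: refl_on_def)
  show "eventually_equal B \<subseteq> pro_rep C X B \<times> pro_rep C X B"
    by (auto simp: eventually_equal_def)
  show "sym (eventually_equal B)" using eventually_equal_sym by (auto simp: sym_def)
  show "trans (eventually_equal B)" using eventually_equal_trans by (meson transI)
qed

lemma pro_repI: "f \<in> hom C (ob X t) B \<Longrightarrow> t \<in> obj (shape X) \<Longrightarrow> (t, f) \<in> pro_rep C X B"
  by (simp add: pro_rep_def)

lemma germ_class: "f \<in> hom C (ob X t) B \<Longrightarrow> germ C X t f = pro_rel C X B `` {(t, f)}"
  by (simp add: germ_def hom_def)

lemma germ_el:
  assumes "t \<in> obj (shape X)" "f \<in> hom C (ob X t) B"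
  shows "germ C X t f \<in> el (germs C X) B"
  using assms by (auto simp: germ_def germs_def hom_def intro!: quotientI pro_repI)

lemma germ_cases:
  assumes "x \<in> el (germs C X) B"
  obtains t f where "t \<in> obj (shape X)" "f \<in> hom C (ob X t) B" "x = germ C X t f"
  using assms by (auto simp: germ_def germs_def pro_rep_def hom_def elim!: quotientE)

lemma germ_eq:
  assumes "t \<in> obj (shape X)" "f \<in> hom C (ob X t) B" "t' \<in> obj (shape X)" "f' \<in> hom C (ob X t') B"
  shows "germ C X t f = germ C X t' f' \<longleftrightarrow>
    (\<exists>r. \<exists>a \<in> hom (shape X) r t. \<exists>a' \<in> hom (shape X) r t'. f \<cdot> ar X a = f' \<cdot> ar X a')"
proof -
  have "germ C X t f = germ C X t' f' \<longleftrightarrow> ((t, f), (t', f')) \<in> pro_rel C X B"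
    unfolding germ_class[OF assms(2)] germ_class[OF assms(4)]
    using eq_equiv_class_iff[OF equiv_pro_rel pro_repI[OF assms(2,1)] pro_repI[OF assms(4,3)]] .
  also have "\<dots> \<longleftrightarrow> (\<exists>r. \<exists>a \<in> hom (shape X) r t. \<exists>a' \<in> hom (shape X) r t'. f \<cdot> ar X a = f' \<cdot> ar X a')"
    using pro_repI assms by (auto simp: pro_rel_eq eventually_equal_def)
  finally show ?thesis .
qed

lemma germ_mem:
  assumes "t \<in> obj (shape X)" "f \<in> hom C (ob X t) B"
  shows "(t', f') \<in> germ C X t f \<longleftrightarrow>
    t' \<in> obj (shape X) \<and> f' \<in> hom C (ob X t') B \<and> germ C X t' f' = germ C X t f"
proof -
  have "(t', f') \<in> germ C X t f \<longleftrightarrow> ((t, f), (t', f')) \<in> pro_rel C X B"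
    using germ_class[OF assms(2)] by simp
  also have "\<dots> \<longleftrightarrow> (t', f') \<in> pro_rep C X B \<and> ((t, f), (t', f')) \<in> pro_rel C X B"
    by (auto simp: pro_rel_eq eventually_equal_def)
  also have "\<dots> \<longleftrightarrow> (t', f') \<in> pro_rep C X B \<and> germ C X t f = germ C X t' f'"
    using eq_equiv_class_iff[OF equiv_pro_rel pro_repI[OF assms(2,1)], of "(t', f')"]
      germ_class[OF assms(2)] germ_class[of f' t' B] by (auto simp: pro_rep_def)
  finally show ?thesis by (simp add: pro_rep_def eq_commute[of "germ C X t f"])
qed

lemma germ_self:
  assumes "t \<in> obj (shape X)" "f \<in> hom C (ob X t) B"
  shows "(t, f) \<in> germ C X t f"
  using germ_mem[OF assms, of t f] assms by simp

lemma germ_restrict: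
  assumes "f \<in> hom C (ob X t) B" "a \<in> hom (shape X) r t"
  shows "germ C X r (f \<cdot> ar X a) = germ C X t f"
proof -
  have r: "r \<in> obj (shape X)" and t: "t \<in> obj (shape X)" using I.hom_obj[OF assms(2)] by auto
  have "(f \<cdot> ar X a) \<cdot> ar X (ident (shape X) r) = f \<cdot> ar X a"
    using restrict_hom[OF assms] ar_ident[OF r] by (simp add: hom_def)
  then show ?thesis
    using germ_eq[OF r restrict_hom[OF assms] t assms(1)] I.ident_hom[OF r] assms(2) by blast
qed

lemma germ_eq_restrict:
  assumes "f \<in> hom C (ob X t) B" "f' \<in> hom C (ob X t) B" "t \<in> obj (shape X)"
    and "germ C X t f = germ C X t f'"
  obtains r a where "a \<in> hom (shape X) r t" "f \<cdot> ar X a = f' \<cdot> ar X a"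
proof -
  obtain s a a' where a: "a \<in> hom (shape X) s t" "a' \<in> hom (shape X) s t" "f \<cdot> ar X a = f' \<cdot> ar X a'"
    using germ_eq assms by blast
  obtain r w where w: "w \<in> hom (shape X) r s" "a \<cdot>\<^bsub>shape X\<^esub> w = a' \<cdot>\<^bsub>shape X\<^esub> w"
    using equalize_index[OF a(1,2)] by metis
  have "f \<cdot> ar X (a \<cdot>\<^bsub>shape X\<^esub> w) = f' \<cdot> ar X (a \<cdot>\<^bsub>shape X\<^esub> w)"
    using restrict_restrict[OF assms(1) a(1) w(1)] restrict_restrict[OF assms(2) a(2) w(1)] a(3) w(2)
    by simp
  then show ?thesis using that I.cmp_hom[OF w(1) a(1)] by blast
qed

text \<open>Finitely many equations between germs hold on representatives after a single refinement; two equations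
  suffice below, since spans of indices have two legs.\<close>

lemma two_germs_eq:
  assumes f: "f \<in> hom C (ob X t) B" "f' \<in> hom C (ob X t') B" "germ C X t f = germ C X t' f'"
    and g: "g \<in> hom C (ob X t) D" "g' \<in> hom C (ob X t') D" "germ C X t g = germ C X t' g'"
    and t: "t \<in> obj (shape X)" "t' \<in> obj (shape X)"
  obtains r a a' where "a \<in> hom (shape X) r t" "a' \<in> hom (shape X) r t'"
    "f \<cdot> ar X a = f' \<cdot> ar X a'" "g \<cdot> ar X a = g' \<cdot> ar X a'"
proof -
  obtain s b b' where b: "b \<in> hom (shape X) s t" "b' \<in> hom (shape X) s t'"
    and fb: "f \<cdot> ar X b = f' \<cdot> ar X b'"
    using germ_eq[OF t(1) f(1) t(2) f(2)] f(3) by blast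
  have s: "s \<in> obj (shape X)" using I.hom_obj b by blast
  have "germ C X s (g \<cdot> ar X b) = germ C X s (g' \<cdot> ar X b')"
    using g(3) germ_restrict[OF g(1) b(1)] germ_restrict[OF g(2) b(2)] by simp
  then obtain r w where w: "w \<in> hom (shape X) r s"
    and eq: "(g \<cdot> ar X b) \<cdot> ar X w = (g' \<cdot> ar X b') \<cdot> ar X w"
    using germ_eq_restrict[OF restrict_hom[OF g(1) b(1)] restrict_hom[OF g(2) b(2)] s] by metis
  have "g \<cdot> ar X (b \<cdot>\<^bsub>shape X\<^esub> w) = g' \<cdot> ar X (b' \<cdot>\<^bsub>shape X\<^esub> w)"
    using eq restrict_restrict[OF g(1) b(1) w] restrict_restrict[OF g(2) b(2) w] by simp
  moreover have "f \<cdot> ar X (b \<cdot>\<^bsub>shape X\<^esub> w) = f' \<cdot> ar X (b' \<cdot>\<^bsub>shape X\<^esub> w)"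
    using fb restrict_restrict[OF f(1) b(1) w] restrict_restrict[OF f(2) b(2) w] by simp
  ultimately show ?thesis using that I.cmp_hom[OF w b(1)] I.cmp_hom[OF w b(2)] by blast
qed

lemma act_germ:
  assumes t: "t \<in> obj (shape X)" and f: "f \<in> hom C (ob X t) A" and g: "g \<in> hom C A B"
  shows "act (germs C X) g (germ C X t f) = germ C X t (g \<cdot> f)"
proof -
  have gf: "g \<cdot> f \<in> hom C (ob X t) B" using cmp_hom[OF f g] .
  have one: "pro_rel C X B `` {(t', g \<cdot> f')} = germ C X t (g \<cdot> f)"
    if "(t', f') \<in> germ C X t f" for t' f'
  proof -
    have t': "t' \<in> obj (shape X)" and f': "f' \<in> hom C (ob X t') A"
      and eq: "germ C X t' f' = germ C X t f"
      using germ_mem[OF t f] that by auto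
    obtain r a a' where a: "a \<in> hom (shape X) r t'" "a' \<in> hom (shape X) r t"
      "f' \<cdot> ar X a = f \<cdot> ar X a'"
      using germ_eq[OF t' f' t f] eq by blast
    have "(g \<cdot> f') \<cdot> ar X a = (g \<cdot> f) \<cdot> ar X a'"
      using a(3) cmp_assoc[OF ar_hom[OF a(1)] f' g] cmp_assoc[OF ar_hom[OF a(2)] f g] by simp
    then have "germ C X t' (g \<cdot> f') = germ C X t (g \<cdot> f)"
      using germ_eq[OF t' cmp_hom[OF f' g] t gf] a by blast
    then show ?thesis using germ_class[OF cmp_hom[OF f' g]] by simp
  qed
  have "pro_rel C X B `` {(t', g \<cdot> f') | t' f'. (t', f') \<in> germ C X t f} = germ C X t (g \<cdot> f)"
  proof (rule Image_constant[of "(t, g \<cdot> f)"])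
    fix z assume "z \<in> {(t', g \<cdot> f') | t' f'. (t', f') \<in> germ C X t f}"
    then obtain t' f' where "z = (t', g \<cdot> f')" "(t', f') \<in> germ C X t f" by blast
    then show "pro_rel C X B `` {z} = germ C X t (g \<cdot> f)" using one by simp
  qed (use germ_self[OF t f] in blast)
  moreover have "tgt C g = B" using homD[OF g] by simp
  ultimately show ?thesis by (simp add: germs_def)
qed

end

text \<open>Every germ is the image of the identity germ at some index, so the cofiltering conditions on the index
  category carry over to the category of elements.\<close>

sublocale pro_object \<subseteq> flat_functor C "germs C X"
proof
  fix A B D g h x y assume g: "g \<in> hom C A B" and x: "x \<in> el (germs C X) A"
  obtain t f where t: "t \<in> obj (shape X)" and f: "f \<in> hom C (ob X t) A" and xf: "x = germ C X t f"
    using germ_cases[OF x] .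
  show "act (germs C X) g x \<in> el (germs C X) B"
    using act_germ[OF t f g] germ_el[OF t cmp_hom[OF f g]] xf by simp
  assume h: "h \<in> hom C B D"
  show "act (germs C X) (h \<cdot> g) x = act (germs C X) h (act (germs C X) g x)"
    using act_germ[OF t f g] act_germ[OF t cmp_hom[OF f g] h] act_germ[OF t f cmp_hom[OF g h]] xf
      cmp_assoc[OF f g h] by simp
next
  obtain t where t: "t \<in> obj (shape X)" using cofil by (auto simp: cofiltered_def)
  then show "\<exists>A \<in> obj C. el (germs C X) A \<noteq> {}"
    using germ_el[OF t ident_hom[OF ob_obj[OF t]]] ob_obj by blast
next
  fix A B x y assume x: "x \<in> el (germs C X) A" and y: "y \<in> el (germs C X) B"
  obtain t f where t: "t \<in> obj (shape X)" and f: "f \<in> hom C (ob X t) A" and xf: "x = germ C X t f"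
    using germ_cases[OF x] .
  obtain s g where s: "s \<in> obj (shape X)" and g: "g \<in> hom C (ob X s) B" and yg: "y = germ C X s g"
    using germ_cases[OF y] .
  obtain r a b where a: "a \<in> hom (shape X) r t" and b: "b \<in> hom (shape X) r s"
    using common_refinement[OF t s] .
  have r: "r \<in> obj (shape X)" using I.hom_obj a by blast
  note i = ident_hom[OF ob_obj[OF r]]
  have fi: "act (germs C X) (f \<cdot> ar X a) (germ C X r (ident C (ob X r))) = x"
    using act_germ[OF r i restrict_hom[OF f a]] germ_restrict[OF f a] xf
      cmp_ident_right[OF restrict_hom[OF f a]] by simp
  have gi: "act (germs C X) (g \<cdot> ar X b) (germ C X r (ident C (ob X r))) = y"
    using act_germ[OF r i restrict_hom[OF g b]] germ_restrict[OF g b] yg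
      cmp_ident_right[OF restrict_hom[OF g b]] by simp
  show "\<exists>D. \<exists>z \<in> el (germs C X) D. \<exists>p \<in> hom C D A. \<exists>q \<in> hom C D B.
          act (germs C X) p z = x \<and> act (germs C X) q z = y"
    using fi gi germ_el[OF r i] restrict_hom[OF f a] restrict_hom[OF g b] by blast
next
  fix A B p q x assume p: "p \<in> hom C A B" and q: "q \<in> hom C A B" and x: "x \<in> el (germs C X) A"
    and eq: "act (germs C X) p x = act (germs C X) q x"
  obtain t f where t: "t \<in> obj (shape X)" and f: "f \<in> hom C (ob X t) A" and xf: "x = germ C X t f"
    using germ_cases[OF x] .
  have "germ C X t (p \<cdot> f) = germ C X t (q \<cdot> f)"
    using eq act_germ[OF t f p] act_germ[OF t f q] xf by simp
  then obtain r a where a: "a \<in> hom (shape X) r t" and eq': "(p \<cdot> f) \<cdot> ar X a = (q \<cdot> f) \<cdot> ar X a"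
    using germ_eq_restrict[OF cmp_hom[OF f p] cmp_hom[OF f q] t] by metis
  have r: "r \<in> obj (shape X)" using I.hom_obj a by blast
  note i = ident_hom[OF ob_obj[OF r]] and fa = restrict_hom[OF f a]
  have "act (germs C X) (f \<cdot> ar X a) (germ C X r (ident C (ob X r))) = x"
    using act_germ[OF r i fa] germ_restrict[OF f a] xf cmp_ident_right[OF fa] by simp
  moreover have "p \<cdot> (f \<cdot> ar X a) = q \<cdot> (f \<cdot> ar X a)"
    using eq' cmp_assoc[OF ar_hom[OF a] f p] cmp_assoc[OF ar_hom[OF a] f q] by simp
  ultimately show "\<exists>D. \<exists>z \<in> el (germs C X) D. \<exists>e \<in> hom C D A. act (germs C X) e z = x \<and> p \<cdot> e = q \<cdot> e"
    using germ_el[OF r i] fa by blast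
qed

section \<open>Pro-morphisms as natural transformations\<close>

text \<open>Precomposition of a germ on \<open>Y\<close> with \<open>\<phi> : X \<rightarrow> Y\<close>.  Composition of pro-morphisms is defined
  componentwise by this operation.\<close>

definition pull ::
  "('o, 'a) cat \<Rightarrow> ('u, 'o, 'a) sdiag \<Rightarrow> ('u \<Rightarrow> ('u \<times> 'a) set) \<Rightarrow> 'o \<Rightarrow> ('u \<times> 'a) set \<Rightarrow> ('u \<times> 'a) set"
  where "pull C X \<phi> B y = pro_rel C X B `` {(t, g \<cdot>\<^bsub>C\<^esub> f) | s t f g. (s, g) \<in> y \<and> (t, f) \<in> \<phi> s}"

lemma pro_homI:
  assumes "pro_object C X" "pro_object C Y" "\<phi> \<in> extensional (obj (shape Y))"
    and el: "\<And>s. s \<in> obj (shape Y) \<Longrightarrow> \<phi> s \<in> el (germs C X) (ob Y s)"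
    and comp: "\<And>s s' b. b \<in> hom (shape Y) s s' \<Longrightarrow> act (germs C X) (ar Y b) (\<phi> s) = \<phi> s'"
  shows "\<phi> \<in> pro_hom C X Y"
proof -
  interpret X: pro_object C X by fact
  interpret Y: pro_object C Y by fact
  have "(t, ar Y b \<cdot>\<^bsub>C\<^esub> f) \<in> \<phi> s'" if b: "b \<in> hom (shape Y) s s'" and tf: "(t, f) \<in> \<phi> s" for s s' b t f
  proof -
    have s: "s \<in> obj (shape Y)" "s' \<in> obj (shape Y)" using Y.I.hom_obj b by auto
    obtain t0 f0 where t0: "t0 \<in> obj (shape X)" "f0 \<in> hom C (ob X t0) (ob Y s)" "\<phi> s = germ C X t0 f0"
      using X.germ_cases[OF el[OF s(1)]] .
    have t: "t \<in> obj (shape X)" "f \<in> hom C (ob X t) (ob Y s)" "\<phi> s = germ C X t f"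
      using X.germ_mem[OF t0(1,2)] tf t0(3) by auto
    have "germ C X t (ar Y b \<cdot>\<^bsub>C\<^esub> f) = \<phi> s'"
      using comp[OF b] X.act_germ[OF t(1,2) Y.ar_hom[OF b]] t(3) by simp
    then show ?thesis
      using X.germ_self[OF t(1) X.cmp_hom[OF t(2) Y.ar_hom[OF b]]] by simp
  qed
  then show ?thesis using assms(3) el
    by (auto simp: pro_hom_def PiE_def germs_def)
qed

locale pro_map = X: pro_object C X + Y: pro_object C Y
  for C :: "('o, 'a) cat" (structure) and X Y :: "('u, 'o, 'a) sdiag" +
  fixes \<phi> :: "'u \<Rightarrow> ('u \<times> 'a) set"
  assumes pro_hom: "\<phi> \<in> pro_hom C X Y"
begin

lemma component_el: "s \<in> obj (shape Y) \<Longrightarrow> \<phi> s \<in> el (germs C X) (ob Y s)"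
  using pro_hom by (auto simp: pro_hom_def germs_def)

lemma extensional: "\<phi> \<in> extensional (obj (shape Y))"
  using pro_hom by (auto simp: pro_hom_def PiE_def)

lemma component_compatible:
  assumes b: "b \<in> hom (shape Y) s s'"
  shows "act (germs C X) (ar Y b) (\<phi> s) = \<phi> s'"
proof -
  have s: "s \<in> obj (shape Y)" "s' \<in> obj (shape Y)" using Y.I.hom_obj b by auto
  obtain t f where t: "t \<in> obj (shape X)" "f \<in> hom C (ob X t) (ob Y s)" "\<phi> s = germ C X t f"
    using X.germ_cases[OF component_el[OF s(1)]] .
  obtain t' f' where t': "t' \<in> obj (shape X)" "f' \<in> hom C (ob X t') (ob Y s')" "\<phi> s' = germ C X t' f'"
    using X.germ_cases[OF component_el[OF s(2)]] .
  have "(t, f) \<in> \<phi> s" using X.germ_self[OF t(1,2)] t(3) by simp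
  then have "(t, ar Y b \<cdot> f) \<in> \<phi> s'"
    using pro_hom b unfolding pro_hom_def by fast
  then have "germ C X t (ar Y b \<cdot> f) = \<phi> s'" using X.germ_mem[OF t'(1,2)] t'(3) by auto
  then show ?thesis using X.act_germ[OF t(1,2) Y.ar_hom[OF b]] t(3) by simp
qed

lemma pull_germ:
  assumes s: "s \<in> obj (shape Y)" and g: "g \<in> hom C (ob Y s) B"
  shows "pull C X \<phi> B (germ C Y s g) = act (germs C X) g (\<phi> s)"
proof -
  obtain t f where t: "t \<in> obj (shape X)" and f: "f \<in> hom C (ob X t) (ob Y s)"
    and \<phi>s: "\<phi> s = germ C X t f"
    using X.germ_cases[OF component_el[OF s]] .
  have tgf: "act (germs C X) g (\<phi> s) = germ C X t (g \<cdot> f)" using X.act_germ[OF t f g] \<phi>s by simp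
  have one: "pro_rel C X B `` {(t', g' \<cdot> f')} = germ C X t (g \<cdot> f)"
    if sg: "(s', g') \<in> germ C Y s g" and tf: "(t', f') \<in> \<phi> s'" for s' g' t' f'
  proof -
    have s': "s' \<in> obj (shape Y)" and g': "g' \<in> hom C (ob Y s') B"
      and eq: "germ C Y s' g' = germ C Y s g"
      using Y.germ_mem[OF s g] sg by auto
    obtain r b b' where b: "b \<in> hom (shape Y) r s'" "b' \<in> hom (shape Y) r s"
      and gb: "g' \<cdot> ar Y b = g \<cdot> ar Y b'"
      using Y.germ_eq[OF s' g' s g] eq by blast
    have r: "r \<in> obj (shape Y)" using Y.I.hom_obj b by blast
    have "act (germs C X) g' (\<phi> s') = act (germs C X) (g' \<cdot> ar Y b) (\<phi> r)"
      using X.act_cmp[OF Y.ar_hom[OF b(1)] g' component_el[OF r]] component_compatible[OF b(1)] by simp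
    also have "\<dots> = act (germs C X) g (\<phi> s)"
      using X.act_cmp[OF Y.ar_hom[OF b(2)] g component_el[OF r]] component_compatible[OF b(2)] gb by simp
    finally have *: "act (germs C X) g' (\<phi> s') = act (germs C X) g (\<phi> s)" .
    obtain t0 f0 where t0: "t0 \<in> obj (shape X)" "f0 \<in> hom C (ob X t0) (ob Y s')" "\<phi> s' = germ C X t0 f0"
      using X.germ_cases[OF component_el[OF s']] .
    have t': "t' \<in> obj (shape X)" "f' \<in> hom C (ob X t') (ob Y s')" "\<phi> s' = germ C X t' f'"
      using X.germ_mem[OF t0(1,2)] tf t0(3) by auto
    show ?thesis
      using * X.act_germ[OF t'(1,2) g'] t'(3) tgf X.germ_class[OF X.cmp_hom[OF t'(2) g']] by simp
  qed
  have "(t, f) \<in> \<phi> s" using X.germ_self[OF t f] \<phi>s by simp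
  then have mem: "(t, g \<cdot> f) \<in> {(t', g' \<cdot> f') | s' t' f' g'. (s', g') \<in> germ C Y s g \<and> (t', f') \<in> \<phi> s'}"
    using Y.germ_self[OF s g] by blast
  have "pull C X \<phi> B (germ C Y s g) = germ C X t (g \<cdot> f)"
    unfolding pull_def
  proof (rule Image_constant[of "(t, g \<cdot> f)"])
    fix z assume "z \<in> {(t', g' \<cdot> f') | s' t' f' g'. (s', g') \<in> germ C Y s g \<and> (t', f') \<in> \<phi> s'}"
    then obtain s' t' f' g' where "z = (t', g' \<cdot> f')" "(s', g') \<in> germ C Y s g" "(t', f') \<in> \<phi> s'"
      by blast
    then show "pro_rel C X B `` {z} = germ C X t (g \<cdot> f)" using one by simp
  qed (use mem in blast)
  then show ?thesis using tgf by simp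
qed

lemma pull_natural: "natural C (germs C Y) (germs C X) (pull C X \<phi>)"
  unfolding natural_def
proof (intro conjI allI ballI)
  fix A y assume "y \<in> el (germs C Y) A"
  then obtain s h where s: "s \<in> obj (shape Y)" and h: "h \<in> hom C (ob Y s) A" and y: "y = germ C Y s h"
    using Y.germ_cases by blast
  show "pull C X \<phi> A y \<in> el (germs C X) A"
    using pull_germ[OF s h] y X.act_el[OF h component_el[OF s]] by simp
  fix B g assume g: "g \<in> hom C A B"
  show "pull C X \<phi> B (act (germs C Y) g y) = act (germs C X) g (pull C X \<phi> A y)"
    using Y.act_germ[OF s h g] pull_germ[OF s h] pull_germ[OF s X.cmp_hom[OF h g]] y
      X.act_cmp[OF h g component_el[OF s]] by simp
qed

text \<open>By this and \<open>pull_germ\<close>, a pro-morphism and its action on germs determine each other (Yoneda).\<close>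

lemma pull_component:
  assumes "s \<in> obj (shape Y)"
  shows "pull C X \<phi> (ob Y s) (germ C Y s (ident C (ob Y s))) = \<phi> s"
proof -
  obtain t f where t: "t \<in> obj (shape X)" "f \<in> hom C (ob X t) (ob Y s)" "\<phi> s = germ C X t f"
    using X.germ_cases[OF component_el[OF assms]] .
  have i: "ident C (ob Y s) \<in> hom C (ob Y s) (ob Y s)" using X.ident_hom Y.ob_obj assms by blast
  show ?thesis
    using pull_germ[OF assms i] X.act_germ[OF t(1,2) i] X.cmp_ident_left[OF t(2)] t(3) by simp
qed

end

section \<open>The pro-category\<close>

text \<open>An isomorphism of morphisms spelled out as two pairs of arrows, a form that is symmetric under reversal
  of all arrows.\<close>

lemma isomorphic_arrow_cat:
  "isomorphic (arrow_cat P) f g \<longleftrightarrow> f \<in> arr P \<and> g \<in> arr P \<and>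
     (\<exists>a \<in> hom P (src P f) (src P g). \<exists>b \<in> hom P (tgt P f) (tgt P g).
      \<exists>a' \<in> hom P (src P g) (src P f). \<exists>b' \<in> hom P (tgt P g) (tgt P f).
        b \<cdot>\<^bsub>P\<^esub> f = g \<cdot>\<^bsub>P\<^esub> a \<and> b' \<cdot>\<^bsub>P\<^esub> g = f \<cdot>\<^bsub>P\<^esub> a' \<and>
        a' \<cdot>\<^bsub>P\<^esub> a = ident P (src P f) \<and> b' \<cdot>\<^bsub>P\<^esub> b = ident P (tgt P f) \<and>
        a \<cdot>\<^bsub>P\<^esub> a' = ident P (src P g) \<and> b \<cdot>\<^bsub>P\<^esub> b' = ident P (tgt P g))"
  (is "?L \<longleftrightarrow> ?R")
proof
  assume ?L
  then show ?R
    unfolding isomorphic_def isos_def hom_def[of "arrow_cat P"] by (auto simp: arrow_cat_def)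
next
  assume ?R
  then obtain a b a' b' where "f \<in> arr P" "g \<in> arr P"
    "a \<in> hom P (src P f) (src P g)" "b \<in> hom P (tgt P f) (tgt P g)"
    "a' \<in> hom P (src P g) (src P f)" "b' \<in> hom P (tgt P g) (tgt P f)"
    "b \<cdot>\<^bsub>P\<^esub> f = g \<cdot>\<^bsub>P\<^esub> a" "b' \<cdot>\<^bsub>P\<^esub> g = f \<cdot>\<^bsub>P\<^esub> a'"
    "a' \<cdot>\<^bsub>P\<^esub> a = ident P (src P f)" "b' \<cdot>\<^bsub>P\<^esub> b = ident P (tgt P f)"
    "a \<cdot>\<^bsub>P\<^esub> a' = ident P (src P g)" "b \<cdot>\<^bsub>P\<^esub> b' = ident P (tgt P g)" by blast
  then have "(f, (a, b), g) \<in> isos (arrow_cat P) \<and> (f, (a, b), g) \<in> hom (arrow_cat P) f g"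
    unfolding isos_def hom_def[of "arrow_cat P"] by (auto simp: arrow_cat_def)
  then show ?L unfolding isomorphic_def by blast
qed

lemma pro_cat_simps [simp]:
  "src (pro_cat C) (X, \<phi>, Y) = X" "tgt (pro_cat C) (X, \<phi>, Y) = Y"
  by (simp_all add: pro_cat_def)

lemma (in category) pro_map_arr: "(X, \<phi>, Y) \<in> arr (pro_cat C) \<longleftrightarrow> pro_map C X Y \<phi>"
  using category_axioms
  by (auto simp: pro_cat_def pro_map_def pro_map_axioms_def pro_object_def pro_object_axioms_def)

lemma (in category) pro_map_hom:
  "f \<in> hom (pro_cat C) X Y \<longleftrightarrow> (\<exists>\<phi>. f = (X, \<phi>, Y) \<and> pro_map C X Y \<phi>)"
  using pro_map_arr by (cases f) (auto simp: hom_def)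

definition pro_cmp ::
  "('o, 'a) cat \<Rightarrow> ('u, 'o, 'a) sdiag \<Rightarrow> ('u \<Rightarrow> ('u \<times> 'a) set) \<Rightarrow> ('u \<Rightarrow> ('u \<times> 'a) set) \<Rightarrow>
     ('u, 'o, 'a) sdiag \<Rightarrow> ('u \<Rightarrow> ('u \<times> 'a) set)" where
  "pro_cmp C X \<phi> \<psi> Z = (\<lambda>r \<in> obj (shape Z). pull C X \<phi> (ob Z r) (\<psi> r))"

definition pro_ident :: "('o, 'a) cat \<Rightarrow> ('u, 'o, 'a) sdiag \<Rightarrow> ('u \<Rightarrow> ('u \<times> 'a) set)" where
  "pro_ident C X = (\<lambda>s \<in> obj (shape X). germ C X s (ident C (ob X s)))"

definition level_map ::
  "('o, 'a) cat \<Rightarrow> ('u, 'o, 'a) sdiag \<Rightarrow> ('u, 'o, 'a) sdiag \<Rightarrow> ('u \<Rightarrow> 'a) \<Rightarrow> ('u \<Rightarrow> ('u \<times> 'a) set)" where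
  "level_map C X Y \<eta> = (\<lambda>s \<in> obj (shape Y). germ C X s (\<eta> s))"

lemma cmp_pro_cat:
  "(Y', \<psi>, Z) \<cdot>\<^bsub>pro_cat C\<^esub> (X, \<phi>, Y) = (X, pro_cmp C X \<phi> \<psi> Z, Z)"
  by (simp add: pro_cat_def pro_cmp_def pull_def)

lemma (in pro_object) ident_pro_cat: "ident (pro_cat C) X = (X, pro_ident C X, X)"
  by (auto simp: pro_cat_def pro_ident_def germ_def ob_obj intro!: restrict_ext)

lemma pro_map_cmp:
  assumes "pro_map C X Y \<phi>" "pro_map C Y Z \<psi>"
  shows "pro_map C X Z (pro_cmp C X \<phi> \<psi> Z)"
    and "z \<in> el (germs C Z) B \<Longrightarrow> pull C X (pro_cmp C X \<phi> \<psi> Z) B z = pull C X \<phi> B (pull C Y \<psi> B z)"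
proof -
  interpret \<phi>: pro_map C X Y \<phi> by fact
  interpret \<psi>: pro_map C Y Z \<psi> by fact
  have "pro_cmp C X \<phi> \<psi> Z \<in> pro_hom C X Z"
  proof (rule pro_homI[OF \<phi>.X.pro_object_axioms \<psi>.Y.pro_object_axioms])
    show "pro_cmp C X \<phi> \<psi> Z \<in> extensional (obj (shape Z))" by (simp add: pro_cmp_def)
    show "pro_cmp C X \<phi> \<psi> Z s \<in> el (germs C X) (ob Z s)" if "s \<in> obj (shape Z)" for s
      using natural_el[OF \<phi>.pull_natural \<psi>.component_el[OF that]] that by (simp add: pro_cmp_def)
    show "act (germs C X) (ar Z b) (pro_cmp C X \<phi> \<psi> Z s) = pro_cmp C X \<phi> \<psi> Z s'"
      if b: "b \<in> hom (shape Z) s s'" for s s' b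
    proof -
      have s: "s \<in> obj (shape Z)" "s' \<in> obj (shape Z)" using \<psi>.Y.I.hom_obj[OF b] by auto
      show ?thesis
        using natural_act[OF \<phi>.pull_natural \<psi>.Y.ar_hom[OF b] \<psi>.component_el[OF s(1)]]
          \<psi>.component_compatible[OF b] s by (simp add: pro_cmp_def)
    qed
  qed
  then show c: "pro_map C X Z (pro_cmp C X \<phi> \<psi> Z)"
    by (simp add: pro_map_def pro_map_axioms_def \<phi>.X.pro_object_axioms \<psi>.Y.pro_object_axioms)
  interpret c: pro_map C X Z "pro_cmp C X \<phi> \<psi> Z" by (rule c)
  assume "z \<in> el (germs C Z) B"
  then obtain r g where r: "r \<in> obj (shape Z)" and g: "g \<in> hom C (ob Z r) B" and z: "z = germ C Z r g"
    using \<psi>.Y.germ_cases by blast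
  show "pull C X (pro_cmp C X \<phi> \<psi> Z) B z = pull C X \<phi> B (pull C Y \<psi> B z)"
    using c.pull_germ[OF r g] \<psi>.pull_germ[OF r g] r z
      natural_act[OF \<phi>.pull_natural g \<psi>.component_el[OF r]] by (simp add: pro_cmp_def)
qed

lemma (in pro_object) pro_map_ident:
  shows "pro_map C X X (pro_ident C X)"
    and "z \<in> el (germs C X) B \<Longrightarrow> pull C X (pro_ident C X) B z = z"
proof -
  have "pro_ident C X \<in> pro_hom C X X"
  proof (rule pro_homI[OF pro_object_axioms pro_object_axioms])
    show "pro_ident C X \<in> extensional (obj (shape X))" by (simp add: pro_ident_def)
    show "pro_ident C X s \<in> el (germs C X) (ob X s)" if "s \<in> obj (shape X)" for s
      using germ_el[OF that ident_hom[OF ob_obj[OF that]]] that by (simp add: pro_ident_def)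
    show "act (germs C X) (ar X b) (pro_ident C X s) = pro_ident C X s'"
      if b: "b \<in> hom (shape X) s s'" for s s' b
    proof -
      have s: "s \<in> obj (shape X)" "s' \<in> obj (shape X)" using I.hom_obj[OF b] by auto
      show ?thesis
        using act_germ[OF s(1) ident_hom[OF ob_obj[OF s(1)]] ar_hom[OF b]] s
          germ_restrict[OF ident_hom[OF ob_obj[OF s(2)]] b]
          cmp_ident_right[OF ar_hom[OF b]] cmp_ident_left[OF ar_hom[OF b]] by (simp add: pro_ident_def)
    qed
  qed
  then show c: "pro_map C X X (pro_ident C X)"
    by (simp add: pro_map_def pro_map_axioms_def pro_object_axioms)
  interpret c: pro_map C X X "pro_ident C X" by (rule c)
  assume "z \<in> el (germs C X) B"
  then obtain r g where r: "r \<in> obj (shape X)" and g: "g \<in> hom C (ob X r) B" and z: "z = germ C X r g"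
    using germ_cases by blast
  show "pull C X (pro_ident C X) B z = z"
    using c.pull_germ[OF r g] act_germ[OF r ident_hom[OF ob_obj[OF r]] g] cmp_ident_right[OF g] r z
    by (simp add: pro_ident_def)
qed

lemma pro_map_level:
  fixes C :: "('o, 'a) cat" (structure)
  assumes "category C" and nt: "nat_trans C X Y \<eta>" and cof: "cofiltered (shape X)"
  shows "pro_map C X Y (level_map C X Y \<eta>)"
    and "s \<in> obj (shape Y) \<Longrightarrow> g \<in> hom C (ob Y s) B \<Longrightarrow>
      pull C X (level_map C X Y \<eta>) B (germ C Y s g) = germ C X s (g \<cdot> \<eta> s)"
    and "pro_induced C X Y \<eta> = (X, level_map C X Y \<eta>, Y)"
proof -
  have dX: "is_diagram C X" and dY: "is_diagram C Y" and sh: "shape Y = shape X"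
    and \<eta>: "\<And>s. s \<in> obj (shape X) \<Longrightarrow> \<eta> s \<in> hom C (ob X s) (ob Y s)"
    and nat: "\<And>s t u. u \<in> hom (shape X) s t \<Longrightarrow> \<eta> t \<cdot> ar X u = ar Y u \<cdot> \<eta> s"
    using nt unfolding nat_trans_def by metis+
  interpret X: pro_object C X
    using assms(1) dX cof by (simp add: pro_object_def pro_object_axioms_def)
  interpret Y: pro_object C Y
    using assms(1) dY cof sh by (simp add: pro_object_def pro_object_axioms_def)
  have "level_map C X Y \<eta> \<in> pro_hom C X Y"
  proof (rule pro_homI[OF X.pro_object_axioms Y.pro_object_axioms])
    show "level_map C X Y \<eta> \<in> extensional (obj (shape Y))" by (simp add: level_map_def)
    show "level_map C X Y \<eta> s \<in> el (germs C X) (ob Y s)" if "s \<in> obj (shape Y)" for s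
      using X.germ_el[OF _ \<eta>] that sh by (simp add: level_map_def)
    show "act (germs C X) (ar Y b) (level_map C X Y \<eta> s) = level_map C X Y \<eta> s'"
      if b: "b \<in> hom (shape Y) s s'" for s s' b
    proof -
      have b': "b \<in> hom (shape X) s s'" using b sh by simp
      then have s: "s \<in> obj (shape X)" "s' \<in> obj (shape X)" using X.I.hom_obj by auto
      show ?thesis
        using X.act_germ[OF s(1) \<eta>[OF s(1)] Y.ar_hom[OF b]] nat[OF b'] X.germ_restrict[OF \<eta>[OF s(2)] b']
          s sh by (simp add: level_map_def)
    qed
  qed
  then show c: "pro_map C X Y (level_map C X Y \<eta>)"
    by (simp add: pro_map_def pro_map_axioms_def X.pro_object_axioms Y.pro_object_axioms)
  interpret c: pro_map C X Y "level_map C X Y \<eta>" by (rule c)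
  show "pull C X (level_map C X Y \<eta>) B (germ C Y s g) = germ C X s (g \<cdot> \<eta> s)"
    if s: "s \<in> obj (shape Y)" and g: "g \<in> hom C (ob Y s) B"
    using c.pull_germ[OF s g] X.act_germ[OF _ \<eta> g] s sh by (simp add: level_map_def)
  show "pro_induced C X Y \<eta> = (X, level_map C X Y \<eta>, Y)"
    using \<eta> sh by (auto simp: pro_induced_def level_map_def germ_def hom_def intro!: restrict_ext)
qed

lemma pro_map_eqI:
  assumes "pro_map C X Y \<phi>" "pro_map C X Y \<psi>"
    and "\<And>B y. y \<in> el (germs C Y) B \<Longrightarrow> pull C X \<phi> B y = pull C X \<psi> B y"
  shows "\<phi> = \<psi>"
proof (rule extensionalityI)
  interpret \<phi>: pro_map C X Y \<phi> by fact
  interpret \<psi>: pro_map C X Y \<psi> by fact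
  show "\<phi> \<in> extensional (obj (shape Y))" "\<psi> \<in> extensional (obj (shape Y))"
    using \<phi>.extensional \<psi>.extensional .
  fix s assume s: "s \<in> obj (shape Y)"
  show "\<phi> s = \<psi> s"
    using \<phi>.pull_component[OF s] \<psi>.pull_component[OF s]
      assms(3)[OF \<phi>.Y.germ_el[OF s \<phi>.X.ident_hom[OF \<phi>.Y.ob_obj[OF s]]]] by simp
qed

text \<open>Yoneda: a pro-morphism that acts bijectively on germs is invertible.  Surjectivity is only required for
  the identity germs of \<open>X\<close>; their preimages are the components of the inverse.\<close>

lemma pro_map_inverse:
  assumes "pro_map C X X' \<alpha>"
    and inj: "\<And>B z z'. z \<in> el (germs C X') B \<Longrightarrow> z' \<in> el (germs C X') B \<Longrightarrow>
      pull C X \<alpha> B z = pull C X \<alpha> B z' \<Longrightarrow> z = z'"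
    and surj: "\<And>t. t \<in> obj (shape X) \<Longrightarrow>
      \<exists>z \<in> el (germs C X') (ob X t). pull C X \<alpha> (ob X t) z = germ C X t (ident C (ob X t))"
  obtains \<alpha>' where "pro_map C X' X \<alpha>'"
    "\<And>B x. x \<in> el (germs C X) B \<Longrightarrow> pull C X \<alpha> B (pull C X' \<alpha>' B x) = x"
    "\<And>B z. z \<in> el (germs C X') B \<Longrightarrow> pull C X' \<alpha>' B (pull C X \<alpha> B z) = z"
proof -
  interpret \<alpha>: pro_map C X X' \<alpha> by fact
  note i = \<alpha>.X.ident_hom[OF \<alpha>.X.ob_obj]
  obtain \<beta> where \<beta>: "\<And>t. t \<in> obj (shape X) \<Longrightarrow> \<beta> t \<in> el (germs C X') (ob X t)"
    "\<And>t. t \<in> obj (shape X) \<Longrightarrow> pull C X \<alpha> (ob X t) (\<beta> t) = germ C X t (ident C (ob X t))"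
    using surj by metis
  define \<alpha>' where "\<alpha>' = restrict \<beta> (obj (shape X))"
  have "\<alpha>' \<in> pro_hom C X' X"
  proof (rule pro_homI[OF \<alpha>.Y.pro_object_axioms \<alpha>.X.pro_object_axioms])
    show "\<alpha>' \<in> extensional (obj (shape X))" by (simp add: \<alpha>'_def)
    show "\<alpha>' s \<in> el (germs C X') (ob X s)" if "s \<in> obj (shape X)" for s
      using \<beta>(1) that by (simp add: \<alpha>'_def)
    show "act (germs C X') (ar X b) (\<alpha>' s) = \<alpha>' s'" if b: "b \<in> hom (shape X) s s'" for s s' b
    proof -
      have s: "s \<in> obj (shape X)" "s' \<in> obj (shape X)" using \<alpha>.X.I.hom_obj[OF b] by auto
      have "pull C X \<alpha> (ob X s') (act (germs C X') (ar X b) (\<beta> s)) = germ C X s (ar X b)"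
        using natural_act[OF \<alpha>.pull_natural \<alpha>.X.ar_hom[OF b] \<beta>(1)[OF s(1)]] \<beta>(2)[OF s(1)]
          \<alpha>.X.act_germ[OF s(1) i[OF s(1)] \<alpha>.X.ar_hom[OF b]]
          \<alpha>.X.cmp_ident_right[OF \<alpha>.X.ar_hom[OF b]] by simp
      also have "\<dots> = pull C X \<alpha> (ob X s') (\<beta> s')"
        using \<alpha>.X.germ_restrict[OF i[OF s(2)] b] \<alpha>.X.cmp_ident_left[OF \<alpha>.X.ar_hom[OF b]]
          \<beta>(2)[OF s(2)] by simp
      finally have "act (germs C X') (ar X b) (\<beta> s) = \<beta> s'"
        using inj \<alpha>.Y.act_el[OF \<alpha>.X.ar_hom[OF b] \<beta>(1)[OF s(1)]] \<beta>(1)[OF s(2)] by blast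
      then show ?thesis using s by (simp add: \<alpha>'_def)
    qed
  qed
  then have pm: "pro_map C X' X \<alpha>'"
    by (simp add: pro_map_def pro_map_axioms_def \<alpha>.X.pro_object_axioms \<alpha>.Y.pro_object_axioms)
  interpret \<alpha>': pro_map C X' X \<alpha>' by (rule pm)
  have left: "pull C X \<alpha> B (pull C X' \<alpha>' B x) = x" if x: "x \<in> el (germs C X) B" for B x
  proof -
    obtain t f where t: "t \<in> obj (shape X)" and f: "f \<in> hom C (ob X t) B" and xf: "x = germ C X t f"
      using \<alpha>.X.germ_cases[OF x] .
    have "pull C X \<alpha> B (act (germs C X') f (\<beta> t)) = x"
      using natural_act[OF \<alpha>.pull_natural f \<beta>(1)[OF t]] \<beta>(2)[OF t] \<alpha>.X.act_germ[OF t i[OF t] f]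
        \<alpha>.X.cmp_ident_right[OF f] xf by simp
    then show ?thesis using \<alpha>'.pull_germ[OF t f] xf t by (simp add: \<alpha>'_def)
  qed
  have "pull C X' \<alpha>' B (pull C X \<alpha> B z) = z" if z: "z \<in> el (germs C X') B" for B z
  proof -
    have x: "pull C X \<alpha> B z \<in> el (germs C X) B" using natural_el[OF \<alpha>.pull_natural z] .
    show ?thesis
      using inj[OF natural_el[OF \<alpha>'.pull_natural x] z left[OF x]] .
  qed
  then show ?thesis using that[OF pm left] by blast
qed

section \<open>Level maps in \<open>W\<close> are approximable\<close>

text \<open>Approximability is invariant under isomorphism, so a square to \<open>f\<close> may be transported to a level map
  \<open>\<eta>\<close>.  There the two germs have representatives at one index, and the square commutes on representatives
  after restriction to a deeper index \<open>l\<close>.  So it factors through \<open>\<eta> l\<close>.\<close>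

lemma pro_Lw_approximable:
  fixes C :: "('o, 'a) cat" (structure)
  assumes "category C" and Lw: "(X, \<phi>, Y) \<in> pro_Lw C W"
  shows "approximable C W (germs C Y) (germs C X) (pull C X \<phi>)"
proof -
  interpret category C by fact
  obtain X' Y' \<eta> where nt: "nat_trans C X' Y' \<eta>" and cof: "cofiltered (shape X')"
    and W: "\<And>s. s \<in> obj (shape X') \<Longrightarrow> \<eta> s \<in> W"
    and iso: "isomorphic (arrow_cat (pro_cat C)) (X, \<phi>, Y) (pro_induced C X' Y' \<eta>)"
    using Lw unfolding pro_Lw_def by blast
  note lev = pro_map_level[OF assms(1) nt cof]
  let ?h = "level_map C X' Y' \<eta>"
  obtain a b a' b' where ab: "a \<in> hom (pro_cat C) X X'" "b \<in> hom (pro_cat C) Y Y'"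
    "a' \<in> hom (pro_cat C) X' X" "b' \<in> hom (pro_cat C) Y' Y"
    "b \<cdot>\<^bsub>pro_cat C\<^esub> (X, \<phi>, Y) = (X', ?h, Y') \<cdot>\<^bsub>pro_cat C\<^esub> a"
    "a' \<cdot>\<^bsub>pro_cat C\<^esub> a = ident (pro_cat C) X" "b' \<cdot>\<^bsub>pro_cat C\<^esub> b = ident (pro_cat C) Y"
    "a \<cdot>\<^bsub>pro_cat C\<^esub> a' = ident (pro_cat C) X'"
    using iso unfolding isomorphic_arrow_cat lev(3) by auto
  obtain \<alpha> \<beta> \<alpha>' \<beta>' where eqs: "a = (X, \<alpha>, X')" "b = (Y, \<beta>, Y')" "a' = (X', \<alpha>', X)" "b' = (Y', \<beta>', Y)"
    and pm: "pro_map C X X' \<alpha>" "pro_map C Y Y' \<beta>" "pro_map C X' X \<alpha>'" "pro_map C Y' Y \<beta>'"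
    using ab(1-4) unfolding pro_map_hom by blast
  have pm\<phi>: "pro_map C X Y \<phi>" using Lw by (simp add: pro_Lw_def pro_map_arr)
  interpret X: pro_object C X using pm\<phi> by (simp add: pro_map_def)
  interpret Y: pro_object C Y using pm\<phi> by (simp add: pro_map_def)
  interpret X': pro_object C X' using pm(1) by (simp add: pro_map_def)
  interpret Y': pro_object C Y' using pm(2) by (simp add: pro_map_def)
  interpret \<phi>: pro_map C X Y \<phi> by (rule pm\<phi>)
  interpret \<alpha>: pro_map C X X' \<alpha> by (rule pm)
  interpret \<beta>: pro_map C Y Y' \<beta> by (rule pm)
  interpret \<alpha>': pro_map C X' X \<alpha>' by (rule pm)
  interpret \<beta>': pro_map C Y' Y \<beta>' by (rule pm)
  interpret h: pro_map C X' Y' ?h by (rule lev)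
  have sq: "pull C X \<phi> B (pull C Y \<beta> B z) = pull C X \<alpha> B (pull C X' ?h B z)"
    if "z \<in> el (germs C Y') B" for B z
    using pro_map_cmp(2)[OF pm\<phi> pm(2) that] pro_map_cmp(2)[OF pm(1) lev(1) that] ab(5)
    by (simp add: eqs cmp_pro_cat)
  have inv1: "pull C X \<alpha> B (pull C X' \<alpha>' B x) = x" if "x \<in> el (germs C X) B" for B x
    using pro_map_cmp(2)[OF pm(1,3) that] ab(6) X.pro_map_ident(2)[OF that]
    by (simp add: eqs cmp_pro_cat X.ident_pro_cat)
  have inv2: "pull C Y \<beta> B (pull C Y' \<beta>' B y) = y" if "y \<in> el (germs C Y) B" for B y
    using pro_map_cmp(2)[OF pm(2,4) that] ab(7) Y.pro_map_ident(2)[OF that]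
    by (simp add: eqs cmp_pro_cat Y.ident_pro_cat)
  have inv3: "pull C X' \<alpha>' B (pull C X \<alpha> B x) = x" if "x \<in> el (germs C X') B" for B x
    using pro_map_cmp(2)[OF pm(3,1) that] ab(8) X'.pro_map_ident(2)[OF that]
    by (simp add: eqs cmp_pro_cat X'.ident_pro_cat)
  have sh: "shape Y' = shape X'" using nt by (simp add: nat_trans_def)
  show ?thesis
    unfolding approximable_def
  proof (intro allI ballI impI)
    fix P R f x y assume f: "f \<in> hom C P R" and x: "x \<in> el (germs C X) P"
      and y: "y \<in> el (germs C Y) R" and eq: "act (germs C X) f x = pull C X \<phi> R y"
    \<comment> \<open>Transport the square along the isomorphism to the level map.\<close>
    define x' where "x' = pull C X' \<alpha>' P x"
    define y' where "y' = pull C Y' \<beta>' R y"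
    have x': "x' \<in> el (germs C X') P" and y': "y' \<in> el (germs C Y') R"
      using natural_el[OF \<alpha>'.pull_natural x] natural_el[OF \<beta>'.pull_natural y] by (auto simp: x'_def y'_def)
    have eq': "act (germs C X') f x' = pull C X' ?h R y'"
      using natural_act[OF \<alpha>'.pull_natural f x] eq inv2[OF y] sq[OF y'] inv3[OF natural_el[OF h.pull_natural y']]
      by (simp add: x'_def y'_def)
    obtain i p where i: "i \<in> obj (shape X')" and p: "p \<in> hom C (ob X' i) P" and xp: "x' = germ C X' i p"
      using X'.germ_cases[OF x'] .
    obtain k q where k: "k \<in> obj (shape Y')" and q: "q \<in> hom C (ob Y' k) R" and yq: "y' = germ C Y' k q"
      using Y'.germ_cases[OF y'] .
    obtain r u v where u: "u \<in> hom (shape X') r i" and v: "v \<in> hom (shape X') r k"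
      using X'.common_refinement[OF i] k sh by metis
    have v': "v \<in> hom (shape Y') r k" using v sh by simp
    have r: "r \<in> obj (shape X')" "r \<in> obj (shape Y')" using X'.I.hom_obj[OF u] sh by auto
    define p' where "p' = p \<cdot> ar X' u"
    define q' where "q' = q \<cdot> ar Y' v"
    have p': "p' \<in> hom C (ob X' r) P" and q': "q' \<in> hom C (ob Y' r) R"
      using X'.restrict_hom[OF p u] Y'.restrict_hom[OF q v'] by (auto simp: p'_def q'_def)
    have xp': "x' = germ C X' r p'" and yq': "y' = germ C Y' r q'"
      using X'.germ_restrict[OF p u] Y'.germ_restrict[OF q v'] xp yq by (auto simp: p'_def q'_def)
    have \<eta>: "\<eta> s \<in> hom C (ob X' s) (ob Y' s)" if "s \<in> obj (shape X')" for s
      using nt that by (simp add: nat_trans_def)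
    \<comment> \<open>The square commutes as an equation of germs; the index \<open>l\<close> is where it holds on representatives.\<close>
    have "germ C X' r (f \<cdot> p') = germ C X' r (q' \<cdot> \<eta> r)"
      using eq' X'.act_germ[OF r(1) p' f] lev(2)[OF r(2) q'] xp' yq' by simp
    then obtain l w where w: "w \<in> hom (shape X') l r" and e: "(f \<cdot> p') \<cdot> ar X' w = (q' \<cdot> \<eta> r) \<cdot> ar X' w"
      using X'.germ_eq_restrict[OF cmp_hom[OF p' f] cmp_hom[OF \<eta>[OF r(1)] q'] r(1)] by metis
    have w': "w \<in> hom (shape Y') l r" using w sh by simp
    have l: "l \<in> obj (shape X')" "l \<in> obj (shape Y')" using X'.I.hom_obj[OF w] sh by auto
    have nat: "\<eta> r \<cdot> ar X' w = ar Y' w \<cdot> \<eta> l" using nt w by (simp add: nat_trans_def)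
    let ?a = "p' \<cdot> ar X' w" and ?b = "q' \<cdot> ar Y' w"
    note iX = ident_hom[OF X'.ob_obj[OF l(1)]] and iY = ident_hom[OF Y'.ob_obj[OF l(2)]]
    note gX = X'.germ_el[OF l(1) iX] and gY = Y'.germ_el[OF l(2) iY]
    let ?x = "pull C X \<alpha> (ob X' l) (germ C X' l (ident C (ob X' l)))"
    let ?y = "pull C Y \<beta> (ob Y' l) (germ C Y' l (ident C (ob Y' l)))"
    have a: "?a \<in> hom C (ob X' l) P" and b: "?b \<in> hom C (ob Y' l) R"
      using X'.restrict_hom[OF p' w] Y'.restrict_hom[OF q' w'] .
    have "?b \<cdot> \<eta> l = f \<cdot> ?a"
      using e nat cmp_assoc[OF X'.ar_hom[OF w] p' f] cmp_assoc[OF X'.ar_hom[OF w] \<eta>[OF r(1)] q']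
        cmp_assoc[OF \<eta>[OF l(1)] Y'.ar_hom[OF w'] q'] by simp
    moreover have "act (germs C X) (\<eta> l) ?x = pull C X \<phi> (ob Y' l) ?y"
      using natural_act[OF \<alpha>.pull_natural \<eta>[OF l(1)] gX] X'.act_germ[OF l(1) iX \<eta>[OF l(1)]]
        sq[OF gY] lev(2)[OF l(2) iY] cmp_ident_right[OF \<eta>[OF l(1)]] cmp_ident_left[OF \<eta>[OF l(1)]] by simp
    moreover have "act (germs C X) ?a ?x = x"
      using natural_act[OF \<alpha>.pull_natural a gX] X'.act_germ[OF l(1) iX a] cmp_ident_right[OF a]
        X'.germ_restrict[OF p' w] xp' inv1[OF x] by (simp add: x'_def)
    moreover have "act (germs C Y) ?b ?y = y"
      using natural_act[OF \<beta>.pull_natural b gY] Y'.act_germ[OF l(2) iY b] cmp_ident_right[OF b]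
        Y'.germ_restrict[OF q' w'] yq' inv2[OF y] by (simp add: y'_def)
    ultimately show "\<exists>A B w a b x' y'. w \<in> W \<and> w \<in> hom C A B \<and> a \<in> hom C A P \<and> b \<in> hom C B R \<and>
          b \<cdot> w = f \<cdot> a \<and> x' \<in> el (germs C X) A \<and> y' \<in> el (germs C Y) B \<and>
          act (germs C X) w x' = pull C X \<phi> B y' \<and>
          act (germs C X) a x' = x \<and> act (germs C Y) b y' = y"
      using W[OF l(1)] \<eta>[OF l(1)] a b natural_el[OF \<alpha>.pull_natural gX] natural_el[OF \<beta>.pull_natural gY]
      by blast
  qed
qed

section \<open>Approximable maps are isomorphic to level maps in \<open>W\<close>\<close>

lemma isomorphic_arrow_catI:
  assumes "f \<in> arr P" "g \<in> arr P" "a \<in> hom P (src P f) (src P g)" "b \<in> hom P (tgt P f) (tgt P g)"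
    "a' \<in> hom P (src P g) (src P f)" "b' \<in> hom P (tgt P g) (tgt P f)"
    "b \<cdot>\<^bsub>P\<^esub> f = g \<cdot>\<^bsub>P\<^esub> a" "b' \<cdot>\<^bsub>P\<^esub> g = f \<cdot>\<^bsub>P\<^esub> a'"
    "a' \<cdot>\<^bsub>P\<^esub> a = ident P (src P f)" "b' \<cdot>\<^bsub>P\<^esub> b = ident P (tgt P f)"
    "a \<cdot>\<^bsub>P\<^esub> a' = ident P (src P g)" "b \<cdot>\<^bsub>P\<^esub> b' = ident P (tgt P g)"
  shows "isomorphic (arrow_cat P) f g"
  unfolding isomorphic_arrow_cat using assms by blast

lemma isomorphic_pro_mapI:
  assumes "category C" and pm: "pro_map C X Y \<phi>" "pro_map C X' Y' \<phi>'" "pro_map C X X' \<alpha>" "pro_map C Y Y' \<beta>"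
    "pro_map C X' X \<alpha>'" "pro_map C Y' Y \<beta>'"
    and sq: "\<And>D z. z \<in> el (germs C Y') D \<Longrightarrow>
      pull C X \<phi> D (pull C Y \<beta> D z) = pull C X \<alpha> D (pull C X' \<phi>' D z)"
    and \<alpha>: "\<And>D x. x \<in> el (germs C X) D \<Longrightarrow> pull C X \<alpha> D (pull C X' \<alpha>' D x) = x"
      "\<And>D z. z \<in> el (germs C X') D \<Longrightarrow> pull C X' \<alpha>' D (pull C X \<alpha> D z) = z"
    and \<beta>: "\<And>D x. x \<in> el (germs C Y) D \<Longrightarrow> pull C Y \<beta> D (pull C Y' \<beta>' D x) = x"
      "\<And>D z. z \<in> el (germs C Y') D \<Longrightarrow> pull C Y' \<beta>' D (pull C Y \<beta> D z) = z"
  shows "isomorphic (arrow_cat (pro_cat C)) (X, \<phi>, Y) (X', \<phi>', Y')"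
proof -
  interpret category C by fact
  interpret X: pro_object C X using pm(1) by (simp add: pro_map_def)
  interpret Y: pro_object C Y using pm(1) by (simp add: pro_map_def)
  interpret X': pro_object C X' using pm(2) by (simp add: pro_map_def)
  interpret Y': pro_object C Y' using pm(2) by (simp add: pro_map_def)
  note pc = pro_map_cmp
  have sq': "pull C X' \<phi>' D (pull C Y' \<beta>' D y) = pull C X' \<alpha>' D (pull C X \<phi> D y)"
    if y: "y \<in> el (germs C Y) D" for D y
  proof -
    have y': "pull C Y' \<beta>' D y \<in> el (germs C Y') D"
      using natural_el[OF pro_map.pull_natural[OF pm(6)] y] .
    show ?thesis
      using sq[OF y'] \<beta>(1)[OF y] \<alpha>(2)[OF natural_el[OF pro_map.pull_natural[OF pm(2)] y']] by simp
  qed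
  have "pro_cmp C X \<phi> \<beta> Y' = pro_cmp C X \<alpha> \<phi>' Y'"
    by (rule pro_map_eqI[OF pc(1)[OF pm(1,4)] pc(1)[OF pm(3,2)]])
      (simp add: pc(2)[OF pm(1,4)] pc(2)[OF pm(3,2)] sq)
  moreover have "pro_cmp C X' \<phi>' \<beta>' Y = pro_cmp C X' \<alpha>' \<phi> Y"
    by (rule pro_map_eqI[OF pc(1)[OF pm(2,6)] pc(1)[OF pm(5,1)]])
      (simp add: pc(2)[OF pm(2,6)] pc(2)[OF pm(5,1)] sq')
  moreover have "pro_cmp C X \<alpha> \<alpha>' X = pro_ident C X"
    by (rule pro_map_eqI[OF pc(1)[OF pm(3,5)] X.pro_map_ident(1)])
      (simp add: pc(2)[OF pm(3,5)] X.pro_map_ident(2) \<alpha>)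
  moreover have "pro_cmp C X' \<alpha>' \<alpha> X' = pro_ident C X'"
    by (rule pro_map_eqI[OF pc(1)[OF pm(5,3)] X'.pro_map_ident(1)])
      (simp add: pc(2)[OF pm(5,3)] X'.pro_map_ident(2) \<alpha>)
  moreover have "pro_cmp C Y \<beta> \<beta>' Y = pro_ident C Y"
    by (rule pro_map_eqI[OF pc(1)[OF pm(4,6)] Y.pro_map_ident(1)])
      (simp add: pc(2)[OF pm(4,6)] Y.pro_map_ident(2) \<beta>)
  moreover have "pro_cmp C Y' \<beta>' \<beta> Y' = pro_ident C Y'"
    by (rule pro_map_eqI[OF pc(1)[OF pm(6,4)] Y'.pro_map_ident(1)])
      (simp add: pc(2)[OF pm(6,4)] Y'.pro_map_ident(2) \<beta>)
  ultimately show ?thesis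
    using pm by (intro isomorphic_arrow_catI[of _ _ _ "(X, \<alpha>, X')" "(Y, \<beta>, Y')" "(X', \<alpha>', X)" "(Y', \<beta>', Y)"])
      (simp_all add: pro_map_arr pro_map_hom cmp_pro_cat X.ident_pro_cat Y.ident_pro_cat
        X'.ident_pro_cat Y'.ident_pro_cat)
qed

text \<open>The diagram \<open>Z\<close> is interleaved with \<open>X\<close>: there are maps \<open>\<xi> c\<close> from \<open>X\<close> to \<open>Z\<close> and maps back, and going
  back and forth gives transition maps.  By \<open>lift\<close>, arbitrarily deep restrictions in \<open>X\<close> are felt in \<open>Z\<close>,
  which makes the action of \<open>\<xi>\<close> on germs injective; by \<open>reach\<close> this action hits the identity germs of \<open>X\<close>.\<close>

lemma interleaved_isomorphic:
  fixes C :: "('o, 'a) cat" (structure)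
  assumes "pro_object C X" "pro_object C Z"
    and \<theta>: "\<And>c. c \<in> obj (shape Z) \<Longrightarrow> \<theta> c \<in> obj (shape X)"
    and \<xi>: "\<And>c. c \<in> obj (shape Z) \<Longrightarrow> \<xi> c \<in> hom C (ob X (\<theta> c)) (ob Z c)"
    and compat: "\<And>c c' j. j \<in> hom (shape Z) c' c \<Longrightarrow>
      germ C X (\<theta> c') (ar Z j \<cdot> \<xi> c') = germ C X (\<theta> c) (\<xi> c)"
    and lift: "\<And>c r u. c \<in> obj (shape Z) \<Longrightarrow> u \<in> hom (shape X) r (\<theta> c) \<Longrightarrow>
      \<exists>c'. \<exists>j \<in> hom (shape Z) c' c. \<exists>m \<in> hom C (ob Z c') (ob X r). ar Z j = \<xi> c \<cdot> (ar X u \<cdot> m)"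
    and reach: "\<And>t. t \<in> obj (shape X) \<Longrightarrow>
      \<exists>c \<in> obj (shape Z). \<exists>m \<in> hom C (ob Z c) (ob X t).
        germ C X (\<theta> c) (m \<cdot> \<xi> c) = germ C X t (ident C (ob X t))"
  obtains \<alpha> \<alpha>' where "pro_map C X Z \<alpha>" "pro_map C Z X \<alpha>'"
    "\<And>c. c \<in> obj (shape Z) \<Longrightarrow> \<alpha> c = germ C X (\<theta> c) (\<xi> c)"
    "\<And>B x. x \<in> el (germs C X) B \<Longrightarrow> pull C X \<alpha> B (pull C Z \<alpha>' B x) = x"
    "\<And>B z. z \<in> el (germs C Z) B \<Longrightarrow> pull C Z \<alpha>' B (pull C X \<alpha> B z) = z"
proof -
  interpret X: pro_object C X by fact
  interpret Z: pro_object C Z by fact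
  define \<alpha> where "\<alpha> = (\<lambda>c \<in> obj (shape Z). germ C X (\<theta> c) (\<xi> c))"
  have \<alpha>c: "\<alpha> c = germ C X (\<theta> c) (\<xi> c)" if "c \<in> obj (shape Z)" for c using that by (simp add: \<alpha>_def)
  have "\<alpha> \<in> pro_hom C X Z"
  proof (rule pro_homI[OF X.pro_object_axioms Z.pro_object_axioms])
    show "\<alpha> \<in> extensional (obj (shape Z))" by (simp add: \<alpha>_def)
    show "\<alpha> c \<in> el (germs C X) (ob Z c)" if "c \<in> obj (shape Z)" for c
      using X.germ_el[OF \<theta>[OF that] \<xi>[OF that]] \<alpha>c[OF that] by simp
    show "act (germs C X) (ar Z j) (\<alpha> c') = \<alpha> c" if j: "j \<in> hom (shape Z) c' c" for c' c j
    proof -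
      have c: "c' \<in> obj (shape Z)" "c \<in> obj (shape Z)" using Z.I.hom_obj[OF j] by auto
      show ?thesis
        using X.act_germ[OF \<theta>[OF c(1)] \<xi>[OF c(1)] Z.ar_hom[OF j]] compat[OF j] \<alpha>c c by simp
    qed
  qed
  then have pm: "pro_map C X Z \<alpha>"
    by (simp add: pro_map_def pro_map_axioms_def X.pro_object_axioms Z.pro_object_axioms)
  interpret \<alpha>: pro_map C X Z \<alpha> by (rule pm)
  have pull: "pull C X \<alpha> B (germ C Z c g) = germ C X (\<theta> c) (g \<cdot> \<xi> c)"
    if "c \<in> obj (shape Z)" "g \<in> hom C (ob Z c) B" for c g B
    using \<alpha>.pull_germ[OF that] X.act_germ[OF \<theta> \<xi> that(2)] \<alpha>c that by simp
  show ?thesis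
  proof (rule pro_map_inverse[OF pm])
    fix B z z' assume z: "z \<in> el (germs C Z) B" and z': "z' \<in> el (germs C Z) B"
      and eq: "pull C X \<alpha> B z = pull C X \<alpha> B z'"
    obtain i h where i: "i \<in> obj (shape Z)" and h: "h \<in> hom C (ob Z i) B" and zh: "z = germ C Z i h"
      using Z.germ_cases[OF z] .
    obtain i' h' where i': "i' \<in> obj (shape Z)" and h': "h' \<in> hom C (ob Z i') B"
      and zh': "z' = germ C Z i' h'"
      using Z.germ_cases[OF z'] .
    obtain c v v' where v: "v \<in> hom (shape Z) c i" and v': "v' \<in> hom (shape Z) c i'"
      using Z.common_refinement[OF i i'] .
    have c: "c \<in> obj (shape Z)" using Z.I.hom_obj[OF v] by auto
    define g where "g = h \<cdot> ar Z v"
    define g' where "g' = h' \<cdot> ar Z v'"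
    have g: "g \<in> hom C (ob Z c) B" and g': "g' \<in> hom C (ob Z c) B"
      using Z.restrict_hom[OF h v] Z.restrict_hom[OF h' v'] by (auto simp: g_def g'_def)
    have zg: "z = germ C Z c g" and zg': "z' = germ C Z c g'"
      using Z.germ_restrict[OF h v] Z.germ_restrict[OF h' v'] zh zh' by (auto simp: g_def g'_def)
    have "germ C X (\<theta> c) (g \<cdot> \<xi> c) = germ C X (\<theta> c) (g' \<cdot> \<xi> c)"
      using eq pull[OF c g] pull[OF c g'] zg zg' by simp
    then obtain r u where u: "u \<in> hom (shape X) r (\<theta> c)"
      and eq': "(g \<cdot> \<xi> c) \<cdot> ar X u = (g' \<cdot> \<xi> c) \<cdot> ar X u"
      using X.germ_eq_restrict[OF X.cmp_hom[OF \<xi>[OF c] g] X.cmp_hom[OF \<xi>[OF c] g'] \<theta>[OF c]] by metis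
    obtain c' j m where j: "j \<in> hom (shape Z) c' c" and m: "m \<in> hom C (ob Z c') (ob X r)"
      and jm: "ar Z j = \<xi> c \<cdot> (ar X u \<cdot> m)"
      using lift[OF c u] by blast
    have um: "ar X u \<cdot> m \<in> hom C (ob Z c') (ob X (\<theta> c))" using X.cmp_hom[OF m X.ar_hom[OF u]] .
    have "k \<cdot> ar Z j = ((k \<cdot> \<xi> c) \<cdot> ar X u) \<cdot> m" if k: "k \<in> hom C (ob Z c) B" for k
      using jm X.cmp_assoc[OF um \<xi>[OF c] k] X.cmp_assoc[OF m X.ar_hom[OF u] X.cmp_hom[OF \<xi>[OF c] k]] by simp
    then have "g \<cdot> ar Z j = g' \<cdot> ar Z j" using g g' eq' by simp
    then show "z = z'" using Z.germ_restrict[OF g j] Z.germ_restrict[OF g' j] zg zg' by simp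
  next
    fix t assume "t \<in> obj (shape X)"
    then obtain c m where "c \<in> obj (shape Z)" "m \<in> hom C (ob Z c) (ob X t)"
      "germ C X (\<theta> c) (m \<cdot> \<xi> c) = germ C X t (ident C (ob X t))" using reach by blast
    then show "\<exists>z \<in> el (germs C Z) (ob X t). pull C X \<alpha> (ob X t) z = germ C X t (ident C (ob X t))"
      using pull Z.germ_el by metis
  qed (use that[OF pm _ \<alpha>c] in blast)
qed

text \<open>Replacing the arrows of an index category by codes.  This turns an index category whose arrows are
  tuples into a small one.\<close>

definition recode :: "('b \<Rightarrow> 'd) \<Rightarrow> ('i, 'b) cat \<Rightarrow> ('i, 'd) cat" where
  "recode e J = \<lparr> obj = obj J, arr = e ` arr J,
     src = (\<lambda>v. src J (inv_into (arr J) e v)), tgt = (\<lambda>v. tgt J (inv_into (arr J) e v)),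
     ident = (\<lambda>c. e (ident J c)),
     cmp = (\<lambda>v u. e (inv_into (arr J) e v \<cdot>\<^bsub>J\<^esub> inv_into (arr J) e u)) \<rparr>"

definition recode_diag :: "('b \<Rightarrow> 'd) \<Rightarrow> ('i, 'b, 'o, 'a) diag \<Rightarrow> ('i, 'd, 'o, 'a) diag" where
  "recode_diag e Z = \<lparr> shape = recode e (shape Z), ob = ob Z,
     ar = (\<lambda>v. ar Z (inv_into (arr (shape Z)) e v)) \<rparr>"

context
  fixes e :: "'b \<Rightarrow> 'd" and J :: "('i, 'b) cat"
  assumes cat: "category J" and inj: "inj_on e (arr J)"
begin

lemma hom_recode: "hom (recode e J) s t = e ` hom J s t"
  using inj by (auto simp: hom_def recode_def)

lemma cmp_recode:
  assumes "u \<in> hom J r s" "v \<in> hom J s t"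
  shows "e v \<cdot>\<^bsub>recode e J\<^esub> e u = e (v \<cdot>\<^bsub>J\<^esub> u)"
  using inj assms by (simp add: hom_def recode_def)

lemma category_recode: "category (recode e J)"
proof -
  interpret J: category J by (rule cat)
  show ?thesis
  proof
    fix f assume "f \<in> arr (recode e J)"
    then show "src (recode e J) f \<in> obj (recode e J)" "tgt (recode e J) f \<in> obj (recode e J)"
      using inj J.src_obj J.tgt_obj by (auto simp: recode_def)
  next
    fix A assume "A \<in> obj (recode e J)"
    then show "ident (recode e J) A \<in> hom (recode e J) A A"
      using J.ident_hom by (auto simp: hom_recode) (auto simp: recode_def)
  next
    fix f g A B D assume "f \<in> hom (recode e J) A B" "g \<in> hom (recode e J) B D"
    then show "g \<cdot>\<^bsub>recode e J\<^esub> f \<in> hom (recode e J) A D"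
      using J.cmp_hom by (auto simp: hom_recode cmp_recode)
  next
    fix f A B assume "f \<in> hom (recode e J) A B"
    then obtain f' where f': "f' \<in> hom J A B" "f = e f'" by (auto simp: hom_recode)
    have i: "ident (recode e J) A = e (ident J A)" "ident (recode e J) B = e (ident J B)"
      by (auto simp: recode_def)
    show "f \<cdot>\<^bsub>recode e J\<^esub> ident (recode e J) A = f" "ident (recode e J) B \<cdot>\<^bsub>recode e J\<^esub> f = f"
      using f' i cmp_recode[OF J.ident_hom f'(1)] cmp_recode[OF f'(1) J.ident_hom] J.hom_obj[OF f'(1)]
        J.cmp_ident_left[OF f'(1)] J.cmp_ident_right[OF f'(1)] by auto
  next
    fix f g h A B D E
    assume "f \<in> hom (recode e J) A B" "g \<in> hom (recode e J) B D" "h \<in> hom (recode e J) D E"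
    then obtain f' g' h' where *: "f' \<in> hom J A B" "f = e f'" "g' \<in> hom J B D" "g = e g'"
      "h' \<in> hom J D E" "h = e h'" by (auto simp: hom_recode)
    show "h \<cdot>\<^bsub>recode e J\<^esub> (g \<cdot>\<^bsub>recode e J\<^esub> f) = (h \<cdot>\<^bsub>recode e J\<^esub> g) \<cdot>\<^bsub>recode e J\<^esub> f"
      using * cmp_recode[OF *(1,3)] cmp_recode[OF *(3,5)] cmp_recode[OF J.cmp_hom[OF *(1,3)] *(5)]
        cmp_recode[OF *(1) J.cmp_hom[OF *(3,5)]] J.cmp_assoc[OF *(1,3,5)] by simp
  qed
qed

lemma cofiltered_recode:
  assumes cof: "cofiltered J"
  shows "cofiltered (recode e J)"
  unfolding cofiltered_def
proof (intro conjI ballI allI)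
  have ob: "obj (recode e J) = obj J" by (simp add: recode_def)
  show "category (recode e J)" by (rule category_recode)
  show "obj (recode e J) \<noteq> {}" using cof ob by (simp add: cofiltered_def)
  show "\<exists>r \<in> obj (recode e J). hom (recode e J) r s \<noteq> {} \<and> hom (recode e J) r t \<noteq> {}"
    if "s \<in> obj (recode e J)" "t \<in> obj (recode e J)" for s t
    using cof that unfolding cofiltered_def ob hom_recode by blast
  show "\<exists>r. \<exists>w \<in> hom (recode e J) r s. u \<cdot>\<^bsub>recode e J\<^esub> w = v \<cdot>\<^bsub>recode e J\<^esub> w"
    if uv: "u \<in> hom (recode e J) s t" "v \<in> hom (recode e J) s t" for s t u v
  proof -
    obtain u' v' where *: "u' \<in> hom J s t" "u = e u'" "v' \<in> hom J s t" "v = e v'"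
      using uv by (auto simp: hom_recode)
    then obtain r w where w: "w \<in> hom J r s" "u' \<cdot>\<^bsub>J\<^esub> w = v' \<cdot>\<^bsub>J\<^esub> w"
      using cof unfolding cofiltered_def by metis
    then have "u \<cdot>\<^bsub>recode e J\<^esub> e w = v \<cdot>\<^bsub>recode e J\<^esub> e w"
      using * cmp_recode[OF w(1) *(1)] cmp_recode[OF w(1) *(3)] by simp
    then show ?thesis using w(1) by (auto simp: hom_recode)
  qed
qed

lemma ar_recode: "shape Z = J \<Longrightarrow> u \<in> hom J s t \<Longrightarrow> ar (recode_diag e Z) (e u) = ar Z u"
  using inj by (simp add: recode_diag_def hom_def)

lemma is_diagram_recode:
  assumes "is_diagram C Z" "shape Z = J"
  shows "is_diagram C (recode_diag e Z)"
proof -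
  interpret J: category J by (rule cat)
  have sh: "shape (recode_diag e Z) = recode e J" "ob (recode_diag e Z) = ob Z"
    using assms(2) by (auto simp: recode_diag_def)
  have i: "ident (recode e J) s = e (ident J s)" for s by (simp add: recode_def)
  have obJ: "obj (recode e J) = obj J" by (simp add: recode_def)
  show ?thesis
    unfolding is_diagram_def sh
  proof (intro conjI ballI allI category_recode)
    fix s assume "s \<in> obj (recode e J)"
    then have s: "s \<in> obj J" using obJ by simp
    show "ob Z s \<in> obj C" using assms s unfolding is_diagram_def by blast
    show "ar (recode_diag e Z) (ident (recode e J) s) = ident C (ob Z s)"
      using assms s ar_recode[OF assms(2) J.ident_hom[OF s]] i unfolding is_diagram_def by simp
  next
    fix s t u assume "u \<in> hom (recode e J) s t"
    then obtain u' where u': "u' \<in> hom J s t" "u = e u'" by (auto simp: hom_recode)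
    show "ar (recode_diag e Z) u \<in> hom C (ob Z s) (ob Z t)"
      using ar_recode[OF assms(2) u'(1)] u' assms unfolding is_diagram_def by simp
  next
    fix r s t u v assume "u \<in> hom (recode e J) r s" "v \<in> hom (recode e J) s t"
    then obtain u' v' where *: "u' \<in> hom J r s" "u = e u'" "v' \<in> hom J s t" "v = e v'"
      by (auto simp: hom_recode)
    have "ar Z (v' \<cdot>\<^bsub>J\<^esub> u') = ar Z v' \<cdot>\<^bsub>C\<^esub> ar Z u'"
      using assms * unfolding is_diagram_def by blast
    then show "ar (recode_diag e Z) (v \<cdot>\<^bsub>recode e J\<^esub> u) = ar (recode_diag e Z) v \<cdot>\<^bsub>C\<^esub> ar (recode_diag e Z) u"
      using ar_recode[OF assms(2) *(1)] ar_recode[OF assms(2) *(3)] * cmp_recode[OF *(1,3)]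
        ar_recode[OF assms(2) J.cmp_hom[OF *(1,3)]] by simp
  qed
qed

end

text \<open>For each index \<open>c\<close>, the map \<open>F c : X(T c) \<rightarrow> Y(S c)\<close> represents \<open>\<phi>\<close>, the square \<open>\<phi> \<rightarrow> F c\<close> factors as
  \<open>\<phi> \<rightarrow> w c \<rightarrow> F c\<close> with \<open>w c\<close> in \<open>W\<close>, and the first half is represented by a square from a deeper map
  \<open>F' c : X(T' c) \<rightarrow> Y(S' c)\<close> to \<open>w c\<close>, chosen so deep that the composite of the two halves consists of
  transition maps.
  \begin{verbatim}
    X(T' c) --xi--> A c --a--> X(T c)
       |             |            |
      F' c          w c          F c
       v             v            v
    Y(S' c) --up--> B c --b--> Y(S c)
  \end{verbatim}
  By the assumption \<open>dense\<close>, the chosen representatives include all restrictions of one fixed representative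
  of each component of \<open>\<phi>\<close>.\<close>

locale level_approximation = pro_map C X Y \<phi> for C :: "('o, 'a) cat" (structure)
    and X Y :: "('u, 'o, 'a) sdiag" and \<phi> +
  fixes W :: "'a set" and T S T' S' :: "'u \<Rightarrow> 'u" and F F' :: "'u \<Rightarrow> 'a"
    and A B :: "'u \<Rightarrow> 'o" and w a b \<xi> \<upsilon> :: "'u \<Rightarrow> 'a" and \<tau> \<sigma> :: "'u \<Rightarrow> 'u"
  assumes F: "T c \<in> obj (shape X)" "S c \<in> obj (shape Y)" "F c \<in> hom C (ob X (T c)) (ob Y (S c))"
    and dense: "k \<in> obj (shape Y) \<Longrightarrow>
      \<exists>t0 \<in> obj (shape X). \<exists>f0 \<in> hom C (ob X t0) (ob Y k). germ C X t0 f0 = \<phi> k \<and>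
        (\<forall>t. \<forall>u \<in> hom (shape X) t t0. \<exists>c. T c = t \<and> S c = k \<and> F c = f0 \<cdot> ar X u)"
    and w: "w c \<in> W" "w c \<in> hom C (A c) (B c)"
    and a: "a c \<in> hom C (A c) (ob X (T c))"
    and b: "b c \<in> hom C (B c) (ob Y (S c))"
    and front: "b c \<cdot> w c = F c \<cdot> a c"
    and F': "T' c \<in> obj (shape X)" "S' c \<in> obj (shape Y)" "F' c \<in> hom C (ob X (T' c)) (ob Y (S' c))"
      "germ C X (T' c) (F' c) = \<phi> (S' c)"
    and \<xi>: "\<xi> c \<in> hom C (ob X (T' c)) (A c)"
    and \<upsilon>: "\<upsilon> c \<in> hom C (ob Y (S' c)) (B c)"
    and rear: "w c \<cdot> \<xi> c = \<upsilon> c \<cdot> F' c"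
    and \<tau>: "\<tau> c \<in> hom (shape X) (T' c) (T c)" "a c \<cdot> \<xi> c = ar X (\<tau> c)"
    and \<sigma>: "\<sigma> c \<in> hom (shape Y) (S' c) (S c)" "b c \<cdot> \<upsilon> c = ar Y (\<sigma> c)"
begin

text \<open>An arrow from \<open>c'\<close> to \<open>c\<close> is a map from \<open>w c'\<close> to \<open>w c\<close> that passes through \<open>F c'\<close>, transition maps,
  and \<open>F' c\<close>.  Such maps compose because going from \<open>F' c\<close> through \<open>w c\<close> to \<open>F c\<close> is itself a pair of
  transition maps.  Only identities have to be added.  Although arrows are recorded as pairs of maps of \<open>C\<close>,
  there are few of them, since they are determined by arrows of the index categories of \<open>X\<close> and \<open>Y\<close>.\<close>

definition index :: "('u, 'u \<times> 'u \<times> 'a \<times> 'a) cat" where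
  "index = \<lparr> obj = UNIV,
     arr = {(c', c, p, q). p \<in> hom C (A c') (A c) \<and> q \<in> hom C (B c') (B c) \<and> q \<cdot> w c' = w c \<cdot> p \<and>
       (c' = c \<and> p = ident C (A c) \<and> q = ident C (B c) \<or>
        (\<exists>u \<in> hom (shape X) (T c') (T' c). \<exists>v \<in> hom (shape Y) (S c') (S' c).
           p = \<xi> c \<cdot> (ar X u \<cdot> a c') \<and> q = \<upsilon> c \<cdot> (ar Y v \<cdot> b c')))},
     src = (\<lambda>(c', c, p, q). c'), tgt = (\<lambda>(c', c, p, q). c),
     ident = (\<lambda>c. (c, c, ident C (A c), ident C (B c))),
     cmp = (\<lambda>(c1, c2, p', q') (c0, c1', p, q). (c0, c2, p' \<cdot> p, q' \<cdot> q)) \<rparr>"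

lemma hom_index: "(d, e, p, q) \<in> hom index c' c \<longleftrightarrow> d = c' \<and> e = c \<and>
    p \<in> hom C (A c') (A c) \<and> q \<in> hom C (B c') (B c) \<and> q \<cdot> w c' = w c \<cdot> p \<and>
    (c' = c \<and> p = ident C (A c) \<and> q = ident C (B c) \<or>
     (\<exists>u \<in> hom (shape X) (T c') (T' c). \<exists>v \<in> hom (shape Y) (S c') (S' c).
        p = \<xi> c \<cdot> (ar X u \<cdot> a c') \<and> q = \<upsilon> c \<cdot> (ar Y v \<cdot> b c')))"
  unfolding hom_def[of index] by (auto simp: index_def)

lemma hom_index_cases:
  assumes "x \<in> hom index c' c"
  obtains p q where "x = (c', c, p, q)" "(c', c, p, q) \<in> hom index c' c"
    "p \<in> hom C (A c') (A c)" "q \<in> hom C (B c') (B c)" "q \<cdot> w c' = w c \<cdot> p"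
proof (cases x)
  case (fields d e p q)
  then have "d = c'" "e = c" "p \<in> hom C (A c') (A c)" "q \<in> hom C (B c') (B c)" "q \<cdot> w c' = w c \<cdot> p"
    using assms hom_index by auto
  then show ?thesis using that fields assms by blast
qed

lemma cmp_index: "(c1, c2, p', q') \<cdot>\<^bsub>index\<^esub> (c0, c1', p, q) = (c0, c2, p' \<cdot> p, q' \<cdot> q)"
  by (simp add: index_def)

lemma A_obj: "A c \<in> obj C" and B_obj: "B c \<in> obj C"
  using X.hom_obj[OF w(2)] by auto

lemma through_hom:
  assumes "u \<in> hom (shape X) (T c') (T' c)" "v \<in> hom (shape Y) (S c') (S' c)"
  shows "ar X u \<cdot> a c' \<in> hom C (A c') (ob X (T' c))" "\<xi> c \<cdot> (ar X u \<cdot> a c') \<in> hom C (A c') (A c)"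
    "ar Y v \<cdot> b c' \<in> hom C (B c') (ob Y (S' c))" "\<upsilon> c \<cdot> (ar Y v \<cdot> b c') \<in> hom C (B c') (B c)"
  using X.cmp_hom[OF a X.ar_hom[OF assms(1)]] X.cmp_hom[OF X.cmp_hom[OF a X.ar_hom[OF assms(1)]] \<xi>]
    X.cmp_hom[OF b Y.ar_hom[OF assms(2)]] X.cmp_hom[OF X.cmp_hom[OF b Y.ar_hom[OF assms(2)]] \<upsilon>] .

lemma link:
  assumes u: "u \<in> hom (shape X) (T c') (T' c)" and v: "v \<in> hom (shape Y) (S c') (S' c)"
    and sq: "F' c \<cdot> ar X u = ar Y v \<cdot> F c'"
  shows "(c', c, \<xi> c \<cdot> (ar X u \<cdot> a c'), \<upsilon> c \<cdot> (ar Y v \<cdot> b c')) \<in> hom index c' c"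
proof -
  note h = through_hom[OF u v]
  have "(\<upsilon> c \<cdot> (ar Y v \<cdot> b c')) \<cdot> w c' = \<upsilon> c \<cdot> (ar Y v \<cdot> (b c' \<cdot> w c'))"
    using X.cmp_assoc[OF w(2) h(3) \<upsilon>] X.cmp_assoc[OF w(2) b Y.ar_hom[OF v]] by simp
  also have "\<dots> = \<upsilon> c \<cdot> ((F' c \<cdot> ar X u) \<cdot> a c')"
    using X.cmp_assoc[OF a F(3) Y.ar_hom[OF v]] front sq by simp
  also have "\<dots> = w c \<cdot> (\<xi> c \<cdot> (ar X u \<cdot> a c'))"
    using X.cmp_assoc[OF a X.ar_hom[OF u] F'(3)] X.cmp_assoc[OF h(1) F'(3) \<upsilon>]
      X.cmp_assoc[OF h(1) \<xi> w(2)] rear by simp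
  finally show ?thesis unfolding hom_index using h u v by blast
qed

lemma index_cmp_hom:
  assumes x: "x \<in> hom index c0 c1" and y: "y \<in> hom index c1 c2"
  shows "y \<cdot>\<^bsub>index\<^esub> x \<in> hom index c0 c2"
proof -
  obtain p q where x': "x = (c0, c1, p, q)" "(c0, c1, p, q) \<in> hom index c0 c1"
    and p: "p \<in> hom C (A c0) (A c1)" "q \<in> hom C (B c0) (B c1)" "q \<cdot> w c0 = w c1 \<cdot> p"
    using hom_index_cases[OF x] by metis
  obtain p' q' where y': "y = (c1, c2, p', q')" "(c1, c2, p', q') \<in> hom index c1 c2"
    and p': "p' \<in> hom C (A c1) (A c2)" "q' \<in> hom C (B c1) (B c2)" "q' \<cdot> w c1 = w c2 \<cdot> p'"
    using hom_index_cases[OF y] by metis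
  have sq: "(q' \<cdot> q) \<cdot> w c0 = w c2 \<cdot> (p' \<cdot> p)"
    using X.cmp_assoc[OF w(2) p(2) p'(2)] p(3) X.cmp_assoc[OF p(1) w(2) p'(2)] p'(3)
      X.cmp_assoc[OF p(1) p'(1) w(2)] by simp
  have "(c0, c2, p' \<cdot> p, q' \<cdot> q) \<in> hom index c0 c2"
  proof (cases "c0 = c1 \<and> p = ident C (A c1) \<and> q = ident C (B c1)")
    case True
    then show ?thesis using y'(2) X.cmp_ident_right[OF p'(1)] X.cmp_ident_right[OF p'(2)] by simp
  next
    case False
    then obtain u v where u: "u \<in> hom (shape X) (T c0) (T' c1)" and v: "v \<in> hom (shape Y) (S c0) (S' c1)"
      and pq: "p = \<xi> c1 \<cdot> (ar X u \<cdot> a c0)" "q = \<upsilon> c1 \<cdot> (ar Y v \<cdot> b c0)"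
      using x'(2) unfolding hom_index by blast
    show ?thesis
    proof (cases "c1 = c2 \<and> p' = ident C (A c2) \<and> q' = ident C (B c2)")
      case True
      then show ?thesis using x'(2) X.cmp_ident_left[OF p(1)] X.cmp_ident_left[OF p(2)] by simp
    next
      case False
      then obtain u' v' where u': "u' \<in> hom (shape X) (T c1) (T' c2)"
        and v': "v' \<in> hom (shape Y) (S c1) (S' c2)"
        and pq': "p' = \<xi> c2 \<cdot> (ar X u' \<cdot> a c1)" "q' = \<upsilon> c2 \<cdot> (ar Y v' \<cdot> b c1)"
        using y'(2) unfolding hom_index by blast
      note h = through_hom[OF u v] and h' = through_hom[OF u' v']
      note \<tau>u = X.I.cmp_hom[OF u \<tau>(1)] and \<sigma>v = Y.I.cmp_hom[OF v \<sigma>(1)]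
      have "a c1 \<cdot> p = ar X (\<tau> c1 \<cdot>\<^bsub>shape X\<^esub> u) \<cdot> a c0"
        using pq(1) X.cmp_assoc[OF h(1) \<xi> a] \<tau>(2) X.cmp_assoc[OF a X.ar_hom[OF u] X.ar_hom[OF \<tau>(1)]]
          X.ar_cmp[OF u \<tau>(1)] by simp
      then have "p' \<cdot> p = \<xi> c2 \<cdot> (ar X (u' \<cdot>\<^bsub>shape X\<^esub> (\<tau> c1 \<cdot>\<^bsub>shape X\<^esub> u)) \<cdot> a c0)"
        using pq'(1) X.cmp_assoc[OF p(1) h'(1) \<xi>] X.cmp_assoc[OF p(1) a X.ar_hom[OF u']]
          X.cmp_assoc[OF a X.ar_hom[OF \<tau>u] X.ar_hom[OF u']] X.ar_cmp[OF \<tau>u u'] by simp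
      moreover have "b c1 \<cdot> q = ar Y (\<sigma> c1 \<cdot>\<^bsub>shape Y\<^esub> v) \<cdot> b c0"
        using pq(2) X.cmp_assoc[OF h(3) \<upsilon> b] \<sigma>(2) X.cmp_assoc[OF b Y.ar_hom[OF v] Y.ar_hom[OF \<sigma>(1)]]
          Y.ar_cmp[OF v \<sigma>(1)] by simp
      then have "q' \<cdot> q = \<upsilon> c2 \<cdot> (ar Y (v' \<cdot>\<^bsub>shape Y\<^esub> (\<sigma> c1 \<cdot>\<^bsub>shape Y\<^esub> v)) \<cdot> b c0)"
        using pq'(2) X.cmp_assoc[OF p(2) h'(3) \<upsilon>] X.cmp_assoc[OF p(2) b Y.ar_hom[OF v']]
          X.cmp_assoc[OF b Y.ar_hom[OF \<sigma>v] Y.ar_hom[OF v']] Y.ar_cmp[OF \<sigma>v v'] by simp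
      ultimately show ?thesis
        unfolding hom_index
        using X.cmp_hom[OF p(1) p'(1)] X.cmp_hom[OF p(2) p'(2)] sq X.I.cmp_hom[OF \<tau>u u']
          Y.I.cmp_hom[OF \<sigma>v v'] by blast
    qed
  qed
  then show ?thesis using x'(1) y'(1) by (simp add: cmp_index)
qed

lemma category_index: "category index"
proof
  show "ident index c \<in> hom index c c" for c
    using hom_index[of c c "ident C (A c)" "ident C (B c)" c c] X.ident_hom[OF A_obj] X.ident_hom[OF B_obj]
      X.cmp_ident_left[OF w(2)] X.cmp_ident_right[OF w(2)] by (simp add: index_def)
  show "f \<cdot>\<^bsub>index\<^esub> ident index c' = f" "ident index c \<cdot>\<^bsub>index\<^esub> f = f" if f: "f \<in> hom index c' c" for f c' c
  proof -
    obtain p q where f': "f = (c', c, p, q)" "p \<in> hom C (A c') (A c)" "q \<in> hom C (B c') (B c)"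
      using hom_index_cases[OF f] by metis
    have i: "ident index c = (c, c, ident C (A c), ident C (B c))" for c by (simp add: index_def)
    show "f \<cdot>\<^bsub>index\<^esub> ident index c' = f" "ident index c \<cdot>\<^bsub>index\<^esub> f = f"
      using f' X.cmp_ident_left[OF f'(2)] X.cmp_ident_left[OF f'(3)] X.cmp_ident_right[OF f'(2)]
        X.cmp_ident_right[OF f'(3)] by (simp_all add: i cmp_index)
  qed
  show "h \<cdot>\<^bsub>index\<^esub> (g \<cdot>\<^bsub>index\<^esub> f) = (h \<cdot>\<^bsub>index\<^esub> g) \<cdot>\<^bsub>index\<^esub> f"
    if f: "f \<in> hom index c0 c1" and g: "g \<in> hom index c1 c2" and h: "h \<in> hom index c2 c3"
    for f g h c0 c1 c2 c3
  proof -
    obtain p q where f': "f = (c0, c1, p, q)" "p \<in> hom C (A c0) (A c1)" "q \<in> hom C (B c0) (B c1)"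
      using hom_index_cases[OF f] by metis
    obtain p' q' where g': "g = (c1, c2, p', q')" "p' \<in> hom C (A c1) (A c2)" "q' \<in> hom C (B c1) (B c2)"
      using hom_index_cases[OF g] by metis
    obtain p'' q'' where h': "h = (c2, c3, p'', q'')" "p'' \<in> hom C (A c2) (A c3)" "q'' \<in> hom C (B c2) (B c3)"
      using hom_index_cases[OF h] by metis
    show ?thesis
      using f' g' h' X.cmp_assoc[OF f'(2) g'(2) h'(2)] X.cmp_assoc[OF f'(3) g'(3) h'(3)]
      by (simp add: cmp_index)
  qed
  show "g \<cdot>\<^bsub>index\<^esub> f \<in> hom index c0 c2" if "f \<in> hom index c0 c1" "g \<in> hom index c1 c2" for f g c0 c1 c2
    using index_cmp_hom that .
qed (auto simp: index_def)

text \<open>Below any two representatives of components of \<open>\<phi>\<close> there is one in the family \<open>F\<close>, with a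
  prescribed index \<open>k\<close> in \<open>Y\<close>.  The representative at \<open>k\<close> given by \<open>dense\<close> agrees with both as germs, hence on a common
  refinement.\<close>

lemma deeper_index:
  assumes t1: "t1 \<in> obj (shape X)" "f1 \<in> hom C (ob X t1) (ob Y s1)" "germ C X t1 f1 = \<phi> s1"
    and t2: "t2 \<in> obj (shape X)" "f2 \<in> hom C (ob X t2) (ob Y s2)" "germ C X t2 f2 = \<phi> s2"
    and r: "u1 \<in> hom (shape X) r t1" "u2 \<in> hom (shape X) r t2"
    and k: "v1 \<in> hom (shape Y) k s1" "v2 \<in> hom (shape Y) k s2"
  obtains c u where "S c = k" "u \<in> hom (shape X) (T c) r"
    "f1 \<cdot> ar X (u1 \<cdot>\<^bsub>shape X\<^esub> u) = ar Y v1 \<cdot> F c" "f2 \<cdot> ar X (u2 \<cdot>\<^bsub>shape X\<^esub> u) = ar Y v2 \<cdot> F c"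
proof -
  have kY: "k \<in> obj (shape Y)" and rX: "r \<in> obj (shape X)"
    using Y.I.hom_obj[OF k(1)] X.I.hom_obj[OF r(1)] by auto
  obtain t0 f0 where t0: "t0 \<in> obj (shape X)" and f0: "f0 \<in> hom C (ob X t0) (ob Y k)"
    and f0\<phi>: "germ C X t0 f0 = \<phi> k"
    and d: "\<And>t u. u \<in> hom (shape X) t t0 \<Longrightarrow> \<exists>c. T c = t \<and> S c = k \<and> F c = f0 \<cdot> ar X u"
    using dense[OF kY] by metis
  have g: "germ C X t0 (ar Y v \<cdot> f0) = germ C X r (f \<cdot> ar X u)"
    if "f \<in> hom C (ob X t) (ob Y s)" "germ C X t f = \<phi> s" "u \<in> hom (shape X) r t" "v \<in> hom (shape Y) k s"
    for f t s u v
    using X.act_germ[OF t0 f0 Y.ar_hom[OF that(4)]] f0\<phi> component_compatible[OF that(4)] that(2)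
      X.germ_restrict[OF that(1,3)] by simp
  obtain t a0 a1 where a0: "a0 \<in> hom (shape X) t t0" and a1: "a1 \<in> hom (shape X) t r"
    and e1: "(ar Y v1 \<cdot> f0) \<cdot> ar X a0 = (f1 \<cdot> ar X u1) \<cdot> ar X a1"
    and e2: "(ar Y v2 \<cdot> f0) \<cdot> ar X a0 = (f2 \<cdot> ar X u2) \<cdot> ar X a1"
    using X.two_germs_eq[OF X.cmp_hom[OF f0 Y.ar_hom[OF k(1)]] X.restrict_hom[OF t1(2) r(1)] g[OF t1(2,3) r(1) k(1)]
        X.cmp_hom[OF f0 Y.ar_hom[OF k(2)]] X.restrict_hom[OF t2(2) r(2)] g[OF t2(2,3) r(2) k(2)] t0 rX]
    by metis
  obtain c where c: "T c = t" "S c = k" "F c = f0 \<cdot> ar X a0" using d[OF a0] by blast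
  show ?thesis
    using that[of c a1] c a1 e1 e2 X.cmp_assoc[OF X.ar_hom[OF a0] f0 Y.ar_hom[OF k(1)]]
      X.cmp_assoc[OF X.ar_hom[OF a0] f0 Y.ar_hom[OF k(2)]]
      X.restrict_restrict[OF t1(2) r(1) a1] X.restrict_restrict[OF t2(2) r(2) a1] by simp
qed

lemma index_over:
  assumes r: "u \<in> hom (shape X) r (T' c)" and k: "v \<in> hom (shape Y) k (S' c)"
  obtains c' u' where "S c' = k" "u' \<in> hom (shape X) (T c') r"
    "(c', c, \<xi> c \<cdot> (ar X (u \<cdot>\<^bsub>shape X\<^esub> u') \<cdot> a c'), \<upsilon> c \<cdot> (ar Y v \<cdot> b c')) \<in> hom index c' c"
proof -
  obtain c' u' where c': "S c' = k" "u' \<in> hom (shape X) (T c') r"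
    "F' c \<cdot> ar X (u \<cdot>\<^bsub>shape X\<^esub> u') = ar Y v \<cdot> F c'"
    using deeper_index[OF F'(1,3,4) F'(1,3,4) r r k k] by metis
  show ?thesis using that[OF c'(1,2) link[OF X.I.cmp_hom[OF c'(2) r] _ c'(3)]] k c'(1) by simp
qed

text \<open>The germs from \<open>X\<close> to \<open>A c\<close> and from \<open>Y\<close> to \<open>B c\<close> are compatible with all arrows of the index
  category; therefore they are morphisms of pro-objects.\<close>

lemma index_arrow_germs:
  assumes "(c', c, p, q) \<in> hom index c' c"
  shows "germ C X (T' c') (p \<cdot> \<xi> c') = germ C X (T' c) (\<xi> c)"
    and "germ C Y (S' c') (q \<cdot> \<upsilon> c') = germ C Y (S' c) (\<upsilon> c)"
proof -
  consider (id) "c' = c" "p = ident C (A c)" "q = ident C (B c)"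
    | (link) u v where "u \<in> hom (shape X) (T c') (T' c)" "v \<in> hom (shape Y) (S c') (S' c)"
        "p = \<xi> c \<cdot> (ar X u \<cdot> a c')" "q = \<upsilon> c \<cdot> (ar Y v \<cdot> b c')"
    using assms unfolding hom_index by blast
  then have "germ C X (T' c') (p \<cdot> \<xi> c') = germ C X (T' c) (\<xi> c) \<and>
    germ C Y (S' c') (q \<cdot> \<upsilon> c') = germ C Y (S' c) (\<upsilon> c)"
  proof cases
    case id
    then show ?thesis using X.cmp_ident_left[OF \<xi>] X.cmp_ident_left[OF \<upsilon>] by simp
  next
    case link
    note h = through_hom[OF link(1,2)]
    have "p \<cdot> \<xi> c' = \<xi> c \<cdot> ar X (u \<cdot>\<^bsub>shape X\<^esub> \<tau> c')"
      using link(3) X.cmp_assoc[OF \<xi> h(1) \<xi>] X.cmp_assoc[OF \<xi> a X.ar_hom[OF link(1)]] \<tau>(2)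
        X.ar_cmp[OF \<tau>(1) link(1)] by simp
    moreover have "q \<cdot> \<upsilon> c' = \<upsilon> c \<cdot> ar Y (v \<cdot>\<^bsub>shape Y\<^esub> \<sigma> c')"
      using link(4) X.cmp_assoc[OF \<upsilon> h(3) \<upsilon>] X.cmp_assoc[OF \<upsilon> b Y.ar_hom[OF link(2)]] \<sigma>(2)
        Y.ar_cmp[OF \<sigma>(1) link(2)] by simp
    ultimately show ?thesis
      using X.germ_restrict[OF \<xi> X.I.cmp_hom[OF \<tau>(1) link(1)]]
        Y.germ_restrict[OF \<upsilon> Y.I.cmp_hom[OF \<sigma>(1) link(2)]] by simp
  qed
  then show "germ C X (T' c') (p \<cdot> \<xi> c') = germ C X (T' c) (\<xi> c)"
    "germ C Y (S' c') (q \<cdot> \<upsilon> c') = germ C Y (S' c) (\<upsilon> c)" by auto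
qed

text \<open>Parallel arrows agree on the germs \<open>\<xi>\<close> and \<open>\<upsilon>\<close>, so they agree after restriction to deep enough indices
  of \<open>X\<close> and \<open>Y\<close>, and by \<open>index_over\<close> there is an arrow of the index category that factors through these.\<close>

lemma cofiltered_index: "cofiltered index"
  unfolding cofiltered_def
proof (intro conjI ballI allI category_index)
  show "obj index \<noteq> {}" by (simp add: index_def)
  fix c1 c2
  obtain r u1 u2 where u: "u1 \<in> hom (shape X) r (T' c1)" "u2 \<in> hom (shape X) r (T' c2)"
    using X.common_refinement[OF F'(1) F'(1)] .
  obtain k v1 v2 where v: "v1 \<in> hom (shape Y) k (S' c1)" "v2 \<in> hom (shape Y) k (S' c2)"
    using Y.common_refinement[OF F'(2) F'(2)] .
  obtain c u where c: "S c = k" "u \<in> hom (shape X) (T c) r"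
    "F' c1 \<cdot> ar X (u1 \<cdot>\<^bsub>shape X\<^esub> u) = ar Y v1 \<cdot> F c" "F' c2 \<cdot> ar X (u2 \<cdot>\<^bsub>shape X\<^esub> u) = ar Y v2 \<cdot> F c"
    using deeper_index[OF F'(1,3,4) F'(1,3,4) u v] by metis
  have "hom index c c1 \<noteq> {}" "hom index c c2 \<noteq> {}"
    using link[OF X.I.cmp_hom[OF c(2) u(1)] _ c(3)] link[OF X.I.cmp_hom[OF c(2) u(2)] _ c(4)] v c(1)
    by auto
  then show "\<exists>r \<in> obj index. hom index r c1 \<noteq> {} \<and> hom index r c2 \<noteq> {}"
    by (auto simp: index_def)
next
  fix c' c x y assume xy: "x \<in> hom index c' c" "y \<in> hom index c' c"
  obtain p q where x: "x = (c', c, p, q)" "(c', c, p, q) \<in> hom index c' c"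
    and p: "p \<in> hom C (A c') (A c)" "q \<in> hom C (B c') (B c)" using hom_index_cases[OF xy(1)] by metis
  obtain p' q' where y: "y = (c', c, p', q')" "(c', c, p', q') \<in> hom index c' c"
    and p': "p' \<in> hom C (A c') (A c)" "q' \<in> hom C (B c') (B c)" using hom_index_cases[OF xy(2)] by metis
  have "germ C X (T' c') (p \<cdot> \<xi> c') = germ C X (T' c') (p' \<cdot> \<xi> c')"
    "germ C Y (S' c') (q \<cdot> \<upsilon> c') = germ C Y (S' c') (q' \<cdot> \<upsilon> c')"
    using index_arrow_germs[OF x(2)] index_arrow_germs[OF y(2)] by auto
  then obtain r u k v where u: "u \<in> hom (shape X) r (T' c')" and v: "v \<in> hom (shape Y) k (S' c')"
    and eu: "(p \<cdot> \<xi> c') \<cdot> ar X u = (p' \<cdot> \<xi> c') \<cdot> ar X u"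
    and ev: "(q \<cdot> \<upsilon> c') \<cdot> ar Y v = (q' \<cdot> \<upsilon> c') \<cdot> ar Y v"
    using X.germ_eq_restrict[OF X.cmp_hom[OF \<xi> p(1)] X.cmp_hom[OF \<xi> p'(1)] F'(1)]
      Y.germ_eq_restrict[OF X.cmp_hom[OF \<upsilon> p(2)] X.cmp_hom[OF \<upsilon> p'(2)] F'(2)] by metis
  obtain d u' where d: "S d = k" "u' \<in> hom (shape X) (T d) r"
    and l: "(d, c', \<xi> c' \<cdot> (ar X (u \<cdot>\<^bsub>shape X\<^esub> u') \<cdot> a d), \<upsilon> c' \<cdot> (ar Y v \<cdot> b d)) \<in> hom index d c'"
    using index_over[OF u v] .
  have uu: "u \<cdot>\<^bsub>shape X\<^esub> u' \<in> hom (shape X) (T d) (T' c')" using X.I.cmp_hom[OF d(2) u] .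
  have v': "v \<in> hom (shape Y) (S d) (S' c')" using v d(1) by simp
  note h = through_hom[OF uu v']
  have ua: "ar X u' \<cdot> a d \<in> hom C (A d) (ob X r)" using X.cmp_hom[OF a X.ar_hom[OF d(2)]] .
  have bd: "b d \<in> hom C (B d) (ob Y k)" using b d(1) by metis
  have 1: "g \<cdot> (\<xi> c' \<cdot> (ar X (u \<cdot>\<^bsub>shape X\<^esub> u') \<cdot> a d)) = ((g \<cdot> \<xi> c') \<cdot> ar X u) \<cdot> (ar X u' \<cdot> a d)"
    if g: "g \<in> hom C (A c') (A c)" for g
    using X.cmp_assoc[OF h(1) \<xi> g] X.ar_cmp[OF d(2) u] X.cmp_assoc[OF a X.ar_hom[OF d(2)] X.ar_hom[OF u]]
      X.cmp_assoc[OF ua X.ar_hom[OF u] X.cmp_hom[OF \<xi> g]] by simp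
  have 2: "g \<cdot> (\<upsilon> c' \<cdot> (ar Y v \<cdot> b d)) = ((g \<cdot> \<upsilon> c') \<cdot> ar Y v) \<cdot> b d"
    if g: "g \<in> hom C (B c') (B c)" for g
    using X.cmp_assoc[OF h(3) \<upsilon> g] X.cmp_assoc[OF bd Y.ar_hom[OF v] X.cmp_hom[OF \<upsilon> g]] by simp
  have "p \<cdot> (\<xi> c' \<cdot> (ar X (u \<cdot>\<^bsub>shape X\<^esub> u') \<cdot> a d)) = p' \<cdot> (\<xi> c' \<cdot> (ar X (u \<cdot>\<^bsub>shape X\<^esub> u') \<cdot> a d))"
    "q \<cdot> (\<upsilon> c' \<cdot> (ar Y v \<cdot> b d)) = q' \<cdot> (\<upsilon> c' \<cdot> (ar Y v \<cdot> b d))"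
    using 1[OF p(1)] 1[OF p'(1)] 2[OF p(2)] 2[OF p'(2)] eu ev by auto
  then show "\<exists>d. \<exists>z \<in> hom index d c'. x \<cdot>\<^bsub>index\<^esub> z = y \<cdot>\<^bsub>index\<^esub> z"
    using l x(1) y(1) by (intro exI[of _ d] bexI[OF _ l]) (simp add: cmp_index)
qed

definition domain_diagram :: "('u, 'u \<times> 'u \<times> 'a \<times> 'a, 'o, 'a) diag" where
  "domain_diagram = \<lparr> shape = index, ob = A, ar = fst \<circ> snd \<circ> snd \<rparr>"

definition codomain_diagram :: "('u, 'u \<times> 'u \<times> 'a \<times> 'a, 'o, 'a) diag" where
  "codomain_diagram = \<lparr> shape = index, ob = B, ar = snd \<circ> snd \<circ> snd \<rparr>"

lemma is_diagram_domain: "is_diagram C domain_diagram"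
  and is_diagram_codomain: "is_diagram C codomain_diagram"
proof -
  have 1: "(fst \<circ> snd \<circ> snd) v \<in> hom C (A s) (A t)" "(snd \<circ> snd \<circ> snd) v \<in> hom C (B s) (B t)"
    if "v \<in> hom index s t" for s t v using hom_index_cases[OF that] by (metis comp_apply fst_conv snd_conv)+
  have 2: "(fst \<circ> snd \<circ> snd) (v \<cdot>\<^bsub>index\<^esub> u) = (fst \<circ> snd \<circ> snd) v \<cdot> (fst \<circ> snd \<circ> snd) u"
    "(snd \<circ> snd \<circ> snd) (v \<cdot>\<^bsub>index\<^esub> u) = (snd \<circ> snd \<circ> snd) v \<cdot> (snd \<circ> snd \<circ> snd) u" for u v
    by (cases u; cases v; simp add: cmp_index)+
  have 3: "(fst \<circ> snd \<circ> snd) (ident index c) = ident C (A c)"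
    "(snd \<circ> snd \<circ> snd) (ident index c) = ident C (B c)" for c by (simp_all add: index_def)
  show "is_diagram C domain_diagram"
    unfolding is_diagram_def domain_diagram_def diag.simps
    by (intro conjI ballI allI category_index A_obj 1 2 3)
  show "is_diagram C codomain_diagram"
    unfolding is_diagram_def codomain_diagram_def diag.simps
    by (intro conjI ballI allI category_index B_obj 1 2 3)
qed

text \<open>The maps \<open>w c\<close> form a level map in \<open>W\<close> over the recoded index category.  Its source is interleaved with
  \<open>X\<close> through \<open>\<xi>\<close> and \<open>a\<close>, its target with \<open>Y\<close> through \<open>\<upsilon>\<close> and \<open>b\<close>, and these isomorphisms identify it
  with \<open>\<phi>\<close>.\<close>

theorem in_pro_Lw:
  fixes e :: "'u \<times> 'u \<times> 'a \<times> 'a \<Rightarrow> 'u"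
  assumes inj: "inj_on e (arr index)"
  shows "(X, \<phi>, Y) \<in> pro_Lw C W"
proof -
  define X' where "X' = recode_diag e domain_diagram"
  define Y' where "Y' = recode_diag e codomain_diagram"
  have shX: "shape domain_diagram = index" and shY: "shape codomain_diagram = index"
    by (auto simp: domain_diagram_def codomain_diagram_def)
  note cat = category_index
  have sh: "shape X' = recode e index" "shape Y' = recode e index" and ob: "ob X' = A" "ob Y' = B"
    by (auto simp: X'_def Y'_def recode_diag_def domain_diagram_def codomain_diagram_def)
  have obI: "obj (recode e index) = UNIV" by (simp add: recode_def index_def)
  have hom: "hom (recode e index) s t = e ` hom index s t" for s t by (rule hom_recode[OF cat inj])
  have ar: "ar X' (e (c', c, p, q)) = p" "ar Y' (e (c', c, p, q)) = q"
    if "(c', c, p, q) \<in> hom index c' c" for c' c p q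
    using ar_recode[OF cat inj shX that] ar_recode[OF cat inj shY that]
    by (simp_all add: X'_def Y'_def domain_diagram_def codomain_diagram_def)
  have dX: "is_diagram C X'" and dY: "is_diagram C Y'"
    using is_diagram_recode[OF cat inj is_diagram_domain shX]
      is_diagram_recode[OF cat inj is_diagram_codomain shY] by (auto simp: X'_def Y'_def)
  have cof: "cofiltered (recode e index)" by (rule cofiltered_recode[OF cat inj cofiltered_index])
  have poX: "pro_object C X'" and poY: "pro_object C Y'"
    using dX dY cof sh X.category_axioms by (auto simp: pro_object_def pro_object_axioms_def)
  have nt: "nat_trans C X' Y' w"
    unfolding nat_trans_def sh ob
  proof (intro conjI dX dY allI ballI refl)
    show "w s \<in> hom C (A s) (B s)" for s by (rule w(2))
    fix s t x assume "x \<in> hom (recode e index) s t"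
    then obtain y where y: "y \<in> hom index s t" "x = e y" unfolding hom by blast
    obtain p q where pq: "y = (s, t, p, q)" "(s, t, p, q) \<in> hom index s t" "q \<cdot> w s = w t \<cdot> p"
      using hom_index_cases[OF y(1)] by metis
    show "w t \<cdot> ar X' x = ar Y' x \<cdot> w s" using ar[OF pq(2)] pq(1,3) y(2) by simp
  qed
  have cofX: "cofiltered (shape X')" using cof sh by simp
  note lev = pro_map_level[OF X.category_axioms nt cofX]
  have \<xi>': "\<xi> c \<in> hom C (ob X (T' c)) (ob X' c)" and \<upsilon>': "\<upsilon> c \<in> hom C (ob Y (S' c)) (ob Y' c)"
    and T'_obj: "T' c \<in> obj (shape X)" and S'_obj: "S' c \<in> obj (shape Y)" if "c \<in> UNIV" for c
    unfolding ob by (rule \<xi>, rule \<upsilon>, rule F'(1), rule F'(2))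
  have compat: "germ C X (T' c') (ar X' j \<cdot> \<xi> c') = germ C X (T' c) (\<xi> c)"
    "germ C Y (S' c') (ar Y' j \<cdot> \<upsilon> c') = germ C Y (S' c) (\<upsilon> c)"
    if jh: "j \<in> hom (recode e index) c' c" for c c' j
  proof -
    obtain y where y: "y \<in> hom index c' c" "j = e y" using jh unfolding hom by blast
    obtain p q where l: "(c', c, p, q) \<in> hom index c' c" and j: "j = e (c', c, p, q)"
      using hom_index_cases[OF y(1)] y(2) by metis
    show "germ C X (T' c') (ar X' j \<cdot> \<xi> c') = germ C X (T' c) (\<xi> c)"
      "germ C Y (S' c') (ar Y' j \<cdot> \<upsilon> c') = germ C Y (S' c) (\<upsilon> c)"
      using index_arrow_germs[OF l] ar[OF l] j by auto
  qed
  have liftX: "\<exists>c'. \<exists>j \<in> hom (recode e index) c' c. \<exists>m \<in> hom C (ob X' c') (ob X r). ar X' j = \<xi> c \<cdot> (ar X u \<cdot> m)"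
    if "c \<in> UNIV" and u: "u \<in> hom (shape X) r (T' c)" for c r u
  proof -
    obtain c' u' where c': "S c' = S' c" "u' \<in> hom (shape X) (T c') r"
      and l: "(c', c, \<xi> c \<cdot> (ar X (u \<cdot>\<^bsub>shape X\<^esub> u') \<cdot> a c'),
        \<upsilon> c \<cdot> (ar Y (ident (shape Y) (S' c)) \<cdot> b c')) \<in> hom index c' c"
      using index_over[OF u Y.I.ident_hom[OF F'(2)]] .
    have "ar X (u \<cdot>\<^bsub>shape X\<^esub> u') \<cdot> a c' = ar X u \<cdot> (ar X u' \<cdot> a c')"
      using X.ar_cmp[OF c'(2) u] X.cmp_assoc[OF a X.ar_hom[OF c'(2)] X.ar_hom[OF u]] by simp
    moreover have "ar X u' \<cdot> a c' \<in> hom C (ob X' c') (ob X r)"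
      using X.cmp_hom[OF a X.ar_hom[OF c'(2)]] ob by simp
    ultimately show ?thesis
      unfolding hom using ar(1)[OF l]
      by (intro exI[of _ c'] bexI[OF _ imageI[OF l]] bexI[of _ "ar X u' \<cdot> a c'"]) simp_all
  qed
  have liftY: "\<exists>c'. \<exists>j \<in> hom (recode e index) c' c. \<exists>m \<in> hom C (ob Y' c') (ob Y k). ar Y' j = \<upsilon> c \<cdot> (ar Y v \<cdot> m)"
    if "c \<in> UNIV" and v: "v \<in> hom (shape Y) k (S' c)" for c k v
  proof -
    obtain c' u' where c': "S c' = k" "u' \<in> hom (shape X) (T c') (T' c)"
      and l: "(c', c, \<xi> c \<cdot> (ar X (ident (shape X) (T' c) \<cdot>\<^bsub>shape X\<^esub> u') \<cdot> a c'),
        \<upsilon> c \<cdot> (ar Y v \<cdot> b c')) \<in> hom index c' c"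
      using index_over[OF X.I.ident_hom[OF F'(1)] v] .
    have "b c' \<in> hom C (ob Y' c') (ob Y k)" using b[of c'] c'(1) ob by simp
    then show ?thesis
      unfolding hom
      by (intro exI[of _ c'] bexI[OF _ imageI[OF l]] bexI[of _ "b c'"]) (simp_all add: ar(2)[OF l])
  qed
  have reachX: "\<exists>c \<in> UNIV. \<exists>m \<in> hom C (ob X' c) (ob X t).
      germ C X (T' c) (m \<cdot> \<xi> c) = germ C X t (ident C (ob X t))" if t: "t \<in> obj (shape X)" for t
  proof -
    obtain r u1 u2 where u1: "u1 \<in> hom (shape X) r (T' undefined)" and u2: "u2 \<in> hom (shape X) r t"
      using X.common_refinement[OF F'(1) t] .
    obtain c u' where c: "u' \<in> hom (shape X) (T c) r"
      using index_over[OF u1 Y.I.ident_hom[OF F'(2)]] by metis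
    have v: "u2 \<cdot>\<^bsub>shape X\<^esub> u' \<in> hom (shape X) (T c) t" using X.I.cmp_hom[OF c u2] .
    have i: "ident C (ob X t) \<in> hom C (ob X t) (ob X t)" using X.ident_hom[OF X.ob_obj[OF t]] .
    have "(ar X (u2 \<cdot>\<^bsub>shape X\<^esub> u') \<cdot> a c) \<cdot> \<xi> c = ident C (ob X t) \<cdot> ar X (u2 \<cdot>\<^bsub>shape X\<^esub> u' \<cdot>\<^bsub>shape X\<^esub> \<tau> c)"
      using X.cmp_assoc[OF \<xi> a X.ar_hom[OF v]] \<tau>(2) X.ar_cmp[OF \<tau>(1) v]
        X.cmp_ident_left[OF X.ar_hom[OF X.I.cmp_hom[OF \<tau>(1) v]]] by simp
    then have "germ C X (T' c) ((ar X (u2 \<cdot>\<^bsub>shape X\<^esub> u') \<cdot> a c) \<cdot> \<xi> c) = germ C X t (ident C (ob X t))"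
      using X.germ_restrict[OF i X.I.cmp_hom[OF \<tau>(1) v]] by simp
    then show ?thesis using X.cmp_hom[OF a X.ar_hom[OF v]] unfolding ob by blast
  qed
  have reachY: "\<exists>c \<in> UNIV. \<exists>m \<in> hom C (ob Y' c) (ob Y s).
      germ C Y (S' c) (m \<cdot> \<upsilon> c) = germ C Y s (ident C (ob Y s))" if s: "s \<in> obj (shape Y)" for s
  proof -
    obtain k v1 v2 where v1: "v1 \<in> hom (shape Y) k (S' undefined)" and v2: "v2 \<in> hom (shape Y) k s"
      using Y.common_refinement[OF F'(2) s] .
    obtain c u' where "S c = k" using index_over[OF X.I.ident_hom[OF F'(1)] v1] by metis
    then have v: "v2 \<in> hom (shape Y) (S c) s" using v2 by simp
    have i: "ident C (ob Y s) \<in> hom C (ob Y s) (ob Y s)" using X.ident_hom[OF Y.ob_obj[OF s]] .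
    have "(ar Y v2 \<cdot> b c) \<cdot> \<upsilon> c = ident C (ob Y s) \<cdot> ar Y (v2 \<cdot>\<^bsub>shape Y\<^esub> \<sigma> c)"
      using X.cmp_assoc[OF \<upsilon> b Y.ar_hom[OF v]] \<sigma>(2) Y.ar_cmp[OF \<sigma>(1) v]
        X.cmp_ident_left[OF Y.ar_hom[OF Y.I.cmp_hom[OF \<sigma>(1) v]]] by simp
    then have "germ C Y (S' c) ((ar Y v2 \<cdot> b c) \<cdot> \<upsilon> c) = germ C Y s (ident C (ob Y s))"
      using Y.germ_restrict[OF i Y.I.cmp_hom[OF \<sigma>(1) v]] by simp
    then show ?thesis using X.cmp_hom[OF b Y.ar_hom[OF v]] unfolding ob by blast
  qed
  obtain \<alpha> \<alpha>' where \<alpha>: "pro_map C X X' \<alpha>" "pro_map C X' X \<alpha>'" "\<And>c. c \<in> UNIV \<Longrightarrow> \<alpha> c = germ C X (T' c) (\<xi> c)"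
    "\<And>B x. x \<in> el (germs C X) B \<Longrightarrow> pull C X \<alpha> B (pull C X' \<alpha>' B x) = x"
    "\<And>B z. z \<in> el (germs C X') B \<Longrightarrow> pull C X' \<alpha>' B (pull C X \<alpha> B z) = z"
    by (rule interleaved_isomorphic[OF X.pro_object_axioms poX, of T' \<xi>, unfolded sh obI,
          OF T'_obj \<xi>' compat(1) liftX reachX]) (assumption | (rule that; assumption))+
  obtain \<beta> \<beta>' where \<beta>: "pro_map C Y Y' \<beta>" "pro_map C Y' Y \<beta>'" "\<And>c. c \<in> UNIV \<Longrightarrow> \<beta> c = germ C Y (S' c) (\<upsilon> c)"
    "\<And>B x. x \<in> el (germs C Y) B \<Longrightarrow> pull C Y \<beta> B (pull C Y' \<beta>' B x) = x"
    "\<And>B z. z \<in> el (germs C Y') B \<Longrightarrow> pull C Y' \<beta>' B (pull C Y \<beta> B z) = z"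
    by (rule interleaved_isomorphic[OF Y.pro_object_axioms poY, of S' \<upsilon>, unfolded sh obI,
          OF S'_obj \<upsilon>' compat(2) liftY reachY]) (assumption | (rule that; assumption))+
  interpret X': pro_object C X' by (rule poX)
  interpret Y': pro_object C Y' by (rule poY)
  interpret \<alpha>: pro_map C X X' \<alpha> by (rule \<alpha>)
  interpret \<beta>: pro_map C Y Y' \<beta> by (rule \<beta>)
  \<comment> \<open>The square formed by \<open>\<phi>\<close>, the level map and the two isomorphisms commutes because of \<open>rear\<close>.\<close>
  have "pull C X \<phi> D (pull C Y \<beta> D z) = pull C X \<alpha> D (pull C X' (level_map C X' Y' w) D z)"
    if z: "z \<in> el (germs C Y') D" for D z
  proof -
    obtain c g where c: "c \<in> obj (shape Y')" "c \<in> obj (shape X')" and g: "g \<in> hom C (B c) D"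
      and zg: "z = germ C Y' c g"
      using Y'.germ_cases[OF z] ob sh by metis
    have g': "g \<in> hom C (ob Y' c) D" using g ob by simp
    have gw: "g \<cdot> w c \<in> hom C (ob X' c) D" using X.cmp_hom[OF w(2) g] ob by simp
    have g\<upsilon>: "g \<cdot> \<upsilon> c \<in> hom C (ob Y (S' c)) D" using X.cmp_hom[OF \<upsilon> g] .
    have "pull C X \<phi> D (pull C Y \<beta> D z) = germ C X (T' c) ((g \<cdot> \<upsilon> c) \<cdot> F' c)"
      using \<beta>.pull_germ[OF c(1) g'] \<beta>(3)[OF UNIV_I] Y.act_germ[OF F'(2) \<upsilon> g] zg pull_germ[OF F'(2) g\<upsilon>]
        X.act_germ[OF F'(1,3) g\<upsilon>] F'(4) by simp
    also have "\<dots> = germ C X (T' c) ((g \<cdot> w c) \<cdot> \<xi> c)"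
      using X.cmp_assoc[OF F'(3) \<upsilon> g] X.cmp_assoc[OF \<xi> w(2) g] rear by simp
    also have "\<dots> = pull C X \<alpha> D (pull C X' (level_map C X' Y' w) D z)"
      using lev(2)[OF c(1) g'] zg \<alpha>.pull_germ[OF c(2) gw] \<alpha>(3)[OF UNIV_I] X.act_germ[OF F'(1) \<xi> X.cmp_hom[OF w(2) g]]
      by simp
    finally show ?thesis .
  qed
  then have "isomorphic (arrow_cat (pro_cat C)) (X, \<phi>, Y) (X', level_map C X' Y' w, Y')"
    by (intro isomorphic_pro_mapI[OF X.category_axioms pro_map_axioms lev(1) \<alpha>(1) \<beta>(1) \<alpha>(2) \<beta>(2) _ \<alpha>(4,5) \<beta>(4,5)])
  moreover have "(X, \<phi>, Y) \<in> arr (pro_cat C)" using pro_map_axioms by (simp add: X.pro_map_arr)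
  ultimately show ?thesis
    unfolding pro_Lw_def using nt cofX w(1) lev(3)
    by (intro CollectI conjI) (assumption, rule exI[of _ X'], rule exI[of _ Y'], rule exI[of _ w], simp)
qed

end

lemma infinite_surj_pairs:
  assumes "infinite (UNIV :: 'u set)"
  obtains h :: "'u \<Rightarrow> 'u \<times> 'u" where "surj h"
proof -
  include cardinal_syntax
  have "|UNIV :: ('u \<times> 'u) set| =o |UNIV :: 'u set|"
    using card_of_Times_same_infinite[OF assms] by (simp add: UNIV_Times_UNIV)
  then obtain h where "bij_betw h (UNIV :: 'u set) (UNIV :: ('u \<times> 'u) set)"
    using card_of_ordIso ordIso_symmetric by blast
  then show ?thesis using that by (auto simp: bij_betw_def)
qed

text \<open>An arrow is given by two indices together with one arrow from each of the index categories of \<open>X\<close> and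
  \<open>Y\<close>, or it is an identity.  An infinite type has room for such quadruples and for one further tag.\<close>

lemma (in level_approximation) index_small:
  assumes inf: "infinite (UNIV :: 'u set)"
  obtains e :: "'u \<times> 'u \<times> 'a \<times> 'a \<Rightarrow> 'u" where "inj_on e (arr index)"
proof -
  obtain h :: "'u \<Rightarrow> 'u \<times> 'u" where h: "surj h" using infinite_surj_pairs[OF inf] .
  obtain i0 i1 :: 'u where i: "i1 \<noteq> i0" using ex_new_if_finite[OF inf, of "{undefined}"] by blast
  define link where "link = (\<lambda>c' c u v. (c', c, \<xi> c \<cdot> (ar X u \<cdot> a c'), \<upsilon> c \<cdot> (ar Y v \<cdot> b c')))"
  define d where "d = (\<lambda>z. let (i, j) = h z; (x, y) = h j; (c', c) = h x; (u, v) = h y in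
    if i = i0 then (c, c, ident C (A c), ident C (B c)) else link c' c u v)"
  have pair: "\<exists>z. h z = (x, y)" for x y using h by (metis surjD)
  have code: "\<exists>z. d z = (if i = i0 then (c, c, ident C (A c), ident C (B c)) else link c' c u v)"
    for i c' c u v
  proof -
    obtain x y where "h x = (c', c)" "h y = (u, v)" using pair by metis
    moreover obtain j where "h j = (x, y)" using pair by metis
    moreover obtain z where "h z = (i, j)" using pair by metis
    ultimately have "d z = (if i = i0 then (c, c, ident C (A c), ident C (B c)) else link c' c u v)"
      by (simp add: d_def)
    then show ?thesis by blast
  qed
  have "arr index \<subseteq> range d"
  proof
    fix x assume x: "x \<in> arr index"
    obtain c' c p q where x': "x = (c', c, p, q)" by (cases x)
    have "x \<in> hom index c' c" using x x' by (simp add: hom_def index_def)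
    then consider "x = (c, c, ident C (A c), ident C (B c))" | u v where "x = link c' c u v"
      unfolding x' hom_index link_def by blast
    then have "\<exists>z. d z = x" using code[of i0] code[of i1] i by cases metis+
    then show "x \<in> range d" by (metis rangeI)
  qed
  then have "inj_on (inv_into UNIV d) (arr index)" by (rule inj_on_inv_into)
  then show ?thesis using that by blast
qed

text \<open>Approximability applied to a representative of \<open>\<phi>\<close> and the identity germs at its two ends.  Equations
  between germs become equations between maps by passing to deeper indices, first on \<open>Y\<close> and then on \<open>X\<close>.\<close>

lemma (in pro_map) factor_through_W:
  assumes ap: "approximable C W (germs C Y) (germs C X) (pull C X \<phi>)"
    and t: "t \<in> obj (shape X)" and s: "s \<in> obj (shape Y)" and f: "f \<in> hom C (ob X t) (ob Y s)"
    and rep: "germ C X t f = \<phi> s"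
  shows "\<exists>A B w a b t' s' f' \<xi> \<upsilon> \<tau> \<sigma>. w \<in> W \<and> w \<in> hom C A B \<and> a \<in> hom C A (ob X t) \<and>
    b \<in> hom C B (ob Y s) \<and> b \<cdot> w = f \<cdot> a \<and> t' \<in> obj (shape X) \<and> s' \<in> obj (shape Y) \<and>
    f' \<in> hom C (ob X t') (ob Y s') \<and> germ C X t' f' = \<phi> s' \<and>
    \<xi> \<in> hom C (ob X t') A \<and> \<upsilon> \<in> hom C (ob Y s') B \<and> w \<cdot> \<xi> = \<upsilon> \<cdot> f' \<and>
    \<tau> \<in> hom (shape X) t' t \<and> a \<cdot> \<xi> = ar X \<tau> \<and> \<sigma> \<in> hom (shape Y) s' s \<and> b \<cdot> \<upsilon> = ar Y \<sigma>"
proof -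
  note iX = X.ident_hom[OF X.ob_obj[OF t]] and iY = X.ident_hom[OF Y.ob_obj[OF s]]
  let ?x = "germ C X t (ident C (ob X t))" and ?y = "germ C Y s (ident C (ob Y s))"
  have "act (germs C X) f ?x = pull C X \<phi> (ob Y s) ?y"
    using X.act_germ[OF t iX f] X.cmp_ident_right[OF f] rep pull_component[OF s] by simp
  from approximableE[OF ap f X.germ_el[OF t iX] Y.germ_el[OF s iY] this]
  obtain A B w a b x y where w: "w \<in> W" "w \<in> hom C A B" and a: "a \<in> hom C A (ob X t)"
    and b: "b \<in> hom C B (ob Y s)" and bw: "b \<cdot> w = f \<cdot> a" and x: "x \<in> el (germs C X) A"
    and y: "y \<in> el (germs C Y) B" and wx: "act (germs C X) w x = pull C X \<phi> B y"
    and ax: "act (germs C X) a x = ?x" and by': "act (germs C Y) b y = ?y"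
    by metis
  obtain s1 \<upsilon>1 where s1: "s1 \<in> obj (shape Y)" and \<upsilon>1: "\<upsilon>1 \<in> hom C (ob Y s1) B" and y1: "y = germ C Y s1 \<upsilon>1"
    using Y.germ_cases[OF y] .
  have "germ C Y s1 (b \<cdot> \<upsilon>1) = ?y" using by' y1 Y.act_germ[OF s1 \<upsilon>1 b] by simp
  then obtain s' \<sigma>1 \<sigma> where \<sigma>1: "\<sigma>1 \<in> hom (shape Y) s' s1" and \<sigma>: "\<sigma> \<in> hom (shape Y) s' s"
    and e1: "(b \<cdot> \<upsilon>1) \<cdot> ar Y \<sigma>1 = ident C (ob Y s) \<cdot> ar Y \<sigma>"
    using Y.germ_eq[OF s1 X.cmp_hom[OF \<upsilon>1 b] s iY] by blast
  have s': "s' \<in> obj (shape Y)" using Y.I.hom_obj[OF \<sigma>] by simp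
  define \<upsilon> where "\<upsilon> = \<upsilon>1 \<cdot> ar Y \<sigma>1"
  have \<upsilon>: "\<upsilon> \<in> hom C (ob Y s') B" and y': "y = germ C Y s' \<upsilon>"
    using Y.restrict_hom[OF \<upsilon>1 \<sigma>1] Y.germ_restrict[OF \<upsilon>1 \<sigma>1] y1 by (auto simp: \<upsilon>_def)
  have b\<upsilon>: "b \<cdot> \<upsilon> = ar Y \<sigma>"
    using e1 X.cmp_assoc[OF Y.ar_hom[OF \<sigma>1] \<upsilon>1 b] X.cmp_ident_left[OF Y.ar_hom[OF \<sigma>]] by (simp add: \<upsilon>_def)
  obtain t1 \<xi>1 where t1: "t1 \<in> obj (shape X)" and \<xi>1: "\<xi>1 \<in> hom C (ob X t1) A" and x1: "x = germ C X t1 \<xi>1"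
    using X.germ_cases[OF x] .
  have "germ C X t1 (a \<cdot> \<xi>1) = ?x" using ax x1 X.act_germ[OF t1 \<xi>1 a] by simp
  then obtain t2 \<tau>1 \<tau>2 where \<tau>1: "\<tau>1 \<in> hom (shape X) t2 t1" and \<tau>2: "\<tau>2 \<in> hom (shape X) t2 t"
    and e2: "(a \<cdot> \<xi>1) \<cdot> ar X \<tau>1 = ident C (ob X t) \<cdot> ar X \<tau>2"
    using X.germ_eq[OF t1 X.cmp_hom[OF \<xi>1 a] t iX] by blast
  have t2: "t2 \<in> obj (shape X)" using X.I.hom_obj[OF \<tau>1] by simp
  define \<xi>2 where "\<xi>2 = \<xi>1 \<cdot> ar X \<tau>1"
  have \<xi>2: "\<xi>2 \<in> hom C (ob X t2) A" and x2: "x = germ C X t2 \<xi>2"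
    using X.restrict_hom[OF \<xi>1 \<tau>1] X.germ_restrict[OF \<xi>1 \<tau>1] x1 by (auto simp: \<xi>2_def)
  have a\<xi>2: "a \<cdot> \<xi>2 = ar X \<tau>2"
    using e2 X.cmp_assoc[OF X.ar_hom[OF \<tau>1] \<xi>1 a] X.cmp_ident_left[OF X.ar_hom[OF \<tau>2]] by (simp add: \<xi>2_def)
  obtain t3 f3 where t3: "t3 \<in> obj (shape X)" and f3: "f3 \<in> hom C (ob X t3) (ob Y s')"
    and f3\<phi>: "\<phi> s' = germ C X t3 f3"
    using X.germ_cases[OF component_el[OF s']] .
  have "germ C X t2 (w \<cdot> \<xi>2) = germ C X t3 (\<upsilon> \<cdot> f3)"
    using wx x2 X.act_germ[OF t2 \<xi>2 w(2)] y' pull_germ[OF s' \<upsilon>] f3\<phi> X.act_germ[OF t3 f3 \<upsilon>] by simp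
  then obtain t' u v where u: "u \<in> hom (shape X) t' t2" and v: "v \<in> hom (shape X) t' t3"
    and e3: "(w \<cdot> \<xi>2) \<cdot> ar X u = (\<upsilon> \<cdot> f3) \<cdot> ar X v"
    using X.germ_eq[OF t2 X.cmp_hom[OF \<xi>2 w(2)] t3 X.cmp_hom[OF f3 \<upsilon>]] by blast
  have t': "t' \<in> obj (shape X)" using X.I.hom_obj[OF u] by simp
  have "w \<cdot> (\<xi>2 \<cdot> ar X u) = \<upsilon> \<cdot> (f3 \<cdot> ar X v)"
    using e3 X.cmp_assoc[OF X.ar_hom[OF u] \<xi>2 w(2)] X.cmp_assoc[OF X.ar_hom[OF v] f3 \<upsilon>] by simp
  moreover have "a \<cdot> (\<xi>2 \<cdot> ar X u) = ar X (\<tau>2 \<cdot>\<^bsub>shape X\<^esub> u)"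
    using a\<xi>2 X.cmp_assoc[OF X.ar_hom[OF u] \<xi>2 a] X.ar_cmp[OF u \<tau>2] by simp
  moreover have "germ C X t' (f3 \<cdot> ar X v) = \<phi> s'" using X.germ_restrict[OF f3 v] f3\<phi> by simp
  ultimately show ?thesis
    using w a b bw t' s' X.restrict_hom[OF f3 v] X.restrict_hom[OF \<xi>2 u] \<upsilon> X.I.cmp_hom[OF u \<tau>2] \<sigma> b\<upsilon>
    by metis
qed

theorem approximable_pro_Lw:
  fixes C :: "('o, 'a) cat" (structure) and X Y :: "('u, 'o, 'a) sdiag"
  assumes inf: "infinite (UNIV :: 'u set)" and "pro_map C X Y \<phi>"
    and ap: "approximable C W (germs C Y) (germs C X) (pull C X \<phi>)"
  shows "(X, \<phi>, Y) \<in> pro_Lw C W"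
proof -
  interpret pro_map C X Y \<phi> by fact
  obtain h :: "'u \<Rightarrow> 'u \<times> 'u" where h: "surj h" using infinite_surj_pairs[OF inf] .
  have "\<exists>t f. t \<in> obj (shape X) \<and> f \<in> hom C (ob X t) (ob Y k) \<and> germ C X t f = \<phi> k"
    if "k \<in> obj (shape Y)" for k
    using X.germ_cases[OF component_el[OF that]] by metis
  then obtain t0 f0 where t0: "\<And>k. k \<in> obj (shape Y) \<Longrightarrow> t0 k \<in> obj (shape X)"
    "\<And>k. k \<in> obj (shape Y) \<Longrightarrow> f0 k \<in> hom C (ob X (t0 k)) (ob Y k)"
    "\<And>k. k \<in> obj (shape Y) \<Longrightarrow> germ C X (t0 k) (f0 k) = \<phi> k" by metis
  \<comment> \<open>All restrictions of one chosen representative of each component of \<open>\<phi>\<close>.  They are parametrized by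
    pairs of indices, hence by \<open>'u\<close> through \<open>h\<close>; values of \<open>g\<close> outside \<open>E\<close> are replaced by \<open>e0\<close>.\<close>
  define E where "E = {(t, k, f0 k \<cdot> ar X u) | t k u. k \<in> obj (shape Y) \<and> u \<in> hom (shape X) t (t0 k)}"
  define g where "g = (\<lambda>c. (src (shape X) (snd (h c)), fst (h c), f0 (fst (h c)) \<cdot> ar X (snd (h c))))"
  have Eg: "E \<subseteq> range g"
  proof
    fix x assume "x \<in> E"
    then obtain t k u where x: "x = (t, k, f0 k \<cdot> ar X u)" "u \<in> hom (shape X) t (t0 k)"
      by (auto simp: E_def)
    obtain c where "h c = (k, u)" using h by (metis surjD)
    then have "g c = x" using x by (simp add: g_def hom_def)
    then show "x \<in> range g" by blast
  qed
  obtain k0 where k0: "k0 \<in> obj (shape Y)" using Y.cofil by (auto simp: cofiltered_def)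
  obtain e0 where e0: "e0 \<in> E" using k0 X.I.ident_hom[OF t0(1)[OF k0]] unfolding E_def by blast
  define d where "d = (\<lambda>c. if g c \<in> E then g c else e0)"
  define T where "T = (\<lambda>c. fst (d c))"
  define S where "S = (\<lambda>c. fst (snd (d c)))"
  define F where "F = (\<lambda>c. snd (snd (d c)))"
  have dE: "(T c, S c, F c) \<in> E" for c using e0 by (simp add: d_def T_def S_def F_def)
  have F: "T c \<in> obj (shape X)" "S c \<in> obj (shape Y)" "F c \<in> hom C (ob X (T c)) (ob Y (S c))"
    "germ C X (T c) (F c) = \<phi> (S c)" for c
  proof -
    obtain u where u: "u \<in> hom (shape X) (T c) (t0 (S c))" and k: "S c \<in> obj (shape Y)"
      and Fc: "F c = f0 (S c) \<cdot> ar X u" using dE[of c] by (auto simp: E_def)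
    show "T c \<in> obj (shape X)" "S c \<in> obj (shape Y)" "F c \<in> hom C (ob X (T c)) (ob Y (S c))"
      "germ C X (T c) (F c) = \<phi> (S c)"
      using X.I.hom_obj[OF u] k X.restrict_hom[OF t0(2)[OF k] u] X.germ_restrict[OF t0(2)[OF k] u] t0(3)[OF k] Fc
      by auto
  qed
  have dense: "\<exists>t \<in> obj (shape X). \<exists>f \<in> hom C (ob X t) (ob Y k). germ C X t f = \<phi> k \<and>
        (\<forall>r. \<forall>u \<in> hom (shape X) r t. \<exists>c. T c = r \<and> S c = k \<and> F c = f \<cdot> ar X u)"
    if k: "k \<in> obj (shape Y)" for k
  proof -
    have "\<exists>c. T c = r \<and> S c = k \<and> F c = f0 k \<cdot> ar X u" if u: "u \<in> hom (shape X) r (t0 k)" for r u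
    proof -
      have x: "(r, k, f0 k \<cdot> ar X u) \<in> E" using k u unfolding E_def by blast
      then obtain c where "g c = (r, k, f0 k \<cdot> ar X u)" using Eg by (metis imageE subsetD)
      then have "d c = (r, k, f0 k \<cdot> ar X u)" using x by (simp add: d_def)
      then show ?thesis by (intro exI[of _ c]) (simp add: T_def S_def F_def)
    qed
    then show ?thesis using t0[OF k] by blast
  qed
  have "\<forall>c. \<exists>A B w a b t' s' f' \<xi> \<upsilon> \<tau> \<sigma>. w \<in> W \<and> w \<in> hom C A B \<and> a \<in> hom C A (ob X (T c)) \<and>
    b \<in> hom C B (ob Y (S c)) \<and> b \<cdot> w = F c \<cdot> a \<and> t' \<in> obj (shape X) \<and> s' \<in> obj (shape Y) \<and>
    f' \<in> hom C (ob X t') (ob Y s') \<and> germ C X t' f' = \<phi> s' \<and>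
    \<xi> \<in> hom C (ob X t') A \<and> \<upsilon> \<in> hom C (ob Y s') B \<and> w \<cdot> \<xi> = \<upsilon> \<cdot> f' \<and>
    \<tau> \<in> hom (shape X) t' (T c) \<and> a \<cdot> \<xi> = ar X \<tau> \<and> \<sigma> \<in> hom (shape Y) s' (S c) \<and> b \<cdot> \<upsilon> = ar Y \<sigma>"
    by (intro allI factor_through_W[OF ap F])
  then obtain A B w a b T' S' F' \<xi> \<upsilon> \<tau> \<sigma> where data: "\<forall>c. w c \<in> W \<and> w c \<in> hom C (A c) (B c) \<and>
    a c \<in> hom C (A c) (ob X (T c)) \<and>
    b c \<in> hom C (B c) (ob Y (S c)) \<and> b c \<cdot> w c = F c \<cdot> a c \<and> T' c \<in> obj (shape X) \<and> S' c \<in> obj (shape Y) \<and>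
    F' c \<in> hom C (ob X (T' c)) (ob Y (S' c)) \<and> germ C X (T' c) (F' c) = \<phi> (S' c) \<and>
    \<xi> c \<in> hom C (ob X (T' c)) (A c) \<and> \<upsilon> c \<in> hom C (ob Y (S' c)) (B c) \<and> w c \<cdot> \<xi> c = \<upsilon> c \<cdot> F' c \<and>
    \<tau> c \<in> hom (shape X) (T' c) (T c) \<and> a c \<cdot> \<xi> c = ar X (\<tau> c) \<and>
    \<sigma> c \<in> hom (shape Y) (S' c) (S c) \<and> b c \<cdot> \<upsilon> c = ar Y (\<sigma> c)"
    unfolding choice_iff by (elim exE) (rule that)
  interpret L: level_approximation C X Y \<phi> W T S T' S' F F' A B w a b \<xi> \<upsilon> \<tau> \<sigma>
    by unfold_locales (use data F in blast | rule dense; assumption)+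
  obtain e :: "'u \<times> 'u \<times> 'a \<times> 'a \<Rightarrow> 'u" where "inj_on e (arr L.index)" using L.index_small[OF inf] .
  then show ?thesis by (rule L.in_pro_Lw)
qed

section \<open>Two out of three in the pro-category\<close>

lemma approximable_cong:
  assumes "\<And>B y. y \<in> el G B \<Longrightarrow> \<phi> B y = \<psi> B y"
  shows "approximable C W G F \<phi> \<longleftrightarrow> approximable C W G F \<psi>"
proof -
  have "approximable C W G F \<psi>" if ap: "approximable C W G F \<phi>"
    and eq: "\<And>B y. y \<in> el G B \<Longrightarrow> \<phi> B y = \<psi> B y" for \<phi> \<psi>
    unfolding approximable_def
  proof (intro allI ballI impI)
    fix P R f x y assume *: "f \<in> hom C P R" "x \<in> el F P" "y \<in> el G R" "act F f x = \<psi> R y"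
    then have "act F f x = \<phi> R y" using eq by simp
    from approximableE[OF ap *(1-3) this] show "\<exists>A B w a b x' y'. w \<in> W \<and> w \<in> hom C A B \<and> a \<in> hom C A P \<and>
      b \<in> hom C B R \<and> b \<cdot>\<^bsub>C\<^esub> w = f \<cdot>\<^bsub>C\<^esub> a \<and> x' \<in> el F A \<and> y' \<in> el G B \<and> act F w x' = \<psi> B y' \<and>
          act F a x' = x \<and> act G b y' = y"
      using eq by metis
  qed
  from this[of \<phi> \<psi>] this[of \<psi> \<phi>] show ?thesis using assms by auto
qed

theorem (in proper_relative) pro_admissible:
  assumes inf: "infinite (UNIV :: 'u set)"
  shows "pro_admissible TYPE('u) C W"
proof -
  let ?P = "pro_cat C" and ?L = "pro_Lw C W :: (('u, 'o, 'a) sdiag \<times> ('u \<Rightarrow> ('u \<times> 'a) set) \<times> ('u, 'o, 'a) sdiag) set"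
  have Lw: "(X, \<phi>, Y) \<in> ?L \<longleftrightarrow> approximable C W (germs C Y) (germs C X) (pull C X \<phi>)"
    if "pro_map C X Y \<phi>" for X Y \<phi>
    using pro_Lw_approximable[OF category_axioms] approximable_pro_Lw[OF inf that] by blast
  have "(f \<in> ?L \<and> g \<in> ?L \<longrightarrow> g \<cdot>\<^bsub>?P\<^esub> f \<in> ?L) \<and> (f \<in> ?L \<and> g \<cdot>\<^bsub>?P\<^esub> f \<in> ?L \<longrightarrow> g \<in> ?L) \<and>
    (g \<in> ?L \<and> g \<cdot>\<^bsub>?P\<^esub> f \<in> ?L \<longrightarrow> f \<in> ?L)"
    if f: "f \<in> arr ?P" and g: "g \<in> arr ?P" and fg: "tgt ?P f = src ?P g" for f g
  proof -
    obtain X \<phi> Y where f': "f = (X, \<phi>, Y)" by (cases f)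
    obtain \<psi> Z where g': "g = (Y, \<psi>, Z)" using fg f' by (cases g) simp
    have pf: "pro_map C X Y \<phi>" and pg: "pro_map C Y Z \<psi>" using f g by (simp_all add: f' g' pro_map_arr)
    interpret \<phi>: pro_map C X Y \<phi> by (rule pf)
    interpret \<psi>: pro_map C Y Z \<psi> by (rule pg)
    note pc = pro_map_cmp[OF pf pg]
    have gf: "g \<cdot>\<^bsub>?P\<^esub> f \<in> ?L \<longleftrightarrow>
      approximable C W (germs C Z) (germs C X) (\<lambda>B z. pull C X \<phi> B (pull C Y \<psi> B z))"
      unfolding f' g' cmp_pro_cat Lw[OF pc(1)] by (rule approximable_cong) (rule pc(2))
    note flat = \<phi>.X.flat_functor_axioms \<phi>.Y.flat_functor_axioms \<psi>.Y.flat_functor_axioms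
    note all = flat \<phi>.pull_natural \<psi>.pull_natural
    show ?thesis
      unfolding gf unfolding f' g' Lw[OF pf] Lw[OF pg]
      using approximable_cmp[OF all] approximable_left[OF all] approximable_right[OF all] by blast
  qed
  then show ?thesis unfolding pro_admissible_def two_out_of_three_def by blast
qed

section \<open>Duality\<close>

definition opc :: "('o, 'a) cat \<Rightarrow> ('o, 'a) cat" where
  "opc C = \<lparr> obj = obj C, arr = arr C, src = tgt C, tgt = src C, ident = ident C,
     cmp = (\<lambda>g f. f \<cdot>\<^bsub>C\<^esub> g) \<rparr>"

definition opd :: "('i, 'j, 'o, 'a) diag \<Rightarrow> ('i, 'j, 'o, 'a) diag" where
  "opd X = \<lparr> shape = opc (shape X), ob = ob X, ar = ar X \<rparr>"

lemma opc_simps [simp]: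
  "obj (opc C) = obj C" "arr (opc C) = arr C" "src (opc C) = tgt C" "tgt (opc C) = src C"
  "ident (opc C) = ident C" "g \<cdot>\<^bsub>opc C\<^esub> f = f \<cdot>\<^bsub>C\<^esub> g" "hom (opc C) A B = hom C B A" "opc (opc C) = C"
  by (auto simp: opc_def hom_def)

lemma opd_simps [simp]:
  "shape (opd X) = opc (shape X)" "ob (opd X) = ob X" "ar (opd X) = ar X" "opd (opd X) = X"
  by (auto simp: opd_def)

lemma category_opc: "category C \<Longrightarrow> category (opc C)"
proof -
  assume "category C"
  then interpret category C .
  show "category (opc C)"
    by (unfold_locales; simp add: src_obj tgt_obj ident_hom cmp_ident_right cmp_ident_left)
      (erule (1) cmp_hom, erule (2) cmp_assoc[symmetric])
qed

lemma is_diagram_opd [simp]: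
  fixes C :: "('o, 'a) cat" and X :: "('i, 'j, 'o, 'a) diag"
  shows "is_diagram (opc C) (opd X) \<longleftrightarrow> is_diagram C X"
proof -
  have "is_diagram C X \<Longrightarrow> is_diagram (opc C) (opd X)" for C :: "('o, 'a) cat" and X :: "('i, 'j, 'o, 'a) diag"
    unfolding is_diagram_def by (simp add: category_opc)
  from this[of C X] this[of "opc C" "opd X"] show ?thesis by auto
qed

lemma cofiltered_opc [simp]: "cofiltered (opc I) \<longleftrightarrow> filtered I"
  using category_opc[of I] category_opc[of "opc I"]
  unfolding cofiltered_def filtered_def opc_simps by blast

lemma is_pullback_opc [simp]: "is_pullback (opc C) f i j k \<longleftrightarrow> is_pushout C f i j k"
  and is_pushout_opc [simp]: "is_pushout (opc C) f i j k \<longleftrightarrow> is_pullback C f i j k"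
  unfolding is_pullback_def is_pushout_def opc_simps by (rule refl)+

lemma proper_maps_opc [simp]:
  "left_proper_maps (opc C) W = right_proper_maps C W"
  "right_proper_maps (opc C) W = left_proper_maps C W"
  by (simp_all add: left_proper_maps_def right_proper_maps_def)

lemma (in proper_relative) proper_relative_opc: "proper_relative (opc C) W"
proof -
  have "category (opc C)" by (rule category_opc) (rule category_axioms)
  moreover have "proper_relative_axioms (opc C) W"
  proof
    show "\<exists>Q. \<exists>l \<in> left_proper_maps (opc C) W \<inter> hom (opc C) A Q.
          \<exists>r \<in> right_proper_maps (opc C) W \<inter> hom (opc C) Q B. m = r \<cdot>\<^bsub>opc C\<^esub> l"
      if "m \<in> hom (opc C) A B" for m A B using RP_LP[of m B A] that by auto
    show "\<exists>Q. \<exists>l \<in> W \<inter> hom (opc C) A Q.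
          \<exists>r \<in> right_proper_maps (opc C) W \<inter> hom (opc C) Q B. m = r \<cdot>\<^bsub>opc C\<^esub> l"
      if "m \<in> hom (opc C) A B" for m A B using W_LP[of m B A] that by auto
    show "\<exists>Q. \<exists>l \<in> left_proper_maps (opc C) W \<inter> hom (opc C) A Q.
          \<exists>r \<in> W \<inter> hom (opc C) Q B. m = r \<cdot>\<^bsub>opc C\<^esub> l"
      if "m \<in> hom (opc C) A B" for m A B using RP_W[of m B A] that by auto
    fix f g A B D assume fg: "f \<in> hom (opc C) A B" "g \<in> hom (opc C) B D"
    show "f \<in> W \<Longrightarrow> g \<in> W \<Longrightarrow> g \<cdot>\<^bsub>opc C\<^esub> f \<in> W"
      using W_cmp[of g f D B A] fg by simp
    show "f \<in> W \<Longrightarrow> g \<cdot>\<^bsub>opc C\<^esub> f \<in> W \<Longrightarrow> g \<in> W"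
      using W_right[of f g D B A] fg by simp
    show "g \<in> W \<Longrightarrow> g \<cdot>\<^bsub>opc C\<^esub> f \<in> W \<Longrightarrow> f \<in> W"
      using W_left[of g f D B A] fg by simp
  next
    fix f i A B D
    show "f \<in> hom (opc C) A B \<Longrightarrow> i \<in> hom (opc C) D B \<Longrightarrow> \<exists>j k. is_pullback (opc C) f i j k"
      using pushouts[of f B A i D] by simp
    show "f \<in> hom (opc C) A B \<Longrightarrow> i \<in> hom (opc C) A D \<Longrightarrow> \<exists>j k. is_pushout (opc C) f i j k"
      using pullbacks[of f B A i D] by simp
  qed
  ultimately show ?thesis by (simp add: proper_relative_def)
qed


text \<open>Reversing all arrows identifies the ind-category of \<open>C\<close> with the opposite of the pro-category of the
  opposite of \<open>C\<close>, already on the level of representatives.\<close>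

lemma ind_rep_eq: "ind_rep C A Y = pro_rep (opc C) (opd Y) A"
  by (simp add: ind_rep_def pro_rep_def)

lemma ind_rel_eq: "ind_rel C A Y = pro_rel (opc C) (opd Y) A"
  by (simp add: ind_rel_def pro_rel_def ind_rep_eq)

lemma ind_hom_eq: "ind_hom C X Y = pro_hom (opc C) (opd Y) (opd X)"
  unfolding ind_hom_def pro_hom_def ind_rep_eq ind_rel_eq by (simp, blast)

definition reverse :: "('i, 'j, 'o, 'a) diag \<times> 'p \<times> ('i, 'j, 'o, 'a) diag \<Rightarrow>
    ('i, 'j, 'o, 'a) diag \<times> 'p \<times> ('i, 'j, 'o, 'a) diag" where
  "reverse = (\<lambda>(X, \<phi>, Y). (opd Y, \<phi>, opd X))"

lemma reverse_reverse [simp]: "reverse (reverse f) = f"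
  by (cases f) (simp add: reverse_def)

lemma reverse_arr: "reverse f \<in> arr (pro_cat (opc C)) \<longleftrightarrow> f \<in> arr (ind_cat C)"
  by (cases f) (auto simp: reverse_def pro_cat_def ind_cat_def ind_hom_eq)

lemma reverse_ends:
  "src (pro_cat (opc C)) (reverse f) = opd (tgt (ind_cat C) f)"
  "tgt (pro_cat (opc C)) (reverse f) = opd (src (ind_cat C) f)"
  by (cases f, simp add: reverse_def pro_cat_def ind_cat_def)+

lemma reverse_cmp: "reverse (g \<cdot>\<^bsub>ind_cat C\<^esub> f) = reverse f \<cdot>\<^bsub>pro_cat (opc C)\<^esub> reverse g"
proof -
  obtain X \<phi> Y where f: "f = (X, \<phi>, Y)" by (cases f)
  obtain Y' \<psi> Z where g: "g = (Y', \<psi>, Z)" by (cases g)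
  have "{(r, g \<cdot>\<^bsub>C\<^esub> f) | t r f g. (t, f) \<in> \<phi> s \<and> (r, g) \<in> \<psi> t} =
    {(t, f \<cdot>\<^bsub>C\<^esub> g) | s' t f g. (s', g) \<in> \<phi> s \<and> (t, f) \<in> \<psi> s'}" for s by blast
  then show ?thesis
    unfolding f g by (simp add: reverse_def pro_cat_def ind_cat_def ind_rel_eq)
qed

lemma reverse_ident: "reverse (ident (ind_cat C) X) = ident (pro_cat (opc C)) (opd X)"
  by (simp add: reverse_def pro_cat_def ind_cat_def ind_rel_eq)

lemma reverse_induced: "reverse (ind_induced C X Y \<eta>) = pro_induced (opc C) (opd Y) (opd X) \<eta>"
  by (simp add: reverse_def ind_induced_def pro_induced_def ind_rel_eq)

lemma nat_trans_opc: "nat_trans (opc C) (opd Y) (opd X) \<eta> \<longleftrightarrow> nat_trans C X Y \<eta>"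
  unfolding nat_trans_def is_diagram_opd opd_simps opc_simps
  by (metis opc_simps(8))

lemma isomorphic_arrow_cat_anti:
  assumes R: "\<And>f. f \<in> arr P \<Longrightarrow> R f \<in> arr Q \<and> src Q (R f) = D (tgt P f) \<and> tgt Q (R f) = D (src P f)"
    and cmp: "\<And>f g. R (g \<cdot>\<^bsub>P\<^esub> f) = R f \<cdot>\<^bsub>Q\<^esub> R g" and ident: "\<And>A. R (ident P A) = ident Q (D A)"
    and iso: "isomorphic (arrow_cat P) f g"
  shows "isomorphic (arrow_cat Q) (R f) (R g)"
proof -
  obtain a b a' b' where f: "f \<in> arr P" and g: "g \<in> arr P"
    and ab: "a \<in> hom P (src P f) (src P g)" "b \<in> hom P (tgt P f) (tgt P g)"
    "a' \<in> hom P (src P g) (src P f)" "b' \<in> hom P (tgt P g) (tgt P f)"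
    and eqs: "b \<cdot>\<^bsub>P\<^esub> f = g \<cdot>\<^bsub>P\<^esub> a" "b' \<cdot>\<^bsub>P\<^esub> g = f \<cdot>\<^bsub>P\<^esub> a'"
    "a' \<cdot>\<^bsub>P\<^esub> a = ident P (src P f)" "b' \<cdot>\<^bsub>P\<^esub> b = ident P (tgt P f)"
    "a \<cdot>\<^bsub>P\<^esub> a' = ident P (src P g)" "b \<cdot>\<^bsub>P\<^esub> b' = ident P (tgt P g)"
    using iso unfolding isomorphic_arrow_cat by blast
  have hom: "R h \<in> hom Q (D B) (D A)" if "h \<in> hom P A B" for h A B
    using R[of h] that by (auto simp: hom_def)
  show ?thesis
    by (rule isomorphic_arrow_catI[of _ _ _ "R b'" "R a'" "R b" "R a"])
      (use R[OF f] R[OF g] hom[OF ab(1)] hom[OF ab(2)] hom[OF ab(3)] hom[OF ab(4)] eqs in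
        \<open>simp_all add: cmp[symmetric] ident\<close>)
qed

lemma isomorphic_reverse:
  "isomorphic (arrow_cat (pro_cat (opc C))) (reverse f) (reverse g) \<longleftrightarrow>
   isomorphic (arrow_cat (ind_cat C)) f g"
proof
  assume "isomorphic (arrow_cat (ind_cat C)) f g"
  then show "isomorphic (arrow_cat (pro_cat (opc C))) (reverse f) (reverse g)"
    by (rule isomorphic_arrow_cat_anti[rotated -1])
      (auto simp: reverse_arr reverse_ends reverse_cmp reverse_ident)
next
  assume iso: "isomorphic (arrow_cat (pro_cat (opc C))) (reverse f) (reverse g)"
  have "isomorphic (arrow_cat (ind_cat C)) (reverse (reverse f)) (reverse (reverse g))"
  proof (rule isomorphic_arrow_cat_anti[OF _ _ _ iso])
    show "reverse h \<in> arr (ind_cat C) \<and> src (ind_cat C) (reverse h) = opd (tgt (pro_cat (opc C)) h) \<and>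
      tgt (ind_cat C) (reverse h) = opd (src (pro_cat (opc C)) h)" if "h \<in> arr (pro_cat (opc C))" for h
      using that reverse_arr[of "reverse h" C] reverse_ends[of C "reverse h"] by simp
    show "reverse (h \<cdot>\<^bsub>pro_cat (opc C)\<^esub> k) = reverse k \<cdot>\<^bsub>ind_cat C\<^esub> reverse h" for h k
      using arg_cong[OF reverse_cmp[of C "reverse k" "reverse h"], of reverse] by simp
    show "reverse (ident (pro_cat (opc C)) X) = ident (ind_cat C) (opd X)" for X
      using arg_cong[OF reverse_ident[of C "opd X"], of reverse] by simp
  qed
  then show "isomorphic (arrow_cat (ind_cat C)) f g" by simp
qed

lemma ind_Lw_reverse: "f \<in> ind_Lw C W \<longleftrightarrow> reverse f \<in> pro_Lw (opc C) W"
proof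
  assume "f \<in> ind_Lw C W"
  then obtain X Y \<eta> where "f \<in> arr (ind_cat C)" and nt: "nat_trans C X Y \<eta>" and fil: "filtered (shape X)"
    and W: "\<forall>s \<in> obj (shape X). \<eta> s \<in> W" and iso: "isomorphic (arrow_cat (ind_cat C)) f (ind_induced C X Y \<eta>)"
    unfolding ind_Lw_def by blast
  have "shape Y = shape X" using nt by (simp add: nat_trans_def)
  then show "reverse f \<in> pro_Lw (opc C) W"
    unfolding pro_Lw_def using \<open>f \<in> arr (ind_cat C)\<close> nt fil W iso
    by (intro CollectI conjI exI[of _ "opd Y"] exI[of _ "opd X"] exI[of _ \<eta>])
      (simp_all add: reverse_arr nat_trans_opc flip: reverse_induced isomorphic_reverse)
next
  assume "reverse f \<in> pro_Lw (opc C) W"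
  then obtain X Y \<eta> where "reverse f \<in> arr (pro_cat (opc C))" and nt: "nat_trans (opc C) X Y \<eta>"
    and fil: "cofiltered (shape X)" and W: "\<forall>s \<in> obj (shape X). \<eta> s \<in> W"
    and iso: "isomorphic (arrow_cat (pro_cat (opc C))) (reverse f) (pro_induced (opc C) X Y \<eta>)"
    unfolding pro_Lw_def by blast
  have sh: "shape Y = shape X" using nt by (simp add: nat_trans_def)
  have nt': "nat_trans C (opd Y) (opd X) \<eta>"
    using nt nat_trans_opc[of C "opd X" "opd Y" \<eta>] by simp
  have "filtered (shape (opd Y))"
    using fil sh cofiltered_opc[of "opc (shape X)"] by simp
  moreover have "isomorphic (arrow_cat (ind_cat C)) f (ind_induced C (opd Y) (opd X) \<eta>)"
    using iso isomorphic_reverse[of C f "ind_induced C (opd Y) (opd X) \<eta>"]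
      reverse_induced[of C "opd Y" "opd X" \<eta>] by simp
  ultimately show "f \<in> ind_Lw C W"
    unfolding ind_Lw_def using \<open>reverse f \<in> arr (pro_cat (opc C))\<close> nt' W sh
    by (intro CollectI conjI exI[of _ "opd Y"] exI[of _ "opd X"] exI[of _ \<eta>])
      (simp_all add: reverse_arr)
qed

lemma ind_admissible_opc:
  fixes C :: "('o, 'a) cat"
  assumes "pro_admissible TYPE('u) (opc C) W"
  shows "ind_admissible TYPE('u) C W"
  unfolding ind_admissible_def two_out_of_three_def
proof (intro ballI impI)
  fix f g :: "('u, 'o, 'a) sdiag \<times> ('u \<Rightarrow> ('u \<times> 'a) set) \<times> ('u, 'o, 'a) sdiag"
  assume f: "f \<in> arr (ind_cat C)" and g: "g \<in> arr (ind_cat C)" and fg: "tgt (ind_cat C) f = src (ind_cat C) g"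
  have "tgt (pro_cat (opc C)) (reverse g) = src (pro_cat (opc C)) (reverse f)"
    using fg by (simp add: reverse_ends)
  then show "(f \<in> ind_Lw C W \<and> g \<in> ind_Lw C W \<longrightarrow> g \<cdot>\<^bsub>ind_cat C\<^esub> f \<in> ind_Lw C W) \<and>
    (f \<in> ind_Lw C W \<and> g \<cdot>\<^bsub>ind_cat C\<^esub> f \<in> ind_Lw C W \<longrightarrow> g \<in> ind_Lw C W) \<and>
    (g \<in> ind_Lw C W \<and> g \<cdot>\<^bsub>ind_cat C\<^esub> f \<in> ind_Lw C W \<longrightarrow> f \<in> ind_Lw C W)"
    using assms f g unfolding pro_admissible_def two_out_of_three_def ind_Lw_reverse reverse_cmp
    by (metis reverse_arr)
qed

section \<open>Pullbacks and pushouts from finite limits and colimits\<close>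

text \<open>The identities are the objects \<open>0\<close>, \<open>1\<close>, \<open>2\<close> themselves; the arrows \<open>3\<close> and \<open>4\<close> lead from \<open>0\<close> and \<open>1\<close>
  to \<open>2\<close>.\<close>

definition cospan :: "(nat, nat) cat" where
  "cospan = \<lparr> obj = {0, 1, 2}, arr = {0, 1, 2, 3, 4},
     src = (\<lambda>u. if u = 3 then 0 else if u = 4 then 1 else u), tgt = (\<lambda>u. if u < 3 then u else 2),
     ident = (\<lambda>s. s), cmp = (\<lambda>v u. if v < 3 then u else v) \<rparr>"

lemma hom_cospan: "u \<in> hom cospan s t \<longleftrightarrow>
    u = s \<and> t = s \<and> s \<in> {0, 1, 2} \<or> u = 3 \<and> s = 0 \<and> t = 2 \<or> u = 4 \<and> s = 1 \<and> t = 2"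
  by (auto simp: hom_def cospan_def)

lemma category_cospan: "category cospan"
proof
  show "h \<cdot>\<^bsub>cospan\<^esub> (g \<cdot>\<^bsub>cospan\<^esub> f) = (h \<cdot>\<^bsub>cospan\<^esub> g) \<cdot>\<^bsub>cospan\<^esub> f"
    if "f \<in> hom cospan A B" "g \<in> hom cospan B D" "h \<in> hom cospan D E" for f g h A B D E
    by (simp add: cospan_def)
qed (auto simp: hom_cospan, auto simp: cospan_def)

lemma pullback_from_finite_limits:
  fixes C :: "('o, 'a) cat" (structure)
  assumes "category C" and lim: "has_finite_limits C"
    and f: "f \<in> hom C A B" and i: "i \<in> hom C D B"
  shows "\<exists>j k. is_pullback C f i j k"
proof -
  interpret category C by fact
  have A: "A \<in> obj C" and B: "B \<in> obj C" and D: "D \<in> obj C" using hom_obj[OF f] hom_obj[OF i] by auto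
  define X :: "(nat, nat, 'o, 'a) diag" where "X = \<lparr> shape = cospan,
    ob = (\<lambda>s. if s = 0 then A else if s = 1 then D else B),
    ar = (\<lambda>u. if u = 0 then ident C A else if u = 1 then ident C D else if u = 2 then ident C B
      else if u = 3 then f else i) \<rparr>"
  have sh: "shape X = cospan" and obc: "obj cospan = {0, 1, 2}"
    and obX: "ob X 0 = A" "ob X (Suc 0) = D" "ob X 1 = D" "ob X 2 = B"
    and arX: "ar X 0 = ident C A" "ar X (Suc 0) = ident C D" "ar X 1 = ident C D" "ar X 2 = ident C B" "ar X 3 = f" "ar X 4 = i"
    and cmpc: "v \<cdot>\<^bsub>cospan\<^esub> u = (if v < 3 then u else v)" and idc: "ident cospan s = s" for u v s
    by (simp_all add: X_def cospan_def)
  have "is_diagram C X"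
    unfolding is_diagram_def sh
  proof (intro conjI category_cospan ballI allI)
    show "ob X s \<in> obj C" "ar X (ident cospan s) = ident C (ob X s)" if "s \<in> obj cospan" for s
      using that A B D by (auto simp: obc obX arX idc)
    show "ar X u \<in> hom C (ob X s) (ob X t)" if "u \<in> hom cospan s t" for s t u
      using that f i ident_hom[OF A] ident_hom[OF B] ident_hom[OF D] by (auto simp: hom_cospan obX arX)
    show "ar X (v \<cdot>\<^bsub>cospan\<^esub> u) = ar X v \<cdot> ar X u" if "u \<in> hom cospan r s" "v \<in> hom cospan s t" for r s t u v
      using that f i A B D cmp_ident_left[OF f] cmp_ident_right[OF f] cmp_ident_left[OF i] cmp_ident_right[OF i]
      by (auto simp: hom_cospan cmpc arX)
  qed
  then have "is_finite_diagram C X" by (simp add: is_finite_diagram_def sh) (simp add: cospan_def)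
  then obtain L p where L: "is_limit C X L p" using lim unfolding has_finite_limits_def by blast
  have cone: "is_cone C X L p" using L by (simp add: is_limit_def)
  have p: "p 0 \<in> hom C L A" "p 1 \<in> hom C L D" "p 2 \<in> hom C L B"
    using cone by (auto simp: is_cone_def sh obc obX)
  have fp: "f \<cdot> p 0 = p 2" "i \<cdot> p 1 = p 2"
  proof -
    have "3 \<in> hom cospan 0 2" "4 \<in> hom cospan 1 2" by (auto simp: hom_cospan)
    then show "f \<cdot> p 0 = p 2" "i \<cdot> p 1 = p 2"
      using cone unfolding is_cone_def sh by (metis arX)+
  qed
  have "\<exists>!h. h \<in> hom C T L \<and> p 0 \<cdot> h = u \<and> p 1 \<cdot> h = v"
    if u: "u \<in> hom C T A" and v: "v \<in> hom C T D" and uv: "f \<cdot> u = i \<cdot> v" for T u v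
  proof -
    define q where "q = (\<lambda>s::nat. if s = 0 then u else if s = 1 then v else f \<cdot> u)"
    have fu: "f \<cdot> u \<in> hom C T B" using cmp_hom[OF u f] .
    have "is_cone C X T q"
      unfolding is_cone_def sh
    proof (intro conjI ballI allI)
      show "T \<in> obj C" using hom_obj[OF u] by simp
      show "q s \<in> hom C T (ob X s)" if "s \<in> obj cospan" for s
        using that u v fu by (auto simp: obc obX q_def)
      show "ar X w \<cdot> q s = q t" if "w \<in> hom cospan s t" for s t w
        using that uv cmp_ident_left[OF u] cmp_ident_left[OF v] cmp_ident_left[OF fu]
        by (auto simp: hom_cospan arX q_def)
    qed
    then have "\<exists>!h. h \<in> hom C T L \<and> (\<forall>s \<in> obj cospan. p s \<cdot> h = q s)"
      using L unfolding is_limit_def sh by blast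
    moreover have "(\<forall>s \<in> obj cospan. p s \<cdot> h = q s) \<longleftrightarrow> p 0 \<cdot> h = u \<and> p 1 \<cdot> h = v"
      if h: "h \<in> hom C T L" for h
      using cmp_assoc[OF h p(1) f] fp(1) by (auto simp: obc q_def)
    ultimately show ?thesis by (metis (no_types, lifting))
  qed
  then have "is_pullback C f i (p 0) (p 1)"
    using f i p fp unfolding is_pullback_def by (simp add: hom_def)
  then show ?thesis by blast
qed

lemma has_finite_limits_opc:
  assumes "has_finite_colimits C"
  shows "has_finite_limits (opc C)"
  unfolding has_finite_limits_def
proof (intro allI impI)
  fix X :: "(nat, nat, 'a, 'b) diag" assume X: "is_finite_diagram (opc C) X"
  then have "is_finite_diagram C (opd X)"
    using is_diagram_opd[of "opc C" X] by (simp add: is_finite_diagram_def)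
  then obtain L p where L: "is_colimit C (opd X) L p" using assms unfolding has_finite_colimits_def by blast
  have cone: "is_cone (opc C) X M q \<longleftrightarrow> is_cocone C (opd X) M q" for M q
    unfolding is_cone_def is_cocone_def by auto
  have "is_limit (opc C) X L p"
    using L unfolding is_limit_def is_colimit_def cone by simp
  then show "\<exists>L p. is_limit (opc C) X L p" by blast
qed

section \<open>Admissibility\<close>

lemma proper_relativeI:
  fixes C :: "('o, 'a) cat" (structure)
  assumes rel: "relative_category C W" and lim: "has_finite_limits C" and colim: "has_finite_colimits C"
    and fact: "has_proper_factorizations C W"
  shows "proper_relative C W"
proof -
  interpret category C using rel by (simp add: relative_category_def)
  have fac: "\<exists>Q. \<exists>l \<in> N \<inter> hom C A Q. \<exists>r \<in> M \<inter> hom C Q B. m = r \<cdot> l"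
    if "arr C = class_comp C M N" "M \<subseteq> arr C" "N \<subseteq> arr C" "m \<in> hom C A B" for M N m A B
  proof -
    have "m \<in> class_comp C M N" using that by (simp add: hom_def)
    then obtain r l where *: "m = r \<cdot> l" "r \<in> M" "l \<in> N" "tgt C l = src C r"
      by (auto simp: class_comp_def)
    have "l \<in> arr C" "r \<in> arr C" using * that(2,3) by auto
    then have "l \<in> hom C A (src C r)" "r \<in> hom C (src C r) B"
      using * homD[OF that(4)] arr_cmp[of l r] by (auto intro: homI)
    then show ?thesis using * by blast
  qed
  have W: "W \<subseteq> arr C" and RP: "right_proper_maps C W \<subseteq> arr C" and LP: "left_proper_maps C W \<subseteq> arr C"
    using rel by (auto simp: relative_category_def right_proper_maps_def left_proper_maps_def)
  have two: "two_out_of_three C W" using rel by (simp add: relative_category_def)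
  have "proper_relative_axioms C W"
  proof
    fix f g A B D assume "f \<in> hom C A B" "g \<in> hom C B D"
    then have *: "f \<in> arr C" "g \<in> arr C" "tgt C f = src C g" by (auto simp: hom_def)
    show "f \<in> W \<Longrightarrow> g \<in> W \<Longrightarrow> g \<cdot> f \<in> W" "f \<in> W \<Longrightarrow> g \<cdot> f \<in> W \<Longrightarrow> g \<in> W"
      "g \<in> W \<Longrightarrow> g \<cdot> f \<in> W \<Longrightarrow> f \<in> W"
      using two * unfolding two_out_of_three_def by blast+
  next
    fix f A B i D assume "f \<in> hom C A B" "i \<in> hom C D B"
    then show "\<exists>j k. is_pullback C f i j k" using pullback_from_finite_limits[OF category_axioms lim] by blast
  next
    fix f A B i D assume "f \<in> hom C A B" "i \<in> hom C A D"
    then have "\<exists>j k. is_pullback (opc C) f i j k"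
      using pullback_from_finite_limits[OF category_opc[OF category_axioms] has_finite_limits_opc[OF colim]] by simp
    then show "\<exists>j k. is_pushout C f i j k" by simp
  qed (use fac[OF _ RP LP] fac[OF _ RP W] fac[OF _ W LP] fact in \<open>auto simp: has_proper_factorizations_def\<close>)
  then show ?thesis by (simp add: proper_relative_def category_axioms)
qed

lemma proper_relative_admissible:
  assumes "infinite (UNIV :: 'u set)" "proper_relative C W"
  shows "admissible TYPE('u) C W"
  unfolding admissible_def
  using proper_relative.pro_admissible[OF assms(2,1)]
    ind_admissible_opc[OF proper_relative.pro_admissible[OF proper_relative.proper_relative_opc[OF assms(2)] assms(1)]]
  by blast

text \<open>Weak equivalences include the identities, by two out of three applied to \<open>i = i \<circ> 1\<close> for a trivial
  cofibration \<open>i\<close> obtained by factoring the identity, and an isomorphism is a retract of an identity.\<close>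

lemma model_category_isos:
  fixes C :: "('o, 'a) cat" (structure)
  assumes M: "model_category C W Cof Fib"
  shows "isos C \<subseteq> W"
proof
  interpret category C using M by (simp add: model_category_def)
  have two: "two_out_of_three C W" and WC: "W \<subseteq> arr C" using M by (auto simp: model_category_def)
  fix f assume "f \<in> isos C"
  then obtain g where f: "f \<in> arr C" and g: "g \<in> hom C (tgt C f) (src C f)"
    and gf: "g \<cdot> f = ident C (src C f)" and fg: "f \<cdot> g = ident C (tgt C f)"
    by (auto simp: isos_def)
  let ?A = "src C f" and ?B = "tgt C f"
  have A: "?A \<in> obj C" and B: "?B \<in> obj C" using src_obj[OF f] tgt_obj[OF f] .
  have "ident C ?A \<in> class_comp C Fib (Cof \<inter> W)" using M arr_ident(1)[OF A] by (simp add: model_category_def)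
  then obtain p i where i: "i \<in> W" and p: "p \<in> arr C" and ip: "tgt C i = src C p" and pi: "ident C ?A = p \<cdot> i"
    using M by (auto simp: class_comp_def model_category_def)
  have ia: "i \<in> arr C" using i WC by blast
  have srci: "src C i = ?A" using arr_cmp(2)[OF ia p ip] arr_ident(2)[OF A] pi by simp
  have "ident C ?A \<in> W"
    using two ia arr_ident[OF A] srci ident_cmp(1)[OF ia srci[symmetric]] i unfolding two_out_of_three_def by metis
  moreover have "is_retract (arrow_cat C) f (ident C ?A)"
    unfolding is_retract_def
  proof (intro bexI)
    let ?s = "(f, (ident C ?A, g), ident C ?A)" and ?r = "(ident C ?A, (ident C ?A, f), f)"
    show "?s \<in> hom (arrow_cat C) f (ident C ?A)" "?r \<in> hom (arrow_cat C) (ident C ?A) f"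
      using f g gf A B by (auto simp: arrow_cat_def hom_def)
    show "?r \<cdot>\<^bsub>arrow_cat C\<^esub> ?s = ident (arrow_cat C) f"
      using A fg by (simp add: arrow_cat_def)
  qed
  ultimately show "f \<in> W"
    using M f unfolding model_category_def retract_closed_def by blast
qed

lemma proper_model_category_relative:
  assumes M: "proper_model_category C W Cof Fib"
  shows "relative_category C W" "has_finite_limits C" "has_finite_colimits C" "has_proper_factorizations C W"
proof -
  have mc: "model_category C W Cof Fib" using M by (simp add: proper_model_category_def)
  interpret category C using mc by (simp add: model_category_def)
  have sub: "W \<subseteq> arr C" "Cof \<subseteq> arr C" "Fib \<subseteq> arr C" and two: "two_out_of_three C W"
    and lim: "has_finite_limits C" "has_finite_colimits C"
    and fac: "arr C = class_comp C Fib (Cof \<inter> W)" "arr C = class_comp C (Fib \<inter> W) Cof"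
    using mc unfolding model_category_def by blast+
  show "has_finite_limits C" "has_finite_colimits C" by fact+
  show "relative_category C W"
    using two sub model_category_isos[OF mc] category_axioms
    unfolding relative_category_def two_out_of_three_def by blast
  have LP: "Cof \<subseteq> left_proper_maps C W" and RP: "Fib \<subseteq> right_proper_maps C W"
    using M sub unfolding proper_model_category_def left_proper_maps_def right_proper_maps_def by blast+
  have cc: "arr C = class_comp C M' N'" if "arr C = class_comp C M N" "M \<subseteq> M'" "N \<subseteq> N'"
    "M' \<subseteq> arr C" "N' \<subseteq> arr C" for M N M' N'
  proof
    show "arr C \<subseteq> class_comp C M' N'" using that(2,3) unfolding that(1) class_comp_def by blast
    show "class_comp C M' N' \<subseteq> arr C" using that(4,5) arr_cmp(1) unfolding class_comp_def by blast
  qed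
  have sub': "right_proper_maps C W \<subseteq> arr C" "left_proper_maps C W \<subseteq> arr C"
    by (auto simp: right_proper_maps_def left_proper_maps_def)
  show "has_proper_factorizations C W"
    unfolding has_proper_factorizations_def
    by (intro conjI cc[OF fac(1) RP _ sub'] cc[OF fac(1) RP _ sub'(1) sub(1)] cc[OF fac(2) _ LP sub(1) sub'(2)])
      (use LP in auto)
qed

theorem corollary3p8:
  fixes C :: "('o, 'a) cat" and W :: "'a set"
  assumes "infinite (UNIV :: 'u set)"
  shows "(relative_category C W \<and> has_finite_limits C \<and> has_finite_colimits C \<and>
            has_proper_factorizations C W \<longrightarrow> admissible TYPE('u) C W) \<and>
         (\<forall>Cof Fib. proper_model_category C W Cof Fib \<longrightarrow> admissible TYPE('u) C W)"
  using proper_relative_admissible[OF assms] proper_relativeI proper_model_category_relative by metis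

end
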